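(* Let $n\ge1$ and $\ell\ge1$. The module $U_{2n,\ell}$ is a free $R_{2n}$-module of rank $\binom{2n}{\ell}$ with basis the elements $v_I^{(2n)}\wedge w_J^{(2n)}\wedge\xi_K^{(2n)}$: $$U_{2n,\ell}=\bigoplus_{I,J,K}R_{2n}\,v_I^{(2n)}\wedge w_J^{(2n)}\wedge\xi_K^{(2n)},$$ where $(I,J,K)$ runs over all triples of index sets $I=(i_1,\dots,i_{\ell_1})$, $J=(j_1,\dots,j_{\ell_2})$, $K=(k_1,\dots,k_{\ell_3})$ (with $\ell_1,\ell_2,\ell_3\ge0$) satisfying $$1\le i_1<\cdots<i_{\ell_1}\le n,\quad 1\le j_1<\cdots<j_{\ell_2}\le n-\ell_1-\ell_3,\quad 1\le k_1\le\cdots\le k_{\ell_3}\le n-\ell_1-\ell_3+1,\quad \ell_1+\ell_2+2\ell_3=\ell.$$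
   Context: $R_{2n}$ is the ring of symmetric polynomials in $x_1,\dots,x_{2n}$ over $\mathbb C$; $H^{(2n)}=\bigoplus_{k=0}^{2n-1}R_{2n}X^k$. $\wedge^\ell H^{(2n)}$ (exterior power over $R_{2n}$) is identified with the space of anti-symmetric polynomials $P(X_1,\dots,X_\ell|x_1,\dots,x_{2n})$ in $X_1,\dots,X_\ell$ of degree less than $2n$ in each $X_a$ with coefficients in $R_{2n}$, via $X^{i_1}\wedge\cdots\wedge X^{i_\ell}\mapsto\sum_{\sigma\in S_\ell}\operatorname{sgn}\sigma\,X_{\sigma(1)}^{i_1}\cdots X_{\sigma(\ell)}^{i_\ell}$. $U_{2n,\ell}$ is the $R_{2n}$-submodule of all $P\in\wedge^\ell H^{(2n)}$ with $P(X_1,\dots,X_{\ell-1},\pm x^{-1}|x_1,\dots,x_{2n-2},x,-x)=0$ identically, for both signs. $e_k^{(2n)}$ is the $k$-th elementary symmetric polynomial in $x_1,\dots,x_{2n}$, with $e^{(2n)}_k=0$ for $k<0$ or $k>2n$. For $1\le r\le n$, $s\in\mathbb Z$: $P^{(2n)}_{1,s}=e^{(2n)}_{2s-1}$ and $P^{(2n)}_{r,s}=P^{(2n)}_{r-1,s+1}-e^{(2n)}_{2s}P^{(2n)}_{r-1,1}$ for $r\ge2$. Put $v^{(2n)}_r=\sum_{s=1}^nP^{(2n)}_{r,s}X^{2(s-1)}$, $w^{(2n)}_r=Xv^{(2n)}_r$ for $1\le r\le n$, $v_0^{(2n)}=\sum_{j=0}^ne^{(2n)}_{2j}X^{2j}$,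 and for $1\le k\le n$ $$2\xi_k^{(2n)}(X_1,X_2)=\frac{X_1-X_2}{X_1+X_2}\Big(v_0^{(2n)}(X_1)w_k^{(2n)}(X_2)+v_0^{(2n)}(X_2)w_k^{(2n)}(X_1)\Big)-v_0^{(2n)}(X_1)w_k^{(2n)}(X_2)+v_0^{(2n)}(X_2)w_k^{(2n)}(X_1),$$ an element of $\wedge^2H^{(2n)}$. Multi-index notation: $v_I=v_{i_1}\wedge\cdots\wedge v_{i_{\ell_1}}$, and similarly $w_J$, $\xi_K$ (products in the exterior algebra of $H^{(2n)}$; empty product is $1$). *)

theory Defs
  imports Complex_Main "HOL-Library.Poly_Mapping" "HOL-Combinatorics.Permutations"
begin

text \<open>
  Multivariate polynomials are finitely supported functions from monomials to coefficients, with
  the convolution product of \<^theory>\<open>HOL-Library.Poly_Mapping\<close>. Variables are indexed by natural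
  numbers; only the indices from 1 on are used.
\<close>

type_synonym 'a mpoly = "(nat \<Rightarrow>\<^sub>0 nat) \<Rightarrow>\<^sub>0 'a"

text \<open>Polynomials in $x_1, x_2, \dots$ over the complex numbers, and polynomials in
  $X_1, X_2, \dots$ whose coefficients are polynomials in $x_1, x_2, \dots$\<close>

type_synonym xpoly = "complex mpoly"
type_synonym Xpoly = "xpoly mpoly"

definition Const :: "'a::zero \<Rightarrow> 'a mpoly" where
  "Const c = Poly_Mapping.single 0 c"

definition Var :: "nat \<Rightarrow> 'a::zero_neq_one mpoly" where
  "Var i = Poly_Mapping.single (Poly_Mapping.single i 1) 1"

definition poly_vars :: "'a::zero mpoly \<Rightarrow> nat set" where
  "poly_vars p = (\<Union>m\<in>Poly_Mapping.keys p. Poly_Mapping.keys m)"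

text \<open>Replace the coefficients by their images under \<open>c\<close> and each variable $X_i$ by \<open>f i\<close>.\<close>

definition poly_subst :: "('a::zero \<Rightarrow> 'b::comm_semiring_1) \<Rightarrow> (nat \<Rightarrow> 'b) \<Rightarrow> 'a mpoly \<Rightarrow> 'b" where
  "poly_subst c f p = (\<Sum>m\<in>Poly_Mapping.keys p. c (Poly_Mapping.lookup p m)
      * (\<Prod>i\<in>Poly_Mapping.keys m. f i ^ Poly_Mapping.lookup m i))"

definition rename :: "(nat \<Rightarrow> nat) \<Rightarrow> 'a::comm_semiring_1 mpoly \<Rightarrow> 'a mpoly" where
  "rename f = poly_subst Const (\<lambda>i. Var (f i))"

text \<open>The value $P(X_1,X_2,\dots\,|\,x_1,x_2,\dots)$ at complex arguments.\<close>

definition Xeval :: "(nat \<Rightarrow> complex) \<Rightarrow> (nat \<Rightarrow> complex) \<Rightarrow> Xpoly \<Rightarrow> complex" where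
  "Xeval X x = poly_subst (poly_subst id x) X"


definition sym_polys :: "nat \<Rightarrow> xpoly set" where
  "sym_polys N = {p. poly_vars p \<subseteq> {1..N} \<and> (\<forall>\<pi>. \<pi> permutes {1..N} \<longrightarrow> rename \<pi> p = p)}"

definition free_basis :: "'a::comm_ring_1 set \<Rightarrow> 'a mpoly set \<Rightarrow> 't set \<Rightarrow> ('t \<Rightarrow> 'a mpoly) \<Rightarrow> bool" where
  "free_basis R M T b \<longleftrightarrow> finite T
     \<and> M = {(\<Sum>t\<in>T. Const (c t) * b t) | c. \<forall>t\<in>T. c t \<in> R}
     \<and> (\<forall>c. (\<forall>t\<in>T. c t \<in> R) \<longrightarrow> (\<Sum>t\<in>T. Const (c t) * b t) = 0 \<longrightarrow> (\<forall>t\<in>T. c t = 0))"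


text \<open>The $\ell$-th exterior power of $H^{(2n)}$ in its model of anti-symmetric polynomials.\<close>

definition ext_power :: "nat \<Rightarrow> nat \<Rightarrow> Xpoly set" where
  "ext_power n l = {P. poly_vars P \<subseteq> {1..l}
     \<and> (\<forall>m\<in>Poly_Mapping.keys P. \<forall>i. Poly_Mapping.lookup m i < 2 * n)
     \<and> (\<forall>m\<in>Poly_Mapping.keys P. Poly_Mapping.lookup P m \<in> sym_polys (2 * n))
     \<and> (\<forall>\<pi>. \<pi> permutes {1..l} \<longrightarrow> rename \<pi> P = of_int (sign \<pi>) * P)}"

definition U_module :: "nat \<Rightarrow> nat \<Rightarrow> Xpoly set" where
  "U_module n l = {P \<in> ext_power n l. \<forall>X x t. t \<noteq> 0 \<longrightarrow>
      Xeval (X(l := inverse t)) (x(2 * n - 1 := t, 2 * n := - t)) P = 0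
    \<and> Xeval (X(l := - inverse t)) (x(2 * n - 1 := t, 2 * n := - t)) P = 0}"

definition alt :: "nat \<Rightarrow> Xpoly \<Rightarrow> Xpoly" where
  "alt l P = (\<Sum>\<sigma> | \<sigma> permutes {1..l}. of_int (sign \<sigma>) * rename \<sigma> P)"

text \<open>
  The exterior product of anti-symmetric polynomials in $k$ and $l$ variables. It is the product
  transported along $X^{i_1}\wedge\dots\wedge X^{i_l} \mapsto
  \sum_\sigma \mathrm{sgn}(\sigma) X_{\sigma(1)}^{i_1}\cdots X_{\sigma(l)}^{i_l}$, that is, the image
  of a pure monomial is \<open>alt l\<close> of it; see lemma \<open>wedge_alt\<close> below.
\<close>

definition wedge :: "nat \<Rightarrow> nat \<Rightarrow> Xpoly \<Rightarrow> Xpoly \<Rightarrow> Xpoly" where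
  "wedge k l P Q = Const (Const (1 / (fact k * fact l))) * alt (k + l) (P * rename (\<lambda>i. i + k) Q)"

text \<open>Product of a list of elements of the same degree \<open>d\<close>.\<close>

fun wedges :: "nat \<Rightarrow> Xpoly list \<Rightarrow> Xpoly" where
  "wedges d [] = 1"
| "wedges d (P # Ps) = wedge d (d * length Ps) P (wedges d Ps)"


text \<open>Here and below \<open>n\<close> is half the number of the variables $x_i$.\<close>

definition elem_sym :: "nat \<Rightarrow> int \<Rightarrow> xpoly" where
  "elem_sym n k = (if k < 0 then 0 else \<Sum>S | S \<subseteq> {1..2 * n} \<and> card S = nat k. \<Prod>i\<in>S. Var i)"

text \<open>The value at \<open>r = 0\<close> is a dummy.\<close>

fun Pcoeff :: "nat \<Rightarrow> nat \<Rightarrow> int \<Rightarrow> xpoly" where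
  "Pcoeff n 0 s = 0"
| "Pcoeff n (Suc 0) s = elem_sym n (2 * s - 1)"
| "Pcoeff n (Suc (Suc r)) s =
     Pcoeff n (Suc r) (s + 1) - elem_sym n (2 * s) * Pcoeff n (Suc r) 1"

definition vH0 :: "nat \<Rightarrow> Xpoly \<Rightarrow> Xpoly" where
  "vH0 n X = (\<Sum>j=0..n. Const (elem_sym n (2 * int j)) * X ^ (2 * j))"

definition vH :: "nat \<Rightarrow> nat \<Rightarrow> Xpoly \<Rightarrow> Xpoly" where
  "vH n r X = (\<Sum>s=1..n. Const (Pcoeff n r (int s)) * X ^ (2 * (s - 1)))"

definition wH :: "nat \<Rightarrow> nat \<Rightarrow> Xpoly \<Rightarrow> Xpoly" where
  "wH n r X = X * vH n r X"

text \<open>The defining equation multiplied by $X_1 + X_2$, which divides the symmetric combination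
  because \<open>vH0\<close> is even and \<open>wH\<close> is odd; see lemma \<open>xi_eq\<close> below.\<close>

definition xi :: "nat \<Rightarrow> nat \<Rightarrow> Xpoly" where
  "xi n k = (let X1 = Var 1; X2 = Var 2 in
     THE P. (X1 + X2) * (2 * P) =
       (X1 - X2) * (vH0 n X1 * wH n k X2 + vH0 n X2 * wH n k X1)
       + (X1 + X2) * (- vH0 n X1 * wH n k X2 + vH0 n X2 * wH n k X1))"

definition basis_elem :: "nat \<Rightarrow> nat list \<times> nat list \<times> nat list \<Rightarrow> Xpoly" where
  "basis_elem n = (\<lambda>(I, J, K).
     wedge (length I) (length J + 2 * length K)
       (wedges 1 (map (\<lambda>i. vH n i (Var 1)) I))
       (wedge (length J) (2 * length K)
         (wedges 1 (map (\<lambda>j. wH n j (Var 1)) J))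
         (wedges 2 (map (xi n) K))))"

text \<open>The upper bounds are written additively because they may be negative.\<close>

definition index_triples :: "nat \<Rightarrow> nat \<Rightarrow> (nat list \<times> nat list \<times> nat list) set" where
  "index_triples n l = {(I, J, K).
       sorted_wrt (<) I \<and> (\<forall>i\<in>set I. 1 \<le> i \<and> i \<le> n)
     \<and> sorted_wrt (<) J \<and> (\<forall>j\<in>set J. 1 \<le> j \<and> j + length I + length K \<le> n)
     \<and> sorted_wrt (\<le>) K \<and> (\<forall>k\<in>set K. 1 \<le> k \<and> k + length I + length K \<le> n + 1)
     \<and> length I + length J + 2 * length K = l}"


subsection \<open>Well-definedness\<close>

lemma poly_subst_superset:
  assumes "finite A" "Poly_Mapping.keys p \<subseteq> A" "c 0 = 0"
  shows "poly_subst c f p = (\<Sum>m\<in>A. c (Poly_Mapping.lookup p m)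
      * (\<Prod>i\<in>Poly_Mapping.keys m. f i ^ Poly_Mapping.lookup m i))"
  unfolding poly_subst_def
  by (rule sum.mono_neutral_left) (use assms in \<open>auto simp: in_keys_iff\<close>)

lemma poly_subst_0 [simp]: "poly_subst c f 0 = 0"
  by (simp add: poly_subst_def)

lemma poly_subst_add:
  assumes "c 0 = 0" "\<And>a b. c (a + b) = c a + c b"
  shows "poly_subst c f (p + q) = poly_subst c f p + poly_subst c f q"
proof -
  let ?A = "Poly_Mapping.keys p \<union> Poly_Mapping.keys q"
  have "Poly_Mapping.keys (p + q) \<subseteq> ?A" by (rule Poly_Mapping.keys_add)
  thus ?thesis
    by (subst (1 2 3) poly_subst_superset[where A = ?A])
       (auto simp: assms lookup_add algebra_simps sum.distrib)
qed

lemma monomial_eval_superset: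
  assumes "finite A" "Poly_Mapping.keys m \<subseteq> A"
  shows "(\<Prod>i\<in>Poly_Mapping.keys m. f i ^ Poly_Mapping.lookup m i)
    = (\<Prod>i\<in>A. (f i :: 'b::comm_semiring_1) ^ Poly_Mapping.lookup m i)"
  by (rule prod.mono_neutral_left) (use assms in \<open>auto simp: in_keys_iff\<close>)

lemma monomial_eval_add:
  "(\<Prod>i\<in>Poly_Mapping.keys (a + b). (f i :: 'b::comm_semiring_1) ^ Poly_Mapping.lookup (a + b) i)
   = (\<Prod>i\<in>Poly_Mapping.keys a. f i ^ Poly_Mapping.lookup a i)
     * (\<Prod>i\<in>Poly_Mapping.keys b. f i ^ Poly_Mapping.lookup b i)"
proof -
  let ?A = "Poly_Mapping.keys a \<union> Poly_Mapping.keys b"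
  have "Poly_Mapping.keys (a + b) \<subseteq> ?A" by (rule Poly_Mapping.keys_add)
  thus ?thesis
    by (subst (1 2 3) monomial_eval_superset[where A = ?A])
       (auto simp: lookup_add power_add prod.distrib)
qed

lemma poly_subst_single:
  assumes "c 0 = 0"
  shows "poly_subst c f (Poly_Mapping.single m a)
    = c a * (\<Prod>i\<in>Poly_Mapping.keys m. f i ^ Poly_Mapping.lookup m i)"
  by (subst poly_subst_superset[where A = "{m}"]) (use assms in \<open>auto simp: lookup_single\<close>)

lemma mpoly_induct [case_names zero add]:
  assumes "P 0" "\<And>m a p. P p \<Longrightarrow> P (Poly_Mapping.single m a + p)"
  shows "P (p :: 'a::comm_monoid_add mpoly)"
proof (induction p rule: update_induct)
  case const
  show ?case using assms(1) by simp
next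
  case (update f a b)
  have "Poly_Mapping.update a b f = Poly_Mapping.single a b + f"
    using update by (intro poly_mapping_eqI) (auto simp: lookup_update lookup_add lookup_single in_keys_iff)
  thus ?case using assms(2) update by metis
qed

lemma poly_subst_mult:
  assumes c: "c 0 = 0" "\<And>a b. c (a + b) = c a + c b" "\<And>a b. c (a * b) = c a * c b"
  shows "poly_subst c f (p * q) = poly_subst c f p * poly_subst c f (q :: 'a::comm_semiring_1 mpoly)"
proof (induction p rule: mpoly_induct)
  case zero thus ?case by simp
next
  case (add m a p)
  have "poly_subst c f (Poly_Mapping.single m a * q)
      = poly_subst c f (Poly_Mapping.single m a) * poly_subst c f q"
  proof (induction q rule: mpoly_induct)
    case zero thus ?case by simp
  next
    case (add m' a' q)
    thus ?case
      by (simp add: distrib_left poly_subst_add c mult_single poly_subst_single monomial_eval_add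
          algebra_simps)
  qed
  thus ?case by (simp add: distrib_right poly_subst_add c add)
qed

lemma Const_0 [simp]: "Const 0 = 0"
  by (simp add: Const_def)

lemma Const_1 [simp]: "Const 1 = 1"
  by (simp add: Const_def)

lemma Const_add: "Const (a + b) = Const a + Const b"
  by (simp add: Const_def single_add)

lemma Const_mult: "Const (a * b) = Const a * Const b"
  by (simp add: Const_def mult_single)

lemma Const_of_nat: "Const (of_nat k) = of_nat k"
  by (induction k) (simp_all add: Const_add)

lemma rename_0 [simp]: "rename f 0 = 0"
  by (simp add: rename_def)

lemma rename_add: "rename f (p + q) = rename f p + rename f q"
  by (simp add: rename_def poly_subst_add Const_add)

lemma rename_mult: "rename f (p * q) = rename f p * rename f q"
  by (simp add: rename_def poly_subst_mult Const_add Const_mult)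

lemma rename_single:
  "rename f (Poly_Mapping.single m a)
    = Const a * (\<Prod>i\<in>Poly_Mapping.keys m. Var (f i) ^ Poly_Mapping.lookup m i)"
  by (simp add: rename_def poly_subst_single)

lemma rename_Const [simp]: "rename f (Const a) = Const a"
  by (simp add: Const_def[of a] rename_single)

lemma rename_1 [simp]: "rename f 1 = 1"
  using rename_Const[of f 1] by simp

lemma rename_Var [simp]: "rename f (Var i) = Var (f i)"
  by (simp add: Var_def[of i] rename_single)

lemma rename_uminus [simp]: "rename f (- p) = - rename f (p :: 'a::comm_ring_1 mpoly)"
  using rename_add[of f p "- p"] by (simp add: add_eq_0_iff)

lemma rename_power: "rename f (p ^ k) = rename f p ^ k"
  by (induction k) (simp_all add: rename_mult)

lemma rename_prod: "rename f (prod g A) = (\<Prod>i\<in>A. rename f (g i))"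
  by (induction A rule: infinite_finite_induct) (simp_all add: rename_mult)

lemma rename_sum: "rename f (sum g A) = (\<Sum>i\<in>A. rename f (g i))"
  by (induction A rule: infinite_finite_induct) (simp_all add: rename_add)

lemma rename_rename: "rename f (rename g p) = rename (f \<circ> g) p"
  by (induction p rule: mpoly_induct)
     (simp_all add: rename_add rename_single rename_mult rename_prod rename_power)

lemma rename_cong:
  "(\<And>i. i \<in> poly_vars p \<Longrightarrow> f i = g i) \<Longrightarrow> rename f p = rename g p"
  unfolding rename_def poly_subst_def poly_vars_def
  by (intro sum.cong arg_cong2[where f = "(*)"] prod.cong refl arg_cong2[where f = "(^)"]
      arg_cong[where f = Var]) auto

lemma rename_id: "rename id p = p"
proof (induction p rule: mpoly_induct)
  case (add m a p)
  have "(Var i :: 'a mpoly) ^ k = Poly_Mapping.single (Poly_Mapping.single i k) 1" for i k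
    by (induction k) (simp_all add: Var_def mult_single flip: single_add)
  moreover have "(\<Prod>i\<in>A. Poly_Mapping.single (g i) (1::'a))
      = Poly_Mapping.single (\<Sum>i\<in>A. g i) 1" for A and g :: "nat \<Rightarrow> nat \<Rightarrow>\<^sub>0 nat"
    by (induction A rule: infinite_finite_induct) (simp_all add: mult_single)
  moreover have "(\<Sum>i\<in>Poly_Mapping.keys m. Poly_Mapping.single i (Poly_Mapping.lookup m i)) = m"
    by (rule poly_mapping_eqI) (auto simp: lookup_sum lookup_single when_def in_keys_iff)
  ultimately have "rename id (Poly_Mapping.single m a) = Poly_Mapping.single m a"
    by (simp add: rename_single Const_def mult_single)
  thus ?case by (simp only: rename_add add.IH)
qed simp

lemma rename_of_sign:
  "rename f (of_int (sign \<pi>) * p) = of_int (sign \<pi>) * rename f (p :: 'a::comm_ring_1 mpoly)"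
  by (cases \<pi> rule: sign_cases) simp_all

lemma alt_sum: "alt m (sum f A) = (\<Sum>i\<in>A. alt m (f i))"
  unfolding alt_def by (simp add: rename_sum sum_distrib_left sum.swap[of _ A])

lemma alt_of_sign: "alt m (of_int (sign \<pi>) * P) = of_int (sign \<pi>) * alt m P"
  unfolding alt_def by (simp add: rename_of_sign sum_distrib_left mult.left_commute)

lemma alt_rename:
  assumes "\<pi> permutes {1..m}"
  shows "alt m (rename \<pi> P) = of_int (sign \<pi>) * alt m P"
proof -
  have perm: "permutation \<sigma>" if "\<sigma> permutes {1..m}" for \<sigma>
    using that by (auto simp: permutation_permutes)
  have "alt m P = (\<Sum>\<sigma> | \<sigma> permutes {1..m}. of_int (sign (\<sigma> \<circ> \<pi>)) * rename (\<sigma> \<circ> \<pi>) P)"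
    unfolding alt_def by (rule sum_permutations_compose_right[OF assms])
  also have "\<dots> = (\<Sum>\<sigma> | \<sigma> permutes {1..m}.
      of_int (sign \<pi>) * (of_int (sign \<sigma>) * rename (\<sigma> \<circ> \<pi>) P))"
    by (intro sum.cong refl) (simp only: mem_Collect_eq sign_compose[OF perm perm[OF assms]] of_int_mult mult_ac)
  also have "\<dots> = of_int (sign \<pi>) * alt m (rename \<pi> P)"
    unfolding alt_def by (simp add: sum_distrib_left rename_rename)
  finally show ?thesis
    by (simp flip: mult.assoc of_int_mult)
qed

lemma wedge_alt:
  assumes p: "poly_vars p \<subseteq> {1..k}" and q: "poly_vars q \<subseteq> {1..l}"
  shows "wedge k l (alt k p) (alt l q) = alt (k + l) (p * rename (\<lambda>i. i + k) q)"
proof -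
  define sh where "sh = (\<lambda>i::nat. i + k)"
  define A where "A = alt (k + l) (p * rename sh q)"
  have left: "alt (k + l) (rename \<tau> p * r) = of_int (sign \<tau>) * alt (k + l) (p * r)"
    if \<tau>: "\<tau> permutes {1..k}" and r: "r = rename (sh \<circ> \<rho>) q" "\<rho> permutes {1..l}" for \<tau> \<rho> r
  proof -
    have "\<tau> (\<rho> i + k) = \<rho> i + k" if "i \<in> {1..l}" for i
      using permutes_in_image[OF r(2), of i] that permutes_not_in[OF \<tau>, of "\<rho> i + k"] by auto
    hence "rename \<tau> r = r"
      unfolding r rename_rename using q by (intro rename_cong) (auto simp: sh_def)
    moreover have "\<tau> permutes {1..k + l}"
      by (rule permutes_subset[OF \<tau>]) auto
    ultimately show ?thesis
      using alt_rename[of \<tau> "k + l" "p * r"] by (simp add: rename_mult)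
  qed
  have right: "alt (k + l) (p * rename (sh \<circ> \<rho>) q) = of_int (sign \<rho>) * A"
    if "\<rho> permutes {1..l}" for \<rho>
    using that finite_atLeastAtMost
  proof (induction \<rho> rule: permutes_induct)
    case id
    show ?case by (simp add: A_def)
  next
    case (swap a b \<rho>)
    let ?t = "Transposition.transpose (a + k) (b + k)"
    have t: "?t permutes {1..k + l}"
      by (rule permutes_swap_id) (use swap in auto)
    have "sh \<circ> (Transposition.transpose a b \<circ> \<rho>) = ?t \<circ> (sh \<circ> \<rho>)"
      by (auto simp: fun_eq_iff sh_def Transposition.transpose_def)
    moreover have "rename ?t p = p"
    proof -
      have "rename ?t p = rename id p"
        by (rule rename_cong) (use p swap in \<open>auto simp: Transposition.transpose_def\<close>)
      thus ?thesis by (simp add: rename_id)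
    qed
    ultimately have "p * rename (sh \<circ> (Transposition.transpose a b \<circ> \<rho>)) q
        = rename ?t (p * rename (sh \<circ> \<rho>) q)"
      by (simp add: rename_mult rename_rename)
    moreover have "permutation \<rho>"
      using swap by (auto simp: permutation_permutes)
    moreover have "sign (Transposition.transpose a b \<circ> \<rho>) = - sign \<rho>" if "permutation \<rho>"
      using that swap by (simp only: sign_compose permutation_swap_id sign_swap_id if_False)
    moreover have "sign ?t = - 1"
      using swap by (simp add: sign_swap_id)
    ultimately show ?case
      by (simp only: alt_rename[OF t] swap.IH of_int_minus of_int_1 mult_minus_left mult_1)
  qed
  have "rename sh (alt l q)
      = (\<Sum>\<rho> | \<rho> permutes {1..l}. of_int (sign \<rho>) * rename (sh \<circ> \<rho>) q)"
    by (simp only: alt_def rename_sum rename_of_sign rename_rename)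
  moreover have "(of_int (sign \<tau>) * rename \<tau> p) * (of_int (sign \<rho>) * rename (sh \<circ> \<rho>) q)
      = of_int (sign \<tau>) * (of_int (sign \<rho>) * (rename \<tau> p * rename (sh \<circ> \<rho>) q))" for \<tau> \<rho>
    by (simp only: mult_ac)
  ultimately have "alt (k + l) (alt k p * rename sh (alt l q))
      = (\<Sum>\<tau> | \<tau> permutes {1..k}. \<Sum>\<rho> | \<rho> permutes {1..l}.
          alt (k + l) (of_int (sign \<tau>) * (of_int (sign \<rho>) * (rename \<tau> p * rename (sh \<circ> \<rho>) q))))"
    by (simp only: alt_def[of k] sum_product alt_sum)
  also have "\<dots> = (\<Sum>\<tau> | \<tau> permutes {1..k}. \<Sum>\<rho> | \<rho> permutes {1..l}. A)"
  proof (intro sum.cong refl)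
    fix \<tau> \<rho> assume *: "\<tau> \<in> {\<tau>. \<tau> permutes {1..k}}" "\<rho> \<in> {\<rho>. \<rho> permutes {1..l}}"
    show "alt (k + l) (of_int (sign \<tau>) * (of_int (sign \<rho>) * (rename \<tau> p * rename (sh \<circ> \<rho>) q))) = A"
      using * unfolding alt_of_sign mem_Collect_eq
      by (simp only: left[OF _ refl] right)
         (cases \<tau> rule: sign_cases; cases \<rho> rule: sign_cases; simp)
  qed
  also have "\<dots> = of_nat (fact k * fact l) * A"
    by (simp add: card_permutations[OF refl])
  finally have "wedge k l (alt k p) (alt l q)
      = Const (Const (1 / (fact k * fact l))) * of_nat (fact k * fact l) * A"
    unfolding wedge_def sh_def by (simp only: mult.assoc)
  also have "Const (Const (1 / (fact k * fact l))) * of_nat (fact k * fact l) = (1 :: Xpoly)"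
  proof -
    have "(of_nat (fact k * fact l) :: Xpoly) = Const (Const (of_nat (fact k * fact l)))"
      by (simp only: Const_of_nat)
    thus ?thesis by (simp flip: Const_mult)
  qed
  finally show ?thesis by (simp add: A_def sh_def)
qed

lemma diff_dvd_power_diff: "X - Y dvd X ^ k - (Y :: 'a::comm_ring_1) ^ k"
  by (metis dvd_triv_left power_diff_sumr2)

lemma vH0_dvd: "X - Y dvd vH0 n X - vH0 n Y"
proof -
  have "vH0 n X - vH0 n Y = (\<Sum>j=0..n. Const (elem_sym n (2 * int j)) * (X ^ (2 * j) - Y ^ (2 * j)))"
    by (simp add: vH0_def sum_subtractf right_diff_distrib)
  thus ?thesis
    by (simp only:) (intro dvd_sum dvd_mult diff_dvd_power_diff)
qed

lemma wH_eq: "wH n r X = (\<Sum>s=1..n. Const (Pcoeff n r (int s)) * X ^ Suc (2 * (s - 1)))"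
  by (simp add: wH_def vH_def sum_distrib_left mult_ac)

lemma wH_dvd: "X - Y dvd wH n r X - wH n r Y"
proof -
  have "wH n r X - wH n r Y
      = (\<Sum>s=1..n. Const (Pcoeff n r (int s)) * (X ^ Suc (2 * (s - 1)) - Y ^ Suc (2 * (s - 1))))"
    unfolding wH_eq by (simp only: sum_subtractf right_diff_distrib)
  thus ?thesis
    by (simp only:) (intro dvd_sum dvd_mult diff_dvd_power_diff)
qed

lemma xi_eq:
  defines "X1 \<equiv> Var 1" and "X2 \<equiv> Var 2"
  shows "(X1 + X2) * (2 * xi n k) =
       (X1 - X2) * (vH0 n X1 * wH n k X2 + vH0 n X2 * wH n k X1)
       + (X1 + X2) * (- vH0 n X1 * wH n k X2 + vH0 n X2 * wH n k X1)" (is "_ = ?r")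
proof -
  have "vH0 n (- X2) = vH0 n X2" and "wH n k (- X2) = - wH n k X2"
    by (simp_all add: vH0_def wH_eq sum_negf)
  hence "vH0 n X1 * wH n k X2 + vH0 n X2 * wH n k X1
      = wH n k X2 * (vH0 n X1 - vH0 n (- X2)) + vH0 n X2 * (wH n k X1 - wH n k (- X2))"
    by (simp add: algebra_simps)
  hence "X1 - (- X2) dvd vH0 n X1 * wH n k X2 + vH0 n X2 * wH n k X1"
    by (metis dvd_add dvd_mult vH0_dvd wH_dvd)
  hence "X1 + X2 dvd ?r" by simp
  then obtain Q where Q: "?r = (X1 + X2) * Q" by (elim dvdE)
  have "(2 :: Xpoly) = Const (Const 2)"
    using Const_of_nat[of 2, where ?'a = complex] Const_of_nat[of 2, where ?'a = xpoly] by simp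
  hence "2 * Const (Const (1 / 2)) = (Const (Const (2 * (1 / 2))) :: Xpoly)"
    by (simp only: Const_mult)
  hence "2 * Const (Const (1 / 2)) = (1 :: Xpoly)"
    by simp
  hence half: "2 * (Const (Const (1 / 2)) * Q) = Q"
    by (simp only: mult_1 flip: mult.assoc)
  have nz: "X1 + X2 \<noteq> 0"
  proof
    assume "X1 + X2 = 0"
    hence "Poly_Mapping.lookup (X1 + X2) (Poly_Mapping.single 1 1) = 0" by simp
    moreover have "Poly_Mapping.single 2 1 \<noteq> (Poly_Mapping.single 1 1 :: nat \<Rightarrow>\<^sub>0 nat)"
      by (metis lookup_single_eq lookup_single_not_eq one_neq_zero n_not_Suc_n numeral_2_eq_2 One_nat_def)
    ultimately show False
      by (simp add: X1_def X2_def Var_def lookup_add lookup_single)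
  qed
  have "\<exists>!P. (X1 + X2) * (2 * P) = ?r"
  proof (rule ex1I)
    show "(X1 + X2) * (2 * (Const (Const (1 / 2)) * Q)) = ?r"
      by (simp only: half Q)
    fix P assume "(X1 + X2) * (2 * P) = ?r"
    hence "(X1 + X2) * (2 * P) = (X1 + X2) * (2 * (Const (Const (1 / 2)) * Q))"
      by (simp only: half Q)
    thus "P = Const (Const (1 / 2)) * Q"
      using nz by simp
  qed
  from theI'[OF this] show ?thesis
    unfolding xi_def Let_def X1_def X2_def .
qed

end

theory Submission
  imports Defs "Jordan_Normal_Form.Determinant"
begin

text \<open>
  Write $D = \prod_{i<j} (x_i + x_j)$ and expand elements of $\wedge^\ell H^{(2n)}$ in the
  $\binom{2n}{\ell}$ coordinates of the monomial basis. At $x_j = -x_i$, contracting an element of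
  $U_{2n,\ell}$ with the evaluation at $x_i^{-1}$ or at $-x_i^{-1}$ gives zero; this amounts to
  $m = \binom{2n}{\ell} - \binom{2n-2}{\ell}$ independent linear relations between the coordinates
  modulo $x_i + x_j$. Hence the coordinate determinant of any $\binom{2n}{\ell}$ elements of
  $U_{2n,\ell}$ is divisible by $D^m$. For the proposed basis the degrees agree (a generating function
  identity over the index triples), so its determinant is $\kappa D^m$ with a constant $\kappa$. To
  see that $\kappa \neq 0$, set all $x_i$ to $1$ and let $y$ run through the $n$ roots of $v_0$ as a
  polynomial in $X^2$. On the functionals that evaluate the even or the odd part of a polynomial at
  $X^2 = y$, the element $v_r$ becomes $v_1(y)\, y^{1-r}$, and $\xi_k$ becomes diagonal: it only pairs
  the even and the odd functional at the same $y$. Linear independence is then that of monomials of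
  bounded degree in the $y^{-1}$. Finally Cramer's rule writes every element of $U_{2n,\ell}$ in terms
  of the basis.
\<close>

text \<open>The relations at x_j = -x_i have to produce a full power of x_i + x_j in the
  determinant, not just a drop of rank. Evaluating at both 1/x and -1/x separates even from odd
  exponents, and clearing denominators leaves, for each exponent set S meeting {2n-2, 2n-1}, a
  relation in which the coordinate of S has coefficient 1 or -1 and every other set has a smaller
  sum. Column operations of determinant 1 or -1 therefore put the factor into m columns. The basis
  elements satisfy the relations because v_0 + w_1 is the generating function of the elementary
  symmetric polynomials and v_(r+1) = (v_r - v_r(0) v_0) / X^2. The diagonal form of xi_k comes from
  writing it as X_1 - X_2 times the Bezoutian of X w_k and v_0 in the squares of the variables. In
  the proof that kappa is nonzero the obstacle is that different shapes (l1, l2, l3) mix under one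
  evaluation; a relation is therefore tested on a term with the shortest K, at sites of which
  exactly l3 occur in both parities. The index bounds are the degree room that remains once the
  other sites have been divided out.\<close>

unbundle no m_inv_syntax

section \<open>Polynomial functions\<close>

lemma poly_subst_Const [simp]: "c 0 = 0 \<Longrightarrow> poly_subst c f (Const a) = c a"
  by (simp add: Const_def poly_subst_single)

lemma poly_subst_Var [simp]: "c 0 = 0 \<Longrightarrow> c 1 = 1 \<Longrightarrow> poly_subst c f (Var i) = f i"
  by (simp add: Var_def poly_subst_single)

lemma poly_subst_comm_ring_hom:
  fixes c :: "'a::comm_ring_1 \<Rightarrow> 'b::comm_ring_1"
  assumes "comm_ring_hom c"
  shows "comm_ring_hom (poly_subst c f)"
proof -
  interpret comm_ring_hom c by fact
  show ?thesis
  proof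
    show "poly_subst c f 1 = 1"
      using poly_subst_Const[of c f 1] by simp
  qed (simp_all add: poly_subst_add poly_subst_mult hom_add hom_mult)
qed

lemma comm_ring_hom_Const: "comm_ring_hom (Const :: 'a::comm_ring_1 \<Rightarrow> _)"
  by standard (simp_all add: Const_add Const_mult)

interpretation Const: comm_ring_hom "Const :: 'a::comm_ring_1 \<Rightarrow> 'a mpoly"
  by (rule comm_ring_hom_Const)

interpretation rename: comm_ring_hom "rename f :: 'a::comm_ring_1 mpoly \<Rightarrow> 'a mpoly" for f
  unfolding rename_def by (rule poly_subst_comm_ring_hom[OF comm_ring_hom_Const])

definition peval :: "(nat \<Rightarrow> 'a) \<Rightarrow> 'a::comm_ring_1 mpoly \<Rightarrow> 'a" where
  "peval x = poly_subst id x"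

interpretation peval: comm_ring_hom "peval x :: 'a::comm_ring_1 mpoly \<Rightarrow> 'a" for x
  unfolding peval_def by (rule poly_subst_comm_ring_hom, standard) simp_all

lemma Xeval_altdef: "Xeval X x = poly_subst (peval x) X"
  by (simp add: fun_eq_iff Xeval_def peval_def)

interpretation Xeval: comm_ring_hom "Xeval X x" for X x
  unfolding Xeval_altdef by (rule poly_subst_comm_ring_hom, rule peval.comm_ring_hom_axioms)

lemma peval_Var [simp]: "peval x (Var i) = x i"
  and peval_Const [simp]: "peval x (Const a) = a"
  by (simp_all add: peval_def)

lemma Xeval_Var [simp]: "Xeval X x (Var i) = X i"
  and Xeval_Const [simp]: "Xeval X x (Const p) = peval x p"
  by (simp_all add: Xeval_altdef)

lemma poly_subst_comm_ring_hom_rename: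
  fixes c :: "'a::comm_ring_1 \<Rightarrow> 'b::comm_ring_1"
  assumes "comm_ring_hom c"
  shows "poly_subst c f (rename g p) = poly_subst c (f \<circ> g) p"
proof -
  interpret c: comm_ring_hom c by fact
  interpret h: comm_ring_hom "poly_subst c f'" for f'
    by (rule poly_subst_comm_ring_hom) fact
  show ?thesis
  proof (induction p rule: mpoly_induct)
    case (add m a p)
    have "poly_subst c f (rename g (Poly_Mapping.single m a))
        = poly_subst c (f \<circ> g) (Poly_Mapping.single m a)"
      by (simp add: rename_single poly_subst_single h.hom_mult h.hom_prod h.hom_power)
    thus ?case unfolding rename.hom_add h.hom_add add by simp
  qed simp
qed

lemma Xeval_rename [simp]: "Xeval X x (rename g P) = Xeval (X \<circ> g) x P"
  unfolding Xeval_altdef by (rule poly_subst_comm_ring_hom_rename, rule peval.comm_ring_hom_axioms)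

lemma peval_superset:
  assumes "finite A" "finite F" "poly_vars p \<subseteq> A" "Poly_Mapping.keys p \<subseteq> F"
  shows "peval x p = (\<Sum>m\<in>F. Poly_Mapping.lookup p m * (\<Prod>i\<in>A. x i ^ Poly_Mapping.lookup m i))"
proof -
  have "peval x p = (\<Sum>m\<in>Poly_Mapping.keys p. Poly_Mapping.lookup p m * (\<Prod>i\<in>A. x i ^ Poly_Mapping.lookup m i))"
    unfolding peval_def poly_subst_def id_def using assms
    by (intro sum.cong refl arg_cong2[where f = "(*)"] monomial_eval_superset) (auto simp: poly_vars_def)
  also have "\<dots> = (\<Sum>m\<in>F. Poly_Mapping.lookup p m * (\<Prod>i\<in>A. x i ^ Poly_Mapping.lookup m i))"
    using assms by (intro sum.mono_neutral_left) (auto simp: in_keys_iff)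
  finally show ?thesis .
qed

lemma finite_poly_vars [simp]: "finite (poly_vars p)"
  by (simp add: poly_vars_def)

text \<open>Induction on the variables: with all variables but one fixed, the sum is a univariate
  polynomial that vanishes everywhere, so the coefficient of each power of that variable vanishes.
  Terms are indexed by an arbitrary type with an exponent function \<open>e\<close>, because
  truncated monomials and plain exponent functions occur later as well.\<close>

lemma monomials_independent:
  fixes c :: "'t \<Rightarrow> complex"
  assumes "finite A" "finite F"
    and "\<And>s t. s \<in> F \<Longrightarrow> t \<in> F \<Longrightarrow> (\<And>i. i \<in> A \<Longrightarrow> e s i = e t i) \<Longrightarrow> s = t"
    and "\<And>x. (\<Sum>t\<in>F. c t * (\<Prod>i\<in>A. x i ^ e t i)) = 0"
    and "t \<in> F"
  shows "c t = 0"
  using assms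
proof (induction A arbitrary: F t rule: finite_induct)
  case empty
  hence "F = {t}" by blast
  thus ?case using empty(3)[of undefined] by simp
next
  case (insert a A)
  define G where "G = {s \<in> F. e s a = e t a}"
  have "(\<Sum>s\<in>G. c s * (\<Prod>i\<in>A. x i ^ e s i)) = 0" for x
  proof -
    define p where "p = (\<Sum>s\<in>F. monom (c s * (\<Prod>i\<in>A. x i ^ e s i)) (e s a))"
    have "poly p z = 0" for z
    proof -
      have "poly p z = (\<Sum>s\<in>F. c s * (\<Prod>i\<in>insert a A. (x(a := z)) i ^ e s i))"
        unfolding p_def poly_sum poly_monom
      proof (intro sum.cong refl)
        fix s
        have "(\<Prod>i\<in>A. (x(a := z)) i ^ e s i) = (\<Prod>i\<in>A. x i ^ e s i)"
          using insert.hyps by (intro prod.cong) auto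
        thus "c s * (\<Prod>i\<in>A. x i ^ e s i) * z ^ e s a = c s * (\<Prod>i\<in>insert a A. (x(a := z)) i ^ e s i)"
          using insert.hyps by simp
      qed
      thus ?thesis using insert.prems(3) by simp
    qed
    hence "p = 0" using poly_all_0_iff_0 by blast
    hence "0 = coeff p (e t a)" by simp
    also have "\<dots> = (\<Sum>s\<in>F. if e s a = e t a then c s * (\<Prod>i\<in>A. x i ^ e s i) else 0)"
      unfolding p_def coeff_sum by (intro sum.cong) auto
    also have "\<dots> = (\<Sum>s\<in>G. c s * (\<Prod>i\<in>A. x i ^ e s i))"
      unfolding G_def using insert.prems by (simp add: sum.inter_filter)
    finally show ?thesis by simp
  qed
  moreover have "s = s'" if "s \<in> G" "s' \<in> G" "\<And>i. i \<in> A \<Longrightarrow> e s i = e s' i" for s s'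
    using that by (intro insert.prems(2)) (auto simp: G_def)
  ultimately show ?case
    using insert.IH[of G t] insert.prems by (simp add: G_def)
qed

lemma mpoly_eq_0_by_peval:
  fixes p :: xpoly
  assumes "\<And>x. peval x p = 0"
  shows "p = 0"
proof (rule poly_mapping_eqI)
  fix m
  show "Poly_Mapping.lookup p m = Poly_Mapping.lookup 0 m"
  proof (cases "m \<in> Poly_Mapping.keys p")
    case True
    have "Poly_Mapping.lookup p m = 0"
    proof (rule monomials_independent[where A = "poly_vars p" and F = "Poly_Mapping.keys p"
          and e = Poly_Mapping.lookup, OF _ _ _ _ True])
      fix s t assume *: "s \<in> Poly_Mapping.keys p" "t \<in> Poly_Mapping.keys p"
        "\<And>i. i \<in> poly_vars p \<Longrightarrow> Poly_Mapping.lookup s i = Poly_Mapping.lookup t i"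
      show "s = t"
      proof (rule poly_mapping_eqI)
        fix i show "Poly_Mapping.lookup s i = Poly_Mapping.lookup t i"
          using * by (cases "i \<in> poly_vars p") (auto simp: poly_vars_def in_keys_iff)
      qed
    qed (use assms in \<open>simp_all flip: peval_superset\<close>)
    thus ?thesis by simp
  qed (simp add: in_keys_iff)
qed

lemma poly_subst_Const_Var [simp]: "poly_subst Const Var p = p"
  using rename_id[of p] by (simp add: rename_def)

section \<open>Divisibility by the linear forms x_i + x_j\<close>

lemma dvd_diff_mult:
  fixes d :: "'a::comm_ring_1"
  assumes "d dvd a - a'" "d dvd b - b'"
  shows "d dvd a * b - a' * b'"
proof -
  have "a * b - a' * b' = (a - a') * b + a' * (b - b')" by (simp add: algebra_simps)
  thus ?thesis using assms by simp
qed

text \<open>Congruence modulo d respects sums and products. For the substitution x_j := -x_i it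
  shows that a polynomial differs from its image by a multiple of x_i + x_j.\<close>

lemma dvd_poly_subst_diff:
  fixes p :: "'a::comm_ring_1 mpoly"
  assumes "\<And>i. d dvd f i - g i"
  shows "d dvd poly_subst Const f p - poly_subst Const g p"
proof (induction p rule: mpoly_induct)
  case (add m a p)
  have pw: "d dvd f i ^ k - g i ^ k" for i k
    by (induction k) (use assms in \<open>auto intro: dvd_diff_mult\<close>)
  have "d dvd (\<Prod>i\<in>I. f i ^ Poly_Mapping.lookup m i) - (\<Prod>i\<in>I. g i ^ Poly_Mapping.lookup m i)" for I
    by (induction I rule: infinite_finite_induct) (auto intro: dvd_diff_mult pw)
  hence "d dvd poly_subst Const f (Poly_Mapping.single m a) - poly_subst Const g (Poly_Mapping.single m a)"
    by (simp add: poly_subst_single flip: right_diff_distrib)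
  from dvd_add[OF this add] show ?case
    by (simp add: poly_subst_add Const_add algebra_simps)
qed simp

interpretation subst_Const: comm_ring_hom "poly_subst Const f :: 'a::comm_ring_1 mpoly \<Rightarrow> 'a mpoly" for f
  by (rule poly_subst_comm_ring_hom[OF comm_ring_hom_Const])

lemma peval_poly_subst_Const: "peval x (poly_subst Const f p) = peval (\<lambda>i. peval x (f i)) (p :: 'a::comm_ring_1 mpoly)"
proof (induction p rule: mpoly_induct)
  case (add m a p)
  have "peval x (poly_subst Const f (Poly_Mapping.single m a)) = peval (\<lambda>i. peval x (f i)) (Poly_Mapping.single m a)"
    by (simp add: poly_subst_single peval.hom_mult peval.hom_prod peval.hom_power) (simp add: peval_def poly_subst_single)
  thus ?case by (simp add: subst_Const.hom_add peval.hom_add add)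
qed simp

text \<open>Reduction modulo x_i + x_j, realised as an endomorphism of the polynomial ring, so that
  no quotient ring has to be formed.\<close>

definition flip_var :: "nat \<Rightarrow> nat \<Rightarrow> xpoly \<Rightarrow> xpoly" where
  "flip_var i j = poly_subst Const (Var(j := - Var i))"

interpretation flip_var: comm_ring_hom "flip_var i j" for i j
  unfolding flip_var_def by (rule poly_subst_comm_ring_hom[OF comm_ring_hom_Const])

lemma peval_flip_var: "peval x (flip_var i j p) = peval (x(j := - x i)) p"
  unfolding flip_var_def peval_poly_subst_Const by (rule arg_cong2[where f = peval]) (auto simp: fun_eq_iff peval.hom_uminus)

lemma sum_vars_dvd_iff:
  assumes "i \<noteq> j"
  shows "Var i + Var j dvd p \<longleftrightarrow> flip_var i j p = 0"
proof
  assume "Var i + Var j dvd p"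
  then obtain q where "p = (Var i + Var j) * q" by (elim dvdE)
  thus "flip_var i j p = 0"
    using assms by (simp add: flip_var.hom_mult flip_var.hom_add) (simp add: flip_var_def)
next
  assume "flip_var i j p = 0"
  moreover have "Var i + Var j dvd poly_subst Const Var p - poly_subst Const (Var(j := - Var i)) p"
    by (rule dvd_poly_subst_diff) (auto simp: add.commute)
  ultimately show "Var i + Var j dvd p" by (simp add: flip_var_def)
qed

lemma sum_vars_dvd_peval_iff:
  assumes "i \<noteq> j"
  shows "Var i + Var j dvd (p :: xpoly) \<longleftrightarrow> (\<forall>x. peval (x(j := - x i)) p = 0)"
  unfolding sum_vars_dvd_iff[OF assms]
  by (metis mpoly_eq_0_by_peval peval.hom_zero peval_flip_var)

text \<open>x_i + x_j generates the kernel of \<open>flip_var i j\<close>, a homomorphism into an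
  integral domain.\<close>

lemma prime_sum_vars:
  assumes "i \<noteq> j"
  shows "prime_elem (Var i + Var j :: xpoly)"
  unfolding prime_elem_def
proof (intro conjI allI impI)
  have "peval (\<lambda>k. 1) (Var i + Var j :: xpoly) \<noteq> 0" by (simp add: peval.hom_add)
  thus "Var i + Var j \<noteq> (0 :: xpoly)" by force
  show "\<not> Var i + Var j dvd (1 :: xpoly)"
    using assms by (simp add: sum_vars_dvd_iff)
next
  fix a b :: xpoly
  assume "Var i + Var j dvd a * b"
  thus "Var i + Var j dvd a \<or> Var i + Var j dvd b"
    using assms by (simp add: sum_vars_dvd_iff flip_var.hom_mult)
qed

text \<open>Each factor p of p^k goes into b, where it can be cancelled. Together with the next
  lemma this takes the place of unique factorization.\<close>

lemma prime_elem_power_dvd_multD: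
  fixes p :: "'a::idom"
  assumes "prime_elem p" "p ^ k dvd a * b" "\<not> p dvd a"
  shows "p ^ k dvd b"
  using assms(2)
proof (induction k arbitrary: b)
  case (Suc k)
  from Suc.prems have "p dvd a * b"
    unfolding power_Suc by (rule dvd_mult_left)
  hence "p dvd b" using assms by (auto simp: prime_elem_def)
  then obtain b' where b': "b = p * b'" by (elim dvdE)
  have "p \<noteq> 0" using assms(1) by (simp add: prime_elem_def)
  hence "p ^ k dvd a * b'" using Suc.prems b' by (simp add: mult.left_commute)
  from Suc.IH[OF this] show ?case by (simp add: b' mult_dvd_mono)
qed simp

lemma prime_elem_dvd_prod:
  fixes p :: "'a::idom"
  assumes "prime_elem p" "finite I" "p dvd (\<Prod>i\<in>I. f i)"
  shows "\<exists>i\<in>I. p dvd f i"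
  using assms(2,3)
  by (induction I rule: finite_induct)
     (use assms(1) in \<open>auto simp: prime_elem_def\<close>)

definition var_pairs :: "nat \<Rightarrow> (nat \<times> nat) set" where
  "var_pairs N = {(i, j). 1 \<le> i \<and> i < j \<and> j \<le> N}"

definition sum_prod :: "nat \<Rightarrow> xpoly" where
  "sum_prod N = (\<Prod>(i, j)\<in>var_pairs N. Var i + Var j)"

lemma finite_var_pairs [simp]: "finite (var_pairs N)"
  by (rule finite_subset[of _ "{1..N} \<times> {1..N}"]) (auto simp: var_pairs_def)

text \<open>The linear forms are primes none of which divides another, so their k-th powers can be
  collected one after the other.\<close>

lemma sum_prod_power_dvd:
  assumes "\<And>i j. (i, j) \<in> var_pairs N \<Longrightarrow> (Var i + Var j) ^ k dvd p"
  shows "sum_prod N ^ k dvd p"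
proof -
  have "(\<Prod>(i, j)\<in>Q. Var i + Var j) ^ k dvd p" if "Q \<subseteq> var_pairs N" for Q
    using finite_subset[OF that finite_var_pairs] that
  proof (induction Q rule: finite_induct)
    case (insert x Q)
    obtain i j where x: "x = (i, j)" by force
    have ij: "1 \<le> i" "i < j" "j \<le> N" using insert x by (auto simp: var_pairs_def)
    have pr: "prime_elem (Var i + Var j :: xpoly)" using ij by (intro prime_sum_vars) simp
    have "\<not> Var i + Var j dvd (Var a + Var b :: xpoly)" if "(a, b) \<in> Q" for a b
    proof -
      have ab: "1 \<le> a" "a < b" "b \<le> N" "(a, b) \<noteq> (i, j)"
        using insert that x by (auto simp: var_pairs_def)
      \<comment> \<open>A point of the hyperplane x_i + x_j = 0 with x_i = -1, x_j = 1 and all other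
        coordinates 2; every other pair of coordinates has sum 1, 3 or 4. It is written as a
        function update to fit \<open>sum_vars_dvd_peval_iff\<close>.\<close>
      have "peval ((\<lambda>k. if k = i then -1 else if k = j then 1 else 2)(j := - (if i = i then -1 else if i = j then 1 else 2)))
          (Var a + Var b :: xpoly) \<noteq> 0"
        using ab ij by (auto simp: peval.hom_add)
      thus ?thesis using ij by (subst sum_vars_dvd_peval_iff) fast+
    qed
    hence "\<not> Var i + Var j dvd (\<Prod>(a, b)\<in>Q. Var a + Var b :: xpoly)"
      by (auto dest!: prime_elem_dvd_prod[OF pr insert.hyps(1)])
    hence nd: "\<not> Var i + Var j dvd (\<Prod>(a, b)\<in>Q. Var a + Var b :: xpoly) ^ k"
      using prime_elem_dvd_prod[OF pr, of "{..<k}" "\<lambda>_. \<Prod>(a, b)\<in>Q. Var a + Var b"] by auto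
    from insert obtain q where q: "p = (\<Prod>(a, b)\<in>Q. Var a + Var b) ^ k * q" by auto
    have "(Var i + Var j) ^ k dvd p" using assms insert x by auto
    hence "(Var i + Var j) ^ k dvd q"
      unfolding q by (rule prime_elem_power_dvd_multD[OF pr _ nd])
    hence "(\<Prod>(a, b)\<in>Q. Var a + Var b) ^ k * (Var i + Var j) ^ k dvd p"
      unfolding q by (rule mult_dvd_mono[OF dvd_refl])
    thus ?case using insert by (simp add: x power_mult_distrib mult.commute)
  qed simp
  thus ?thesis by (simp add: sum_prod_def)
qed

lemma sum_prod_nonzero: "sum_prod N \<noteq> 0"
proof -
  have "peval (\<lambda>k. 1) (sum_prod N) \<noteq> 0"
    by (auto simp: sum_prod_def peval.hom_prod peval.hom_add)
  thus ?thesis by force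
qed

section \<open>Coefficients and multilinear evaluation\<close>

lemma mpoly_sum_monomials:
  "p = (\<Sum>m\<in>Poly_Mapping.keys p. Poly_Mapping.single m (Poly_Mapping.lookup p m))"
  by (rule poly_mapping_eqI) (auto simp: lookup_sum lookup_single when_def in_keys_iff)

lemma Var_power: "(Var i :: 'a::comm_semiring_1 mpoly) ^ k = Poly_Mapping.single (Poly_Mapping.single i k) 1"
  by (induction k) (simp_all add: Var_def mult_single flip: single_add)

lemma Const_mult_single: "Const a * Poly_Mapping.single m (b :: 'a::comm_semiring_1) = Poly_Mapping.single m (a * b)"
  by (simp add: Const_def mult_single)

lemma monomial_eq_single:
  "Const a * (\<Prod>i\<in>I. Var (f i) ^ g i)
    = Poly_Mapping.single (\<Sum>i\<in>I. Poly_Mapping.single (f i) (g i)) (a :: 'a::comm_semiring_1)"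
proof -
  have "(\<Prod>i\<in>I. Var (f i) ^ g i) = Poly_Mapping.single (\<Sum>i\<in>I. Poly_Mapping.single (f i) (g i)) (1::'a)"
    by (induction I rule: infinite_finite_induct) (simp_all add: Var_power mult_single)
  thus ?thesis by (simp add: Const_mult_single)
qed

lemma lookup_Const_mult [simp]:
  "Poly_Mapping.lookup (Const a * P) m = a * Poly_Mapping.lookup P (m :: nat \<Rightarrow>\<^sub>0 nat)"
  for P :: "'a::comm_semiring_1 mpoly"
  by (induction P rule: mpoly_induct)
     (auto simp: distrib_left lookup_add Const_mult_single lookup_single when_def)

lemma rename_single_bij:
  assumes "bij \<pi>"
  shows "rename \<pi> (Poly_Mapping.single m a) = Poly_Mapping.single (Poly_Mapping.map_key (inv \<pi>) m) (a :: 'a::comm_semiring_1)"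
proof -
  have inj: "inj (inv \<pi>)" using assms by (simp add: bij_imp_bij_inv bij_is_inj)
  have "(\<Sum>i\<in>Poly_Mapping.keys m. Poly_Mapping.single (\<pi> i) (Poly_Mapping.lookup m i)) = Poly_Mapping.map_key (inv \<pi>) m"
  proof (rule poly_mapping_eqI)
    fix j
    have "Poly_Mapping.lookup (\<Sum>i\<in>Poly_Mapping.keys m. Poly_Mapping.single (\<pi> i) (Poly_Mapping.lookup m i)) j
       = (\<Sum>i\<in>Poly_Mapping.keys m. if i = inv \<pi> j then Poly_Mapping.lookup m i else 0)"
      unfolding lookup_sum
      by (intro sum.cong refl) (use assms in \<open>auto simp: lookup_single when_def bij_inv_eq_iff\<close>)
    thus "Poly_Mapping.lookup (\<Sum>i\<in>Poly_Mapping.keys m. Poly_Mapping.single (\<pi> i) (Poly_Mapping.lookup m i)) j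
       = Poly_Mapping.lookup (Poly_Mapping.map_key (inv \<pi>) m) j"
      by (auto simp: map_key.rep_eq inj in_keys_iff)
  qed
  thus ?thesis by (simp add: rename_single monomial_eq_single)
qed

lemma lookup_rename:
  fixes P :: "'a::comm_semiring_1 mpoly"
  assumes "bij \<pi>"
  shows "Poly_Mapping.lookup (rename \<pi> P) m = Poly_Mapping.lookup P (Poly_Mapping.map_key \<pi> m)"
proof (induction P rule: mpoly_induct)
  case (add m' a p)
  have inj: "inj (inv \<pi>)" "inj \<pi>" using assms by (simp_all add: bij_imp_bij_inv bij_is_inj)
  have "Poly_Mapping.map_key (inv \<pi>) m' = m \<longleftrightarrow> m' = Poly_Mapping.map_key \<pi> m"
  proof
    assume "Poly_Mapping.map_key (inv \<pi>) m' = m"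
    hence "m = Poly_Mapping.map_key (inv \<pi>) m'" ..
    thus "m' = Poly_Mapping.map_key \<pi> m"
      by (intro poly_mapping_eqI) (use inj assms in \<open>simp add: map_key.rep_eq inv_f_f\<close>)
  next
    assume "m' = Poly_Mapping.map_key \<pi> m"
    thus "Poly_Mapping.map_key (inv \<pi>) m' = m"
      by (intro poly_mapping_eqI) (use inj assms in \<open>simp add: map_key.rep_eq surj_f_inv_f bij_is_surj\<close>)
  qed
  thus ?case
    by (simp add: rename_add rename_single_bij[OF assms] lookup_add lookup_single add when_def)
qed simp

section \<open>Occurring variables and the ring of symmetric polynomials\<close>

lemma poly_vars_add: "poly_vars (p + q) \<subseteq> poly_vars p \<union> poly_vars q"
  using Poly_Mapping.keys_add[of p q] by (auto simp: poly_vars_def)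

lemma poly_vars_mult: "poly_vars (p * q) \<subseteq> poly_vars p \<union> poly_vars (q :: 'a::comm_semiring_1 mpoly)"
proof
  fix i assume "i \<in> poly_vars (p * q)"
  then obtain m where m: "m \<in> Poly_Mapping.keys (p * q)" "i \<in> Poly_Mapping.keys m"
    by (auto simp: poly_vars_def)
  then obtain a b where ab: "a \<in> Poly_Mapping.keys p" "b \<in> Poly_Mapping.keys q" "m = a + b"
    using keys_mult[of p q] by blast
  thus "i \<in> poly_vars p \<union> poly_vars q"
    using m(2) Poly_Mapping.keys_add[of a b] by (auto simp: poly_vars_def)
qed

lemma poly_vars_Const [simp]: "poly_vars (Const a) = {}"
  by (auto simp: poly_vars_def Const_def split: if_splits)

lemma poly_vars_0 [simp]: "poly_vars 0 = {}"
  and poly_vars_1 [simp]: "poly_vars (1 :: 'a::zero_neq_one mpoly) = {}"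
  by (simp_all add: poly_vars_def)

lemma poly_vars_Var [simp]: "poly_vars (Var i :: 'a::zero_neq_one mpoly) = {i}"
  by (simp add: poly_vars_def Var_def)

lemma poly_vars_uminus [simp]: "poly_vars (- p) = poly_vars (p :: 'a::ab_group_add mpoly)"
  by (simp add: poly_vars_def keys.rep_eq)

lemma poly_vars_prod_subset:
  assumes "\<And>i. i \<in> I \<Longrightarrow> poly_vars (f i) \<subseteq> A"
  shows "poly_vars (prod f I :: 'a::comm_semiring_1 mpoly) \<subseteq> A"
  using assms
proof (induction I rule: infinite_finite_induct)
  case (insert i I)
  thus ?case using poly_vars_mult[of "f i" "prod f I"] by auto
qed auto

lemma sym_polys_0 [simp]: "0 \<in> sym_polys N"
  and sym_polys_Const [simp]: "Const c \<in> sym_polys N"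
  and sym_polys_add: "p \<in> sym_polys N \<Longrightarrow> q \<in> sym_polys N \<Longrightarrow> p + q \<in> sym_polys N"
  and sym_polys_mult: "p \<in> sym_polys N \<Longrightarrow> q \<in> sym_polys N \<Longrightarrow> p * q \<in> sym_polys N"
  and sym_polys_uminus: "p \<in> sym_polys N \<Longrightarrow> - p \<in> sym_polys N"
  using poly_vars_add[of p q] poly_vars_mult[of p q]
  by (auto simp: sym_polys_def rename_add rename_mult)

lemma sym_polys_1 [simp]: "1 \<in> sym_polys N"
  using sym_polys_Const[of 1 N] by simp

lemma sym_polys_diff: "p \<in> sym_polys N \<Longrightarrow> q \<in> sym_polys N \<Longrightarrow> p - q \<in> sym_polys N"
  using sym_polys_add[of p N "- q"] sym_polys_uminus[of q N] by simp

lemma sym_polys_sum: "(\<And>i. i \<in> I \<Longrightarrow> f i \<in> sym_polys N) \<Longrightarrow> sum f I \<in> sym_polys N"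
  by (induction I rule: infinite_finite_induct) (auto intro: sym_polys_add)

lemma sym_polys_prod: "(\<And>i. i \<in> I \<Longrightarrow> f i \<in> sym_polys N) \<Longrightarrow> prod f I \<in> sym_polys N"
  by (induction I rule: infinite_finite_induct) (auto intro: sym_polys_mult)

lemma sym_polys_of_int [simp]: "of_int k \<in> sym_polys N"
  using sym_polys_Const[of "of_int k" N] by (simp add: Const.hom_of_int)

text \<open>The tensor product of the functionals X_i^k \<mapsto> \<Lambda> i k for i in A, applied
  after specialising the x. Evaluation of only the even or only the odd part of a polynomial is such
  a functional, but it is not a ring homomorphism and hence not covered by
  \<open>Xeval\<close>.\<close>

definition mlin :: "nat set \<Rightarrow> (nat \<Rightarrow> complex) \<Rightarrow> (nat \<Rightarrow> nat \<Rightarrow> complex) \<Rightarrow> Xpoly \<Rightarrow> complex" where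
  "mlin A x \<Lambda> P = (\<Sum>m\<in>Poly_Mapping.keys P. peval x (Poly_Mapping.lookup P m)
     * (\<Prod>i\<in>A. \<Lambda> i (Poly_Mapping.lookup m i)))"

lemma mlin_superset:
  assumes "finite F" "Poly_Mapping.keys P \<subseteq> F"
  shows "mlin A x \<Lambda> P = (\<Sum>m\<in>F. peval x (Poly_Mapping.lookup P m)
     * (\<Prod>i\<in>A. \<Lambda> i (Poly_Mapping.lookup m i)))"
  unfolding mlin_def by (rule sum.mono_neutral_left) (use assms in \<open>auto simp: in_keys_iff\<close>)

lemma mlin_0 [simp]: "mlin A x \<Lambda> 0 = 0"
  by (simp add: mlin_def)

lemma mlin_add: "mlin A x \<Lambda> (P + Q) = mlin A x \<Lambda> P + mlin A x \<Lambda> Q"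
proof -
  let ?A = "Poly_Mapping.keys P \<union> Poly_Mapping.keys Q"
  have "Poly_Mapping.keys (P + Q) \<subseteq> ?A" by (rule Poly_Mapping.keys_add)
  thus ?thesis
    by (subst (1 2 3) mlin_superset[where F = ?A])
       (auto simp: lookup_add algebra_simps sum.distrib peval.hom_add)
qed

lemma mlin_sum: "mlin A x \<Lambda> (sum f I) = (\<Sum>i\<in>I. mlin A x \<Lambda> (f i))"
  by (induction I rule: infinite_finite_induct) (simp_all add: mlin_add)

lemma mlin_single [simp]:
  "mlin A x \<Lambda> (Poly_Mapping.single m a) = peval x a * (\<Prod>i\<in>A. \<Lambda> i (Poly_Mapping.lookup m i))"
  by (subst mlin_superset[where F = "{m}"]) (auto simp: lookup_single)

lemma mlin_Const_mult [simp]: "mlin A x \<Lambda> (Const a * P) = peval x a * mlin A x \<Lambda> P"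
  by (induction P rule: mpoly_induct)
     (simp_all add: distrib_left mlin_add Const_mult_single peval.hom_mult mult.assoc)

lemma mlin_of_int_mult [simp]: "mlin A x \<Lambda> (of_int k * P) = of_int k * mlin A x \<Lambda> P"
  using mlin_Const_mult[of A x \<Lambda> "of_int k" P] by (simp add: Const.hom_of_int peval.hom_of_int)

text \<open>Within one variable the functionals are not multiplicative. With disjoint sets of
  variables, each exponent of a product comes from a single factor.\<close>

lemma mlin_mult:
  assumes "finite A" "finite B" "A \<inter> B = {}" "poly_vars P \<subseteq> A" "poly_vars Q \<subseteq> B"
  shows "mlin (A \<union> B) x \<Lambda> (P * Q) = mlin A x \<Lambda> P * mlin B x \<Lambda> Q"
proof -
  have "P * Q = (\<Sum>m\<in>Poly_Mapping.keys P. \<Sum>m'\<in>Poly_Mapping.keys Q.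
      Poly_Mapping.single (m + m') (Poly_Mapping.lookup P m * Poly_Mapping.lookup Q m'))"
    by (subst (1) mpoly_sum_monomials[of P], subst (1) mpoly_sum_monomials[of Q])
       (simp add: sum_product mult_single)
  hence "mlin (A \<union> B) x \<Lambda> (P * Q) = (\<Sum>m\<in>Poly_Mapping.keys P. \<Sum>m'\<in>Poly_Mapping.keys Q.
      (peval x (Poly_Mapping.lookup P m) * peval x (Poly_Mapping.lookup Q m')) *
      (\<Prod>i\<in>A\<union>B. \<Lambda> i (Poly_Mapping.lookup (m + m') i)))"
    by (simp add: mlin_sum peval.hom_mult)
  also have "\<dots> = (\<Sum>m\<in>Poly_Mapping.keys P. \<Sum>m'\<in>Poly_Mapping.keys Q.
      (peval x (Poly_Mapping.lookup P m) * (\<Prod>i\<in>A. \<Lambda> i (Poly_Mapping.lookup m i))) *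
      (peval x (Poly_Mapping.lookup Q m') * (\<Prod>i\<in>B. \<Lambda> i (Poly_Mapping.lookup m' i))))"
  proof (intro sum.cong refl)
    fix m m' assume *: "m \<in> Poly_Mapping.keys P" "m' \<in> Poly_Mapping.keys Q"
    have "Poly_Mapping.lookup m' i = 0" if "i \<in> A" for i
      using that * assms by (auto simp: poly_vars_def simp flip: not_in_keys_iff_lookup_eq_zero)
    moreover have "Poly_Mapping.lookup m i = 0" if "i \<in> B" for i
      using that * assms by (auto simp: poly_vars_def simp flip: not_in_keys_iff_lookup_eq_zero)
    ultimately have "(\<Prod>i\<in>A\<union>B. \<Lambda> i (Poly_Mapping.lookup (m + m') i))
        = (\<Prod>i\<in>A. \<Lambda> i (Poly_Mapping.lookup m i)) * (\<Prod>i\<in>B. \<Lambda> i (Poly_Mapping.lookup m' i))"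
      using assms by (simp add: prod.union_disjoint lookup_add)
    thus "(peval x (Poly_Mapping.lookup P m) * peval x (Poly_Mapping.lookup Q m')) *
      (\<Prod>i\<in>A\<union>B. \<Lambda> i (Poly_Mapping.lookup (m + m') i)) = (peval x (Poly_Mapping.lookup P m) * (\<Prod>i\<in>A. \<Lambda> i (Poly_Mapping.lookup m i))) *
      (peval x (Poly_Mapping.lookup Q m') * (\<Prod>i\<in>B. \<Lambda> i (Poly_Mapping.lookup m' i)))"
      by simp
  qed
  finally show ?thesis by (simp add: mlin_def sum_product)
qed

lemma mlin_prod:
  assumes "finite I" "\<And>i. i \<in> I \<Longrightarrow> finite (A i)" "\<And>i. i \<in> I \<Longrightarrow> poly_vars (P i) \<subseteq> A i"
    and "\<And>i j. i \<in> I \<Longrightarrow> j \<in> I \<Longrightarrow> i \<noteq> j \<Longrightarrow> A i \<inter> A j = {}"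
  shows "mlin (\<Union>i\<in>I. A i) x \<Lambda> (\<Prod>i\<in>I. P i) = (\<Prod>i\<in>I. mlin (A i) x \<Lambda> (P i))"
  using assms
proof (induction I rule: finite_induct)
  case empty
  show ?case using mlin_single[of "{}" x \<Lambda> 0 1] by simp
next
  case (insert i I)
  have "A i \<inter> (\<Union>i\<in>I. A i) = {}" using insert by blast
  moreover have "poly_vars (\<Prod>i\<in>I. P i) \<subseteq> (\<Union>i\<in>I. A i)"
    by (rule poly_vars_prod_subset) (use insert in blast)
  ultimately show ?case using insert by (simp add: mlin_mult)
qed

lemma mlin_rename:
  assumes "\<pi> permutes A" "finite A"
  shows "mlin A x \<Lambda> (rename \<pi> P) = mlin A x (\<Lambda> \<circ> \<pi>) P"
proof (induction P rule: mpoly_induct)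
  case (add m a p)
  have b: "bij \<pi>" using assms permutes_bij by blast
  hence inj: "inj (inv \<pi>)" by (simp add: bij_imp_bij_inv bij_is_inj)
  have "(\<Prod>i\<in>A. \<Lambda> i (Poly_Mapping.lookup (Poly_Mapping.map_key (inv \<pi>) m) i))
      = (\<Prod>i\<in>A. \<Lambda> (\<pi> i) (Poly_Mapping.lookup (Poly_Mapping.map_key (inv \<pi>) m) (\<pi> i)))"
    using prod.permute[OF assms(1), of "\<lambda>i. \<Lambda> i (Poly_Mapping.lookup (Poly_Mapping.map_key (inv \<pi>) m) i)"] by simp
  also have "\<dots> = (\<Prod>i\<in>A. (\<Lambda> \<circ> \<pi>) i (Poly_Mapping.lookup m i))"
    using b by (simp add: map_key.rep_eq inj bij_is_inj)
  finally have "mlin A x \<Lambda> (rename \<pi> (Poly_Mapping.single m a)) = mlin A x (\<Lambda> \<circ> \<pi>) (Poly_Mapping.single m a)"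
    by (simp add: rename_single_bij[OF b])
  thus ?case by (simp only: rename_add mlin_add add)
qed simp

lemma mlin_alt:
  "mlin {1..l} x \<Lambda> (alt l P) = (\<Sum>\<sigma> | \<sigma> permutes {1..l}. of_int (sign \<sigma>) * mlin {1..l} x (\<Lambda> \<circ> \<sigma>) P)"
  by (simp add: alt_def mlin_sum mlin_rename)

lemma Xeval_alt:
  "Xeval X x (alt l P) = (\<Sum>\<sigma> | \<sigma> permutes {1..l}. of_int (sign \<sigma>) * Xeval (X \<circ> \<sigma>) x P)"
  by (simp add: alt_def Xeval.hom_sum Xeval.hom_mult Xeval.hom_of_int)

text \<open>The conditions of \<open>ext_power\<close> without antisymmetry and for any set of
  variables, as they hold for the products that are still to be antisymmetrised.\<close>

definition poly_frag :: "nat \<Rightarrow> nat set \<Rightarrow> Xpoly set" where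
  "poly_frag n A = {P. \<forall>m\<in>Poly_Mapping.keys P. Poly_Mapping.keys m \<subseteq> A
     \<and> (\<forall>i. Poly_Mapping.lookup m i < 2 * n) \<and> Poly_Mapping.lookup P m \<in> sym_polys (2 * n)}"

lemma ext_power_altdef:
  "ext_power n l = {P \<in> poly_frag n {1..l}. \<forall>\<pi>. \<pi> permutes {1..l} \<longrightarrow> rename \<pi> P = of_int (sign \<pi>) * P}"
  by (auto simp: ext_power_def poly_frag_def poly_vars_def)

lemma poly_frag_vars: "P \<in> poly_frag n A \<Longrightarrow> poly_vars P \<subseteq> A"
  by (auto simp: poly_frag_def poly_vars_def)

lemma poly_frag_lookup: "P \<in> poly_frag n A \<Longrightarrow> Poly_Mapping.lookup P m \<in> sym_polys (2 * n)"
  by (cases "m \<in> Poly_Mapping.keys P") (auto simp: poly_frag_def in_keys_iff)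

lemma poly_frag_0 [simp]: "0 \<in> poly_frag n A"
  by (simp add: poly_frag_def)

lemma poly_frag_add: "P \<in> poly_frag n A \<Longrightarrow> Q \<in> poly_frag n A \<Longrightarrow> P + Q \<in> poly_frag n A"
  using Poly_Mapping.keys_add[of P Q]
  by (auto simp: poly_frag_def lookup_add in_keys_iff subset_iff intro!: sym_polys_add)

lemma poly_frag_sum: "(\<And>i. i \<in> I \<Longrightarrow> f i \<in> poly_frag n A) \<Longrightarrow> sum f I \<in> poly_frag n A"
  by (induction I rule: infinite_finite_induct) (auto intro: poly_frag_add)

lemma poly_frag_single:
  "a \<in> sym_polys (2 * n) \<Longrightarrow> Poly_Mapping.keys m \<subseteq> A \<Longrightarrow> (\<And>i. Poly_Mapping.lookup m i < 2 * n)
    \<Longrightarrow> Poly_Mapping.single m a \<in> poly_frag n A"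
  by (auto simp: poly_frag_def)

lemma poly_frag_Const_mult:
  "P \<in> poly_frag n A \<Longrightarrow> a \<in> sym_polys (2 * n) \<Longrightarrow> Const a * P \<in> poly_frag n A"
  by (auto simp: poly_frag_def in_keys_iff intro: sym_polys_mult)

lemma poly_frag_of_int_mult: "P \<in> poly_frag n A \<Longrightarrow> of_int k * P \<in> poly_frag n A"
  using poly_frag_Const_mult[of P n A "of_int k"] by (simp add: Const.hom_of_int)

text \<open>The degree bound survives because no variable occurs in both factors.\<close>

lemma poly_frag_mult:
  assumes "A \<inter> B = {}" and P: "P \<in> poly_frag n A" and Q: "Q \<in> poly_frag n B"
  shows "P * Q \<in> poly_frag n (A \<union> B)"
proof -
  have "P * Q = (\<Sum>m\<in>Poly_Mapping.keys P. \<Sum>m'\<in>Poly_Mapping.keys Q.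
      Poly_Mapping.single (m + m') (Poly_Mapping.lookup P m * Poly_Mapping.lookup Q m'))"
    by (subst (1) mpoly_sum_monomials[of P], subst (1) mpoly_sum_monomials[of Q])
       (simp add: sum_product mult_single)
  also have "\<dots> \<in> poly_frag n (A \<union> B)"
  proof (intro poly_frag_sum poly_frag_single)
    fix m m' assume *: "m \<in> Poly_Mapping.keys P" "m' \<in> Poly_Mapping.keys Q"
    show "Poly_Mapping.lookup P m * Poly_Mapping.lookup Q m' \<in> sym_polys (2 * n)"
      using P Q by (intro sym_polys_mult poly_frag_lookup)
    show "Poly_Mapping.keys (m + m') \<subseteq> A \<union> B"
      using Poly_Mapping.keys_add[of m m'] * P Q unfolding poly_frag_def by blast
    fix i
    have "Poly_Mapping.lookup m i = 0 \<or> Poly_Mapping.lookup m' i = 0"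
      using * assms unfolding poly_frag_def not_in_keys_iff_lookup_eq_zero[symmetric] by blast
    thus "Poly_Mapping.lookup (m + m') i < 2 * n"
      using * P Q by (auto simp: poly_frag_def lookup_add)
  qed
  finally show ?thesis .
qed

lemma poly_frag_prod:
  assumes "n \<ge> 1" "\<And>i. i \<in> I \<Longrightarrow> P i \<in> poly_frag n (A i)"
    and "\<And>i j. i \<in> I \<Longrightarrow> j \<in> I \<Longrightarrow> i \<noteq> j \<Longrightarrow> A i \<inter> A j = {}"
  shows "(\<Prod>i\<in>I. P i) \<in> poly_frag n (\<Union>i\<in>I. A i)"
  using assms(2,3)
proof (induction I rule: infinite_finite_induct)
  case (insert i I)
  have "A i \<inter> (\<Union>i\<in>I. A i) = {}" using insert by blast
  thus ?case using insert by (simp add: poly_frag_mult)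
\<comment> \<open>The empty product needs n >= 1: its exponents 0 have to be below 2n.\<close>
qed (use assms(1) in \<open>auto simp: poly_frag_def\<close>)

lemma poly_frag_rename:
  assumes "\<pi> permutes A" "P \<in> poly_frag n A"
  shows "rename \<pi> P \<in> poly_frag n A"
proof -
  have b: "bij \<pi>" using assms permutes_bij by blast
  show ?thesis
    unfolding poly_frag_def
  proof (intro CollectI ballI conjI subsetI allI)
    fix m assume "m \<in> Poly_Mapping.keys (rename \<pi> P)"
    hence m: "Poly_Mapping.map_key \<pi> m \<in> Poly_Mapping.keys P"
      by (simp add: in_keys_iff lookup_rename[OF b])
    have mi: "Poly_Mapping.lookup m i = Poly_Mapping.lookup (Poly_Mapping.map_key \<pi> m) (inv \<pi> i)" for i
      using b by (simp add: map_key.rep_eq bij_is_inj surj_f_inv_f bij_is_surj)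
    show "Poly_Mapping.lookup (rename \<pi> P) m \<in> sym_polys (2 * n)"
      using assms(2) by (simp add: lookup_rename[OF b] poly_frag_lookup)
    fix i
    show "Poly_Mapping.lookup m i < 2 * n" using m assms(2) by (simp add: mi poly_frag_def)
    assume "i \<in> Poly_Mapping.keys m"
    hence "inv \<pi> i \<in> Poly_Mapping.keys (Poly_Mapping.map_key \<pi> m)"
      by (simp add: in_keys_iff mi)
    hence "inv \<pi> i \<in> A" using m assms(2) by (auto simp: poly_frag_def)
    thus "i \<in> A" using permutes_in_image[OF assms(1), of "inv \<pi> i"] b
      by (simp add: surj_f_inv_f bij_is_surj)
  qed
qed

lemma alt_in_ext_power:
  assumes "P \<in> poly_frag n {1..l}"
  shows "alt l P \<in> ext_power n l"
proof -
  have "alt l P \<in> poly_frag n {1..l}"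
    unfolding alt_def using assms by (intro poly_frag_sum poly_frag_of_int_mult poly_frag_rename) auto
  moreover have "rename \<pi> (alt l P) = of_int (sign \<pi>) * alt l P" if \<pi>: "\<pi> permutes {1..l}" for \<pi>
  proof -
    have perm: "permutation \<sigma>" if "\<sigma> permutes {1..l}" for \<sigma>
      using that by (auto simp: permutation_permutes)
    have "of_int (sign \<pi>) * alt l P
      = (\<Sum>\<sigma> | \<sigma> permutes {1..l}. of_int (sign \<pi>) * (of_int (sign (\<pi> \<circ> \<sigma>)) * rename (\<pi> \<circ> \<sigma>) P))"
      unfolding alt_def sum_distrib_left
      by (rule setum_permutations_compose_left[OF \<pi>])
    also have "\<dots> = (\<Sum>\<sigma> | \<sigma> permutes {1..l}. of_int (sign \<sigma>) * rename (\<pi> \<circ> \<sigma>) P)"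
    proof (intro sum.cong refl)
      fix \<sigma> assume "\<sigma> \<in> {\<sigma>. \<sigma> permutes {1..l}}"
      hence "sign (\<pi> \<circ> \<sigma>) = sign \<pi> * sign \<sigma>" using perm \<pi> by (simp add: sign_compose)
      thus "of_int (sign \<pi>) * (of_int (sign (\<pi> \<circ> \<sigma>)) * rename (\<pi> \<circ> \<sigma>) P)
         = of_int (sign \<sigma>) * rename (\<pi> \<circ> \<sigma>) P"
        by (cases \<pi> rule: sign_cases) simp_all
    qed
    also have "\<dots> = rename \<pi> (alt l P)"
      by (simp add: alt_def rename_sum rename_of_sign rename_rename)
    finally show ?thesis ..
  qed
  ultimately show ?thesis by (simp add: ext_power_altdef)
qed

section \<open>Bezoutians\<close>

text \<open>The Bezoutian (F(y) G(z) - G(y) F(z)) / (y - z) of the polynomials F and G with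
  coefficients f and g. Without the division it makes sense in every commutative ring, also for y =
  z, and commutes with ring homomorphisms.\<close>

definition bez :: "(nat \<Rightarrow> 'a::comm_ring_1) \<Rightarrow> (nat \<Rightarrow> 'a) \<Rightarrow> nat \<Rightarrow> 'a \<Rightarrow> 'a \<Rightarrow> 'a" where
  "bez f g n y z = (\<Sum>j\<le>n. \<Sum>i<j. \<Sum>r<j - i.
     (f j * g i - f i * g j) * (y ^ (i + r) * z ^ (j - Suc r)))"

lemma sum_square_triangle:
  fixes a :: "nat \<Rightarrow> nat \<Rightarrow> 'a::comm_ring_1"
  assumes "\<And>i. a i i = 0"
  shows "(\<Sum>j\<le>n. \<Sum>i\<le>n. a j i) = (\<Sum>j\<le>n. \<Sum>i<j. a j i + a i j)"
  by (induction n) (simp_all add: assms sum.distrib lessThan_Suc_atMost)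

text \<open>The terms are paired as i < j. A pair contributes f_j g_i - f_i g_j times y^j z^i - y^i
  z^j = (y z)^i (y^(j-i) - z^(j-i)), and the last factor is y - z times a geometric sum.\<close>

lemma diff_mult_bez:
  "(y - z) * bez f g n y z
     = (\<Sum>j\<le>n. f j * y ^ j) * (\<Sum>i\<le>n. g i * z ^ i) - (\<Sum>i\<le>n. g i * y ^ i) * (\<Sum>j\<le>n. f j * z ^ j)"
proof -
  have *: "(\<Sum>r<j - i. (y - z) * (c * (y ^ (i + r) * z ^ (j - Suc r)))) = c * (y ^ j * z ^ i - y ^ i * z ^ j)"
    if ij: "i < j" for i j c
  proof -
    obtain k where k: "j = i + k" using le_Suc_ex[OF less_imp_le[OF ij]] by auto
    have "(\<Sum>r<j - i. (y - z) * (c * (y ^ (i + r) * z ^ (j - Suc r))))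
        = (\<Sum>r<k. c * (y ^ i * z ^ i) * ((y - z) * (z ^ (k - Suc r) * y ^ r)))"
    proof (rule sum.cong)
      fix r assume "r \<in> {..<k}"
      hence "j - Suc r = i + (k - Suc r)" by (simp add: k)
      thus "(y - z) * (c * (y ^ (i + r) * z ^ (j - Suc r))) = c * (y ^ i * z ^ i) * ((y - z) * (z ^ (k - Suc r) * y ^ r))"
        by (simp only: power_add mult_ac)
    qed (simp add: k)
    also have "\<dots> = c * (y ^ i * z ^ i) * (y ^ k - z ^ k)"
      by (simp only: power_diff_sumr2 sum_distrib_left)
    also have "\<dots> = c * (y ^ j * z ^ i - y ^ i * z ^ j)"
      by (simp only: k power_add right_diff_distrib mult_ac)
    finally show ?thesis .
  qed
  have "(\<Sum>i\<le>n. g i * y ^ i) * (\<Sum>j\<le>n. f j * z ^ j) = (\<Sum>j\<le>n. \<Sum>i\<le>n. g i * y ^ i * (f j * z ^ j))"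
    unfolding sum_product by (rule sum.swap)
  hence "(\<Sum>j\<le>n. f j * y ^ j) * (\<Sum>i\<le>n. g i * z ^ i) - (\<Sum>i\<le>n. g i * y ^ i) * (\<Sum>j\<le>n. f j * z ^ j)
      = (\<Sum>j\<le>n. \<Sum>i\<le>n. f j * y ^ j * (g i * z ^ i) - g i * y ^ i * (f j * z ^ j))"
    by (simp only: sum_product sum_subtractf)
  also have "\<dots> = (\<Sum>j\<le>n. \<Sum>i<j. (f j * y ^ j * (g i * z ^ i) - g i * y ^ i * (f j * z ^ j))
      + (f i * y ^ i * (g j * z ^ j) - g j * y ^ j * (f i * z ^ i)))"
    by (rule sum_square_triangle) (simp only: mult_ac diff_self)
  also have "\<dots> = (\<Sum>j\<le>n. \<Sum>i<j. \<Sum>r<j - i. (y - z) * ((f j * g i - f i * g j) * (y ^ (i + r) * z ^ (j - Suc r))))"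
  proof (rule sum.cong[OF refl], rule sum.cong[OF refl])
    fix j i :: nat assume "i \<in> {..<j}"
    hence "i < j" by simp
    show "(f j * y ^ j * (g i * z ^ i) - g i * y ^ i * (f j * z ^ j))
      + (f i * y ^ i * (g j * z ^ j) - g j * y ^ j * (f i * z ^ i))
      = (\<Sum>r<j - i. (y - z) * ((f j * g i - f i * g j) * (y ^ (i + r) * z ^ (j - Suc r))))"
      unfolding *[OF \<open>i < j\<close>] by (simp add: algebra_simps)
  qed
  also have "\<dots> = (y - z) * bez f g n y z"
    by (simp only: bez_def sum_distrib_left)
  finally show ?thesis ..
qed

text \<open>Reversing the index r exchanges y and z; cancelling y - z in
  \<open>diff_mult_bez\<close> would exclude y = z.\<close>

lemma bez_sym: "bez f g n y z = bez f g n z y"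
  unfolding bez_def
proof (rule sum.cong[OF refl], rule sum.cong[OF refl])
  fix i j :: nat assume "i \<in> {..<j}"
  show "(\<Sum>r<j - i. (f j * g i - f i * g j) * (y ^ (i + r) * z ^ (j - Suc r)))
      = (\<Sum>r<j - i. (f j * g i - f i * g j) * (z ^ (i + r) * y ^ (j - Suc r)))"
    by (subst sum.nat_diff_reindex[symmetric]) (use \<open>i \<in> {..<j}\<close> in \<open>auto intro!: sum.cong simp: mult_ac\<close>)
qed

lemma bez_hom:
  assumes "comm_ring_hom h"
  shows "h (bez f g n y z) = bez (\<lambda>i. h (f i)) (\<lambda>i. h (g i)) n (h y) (h z)"
proof -
  interpret comm_ring_hom h by fact
  show ?thesis by (simp add: bez_def hom_sum hom_mult hom_minus hom_power)
qed

text \<open>Up to sign, the diagonal value is the limit for z -> y of the difference quotient of z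
  \<mapsto> F(y) G(z) - G(y) F(z), a function that vanishes at z = y. Because of G(y) = 0 the
  derivative of F drops out.\<close>

lemma bez_diag:
  fixes f g :: "nat \<Rightarrow> complex" and n :: nat
  defines "F \<equiv> \<lambda>y. \<Sum>j\<le>n. f j * y ^ j" and "G \<equiv> \<lambda>y. \<Sum>j\<le>n. g j * y ^ j"
  assumes G: "G y = 0" and DG: "(G has_field_derivative G') (at y)"
  shows "bez f g n y y = - F y * G'"
proof -
  have "(F has_field_derivative (\<Sum>j\<le>n. f j * (of_nat j * y ^ (j - 1)))) (at y)"
    unfolding F_def by (auto intro!: derivative_eq_intros sum.cong simp: mult_ac)
  then obtain F' where DF: "(F has_field_derivative F') (at y)" by blast
  have "((\<lambda>z. F y * G z - G y * F z) has_field_derivative F y * G') (at y)"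
    by (auto intro!: derivative_eq_intros DF DG simp: G)
  hence "((\<lambda>z. (F y * G z - G y * F z - (F y * G y - G y * F y)) / (z - y)) \<longlongrightarrow> F y * G') (at y)"
    by (simp add: has_field_derivative_iff)
  moreover have "eventually (\<lambda>z. (F y * G z - G y * F z - (F y * G y - G y * F y)) / (z - y)
     = - bez f g n y z) (at y)"
    unfolding eventually_at_filter
  proof (rule always_eventually, safe)
    fix z assume "z \<noteq> y"
    moreover have "F y * G z - G y * F z - (F y * G y - G y * F y) = - bez f g n y z * (z - y)"
      using diff_mult_bez[of y z f g n] by (simp add: F_def G_def algebra_simps)
    ultimately show "(F y * G z - G y * F z - (F y * G y - G y * F y)) / (z - y) = - bez f g n y z"
      by simp
  qed
  ultimately have "((\<lambda>z. - bez f g n y z) \<longlongrightarrow> F y * G') (at y)"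
    by (rule Lim_transform_eventually)
  moreover have "((\<lambda>z. - bez f g n y z) \<longlongrightarrow> - bez f g n y y) (at y)"
    unfolding bez_def by (intro tendsto_intros)
  ultimately have "F y * G' = - bez f g n y y"
    by (intro tendsto_unique[of "at y"]) auto
  thus ?thesis by simp
qed

text \<open>For y = z the identity \<open>diff_mult_bez\<close> carries no information; there the
  vanishing comes from \<open>bez_diag\<close>.\<close>

lemma bez_eq_0:
  fixes f g :: "nat \<Rightarrow> complex"
  assumes F: "(\<Sum>j\<le>n. f j * y ^ j) = 0" and G: "(\<Sum>j\<le>n. g j * y ^ j) = 0"
  shows "bez f g n y z = 0"
proof (cases "y = z")
  case False
  thus ?thesis using diff_mult_bez[of y z f g n] F G by simp
next
  case True
  have "((\<lambda>y. \<Sum>j\<le>n. g j * y ^ j) has_field_derivative (\<Sum>j\<le>n. g j * (of_nat j * y ^ (j - 1)))) (at y)"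
    by (auto intro!: derivative_eq_intros sum.cong simp: mult_ac)
  from bez_diag[OF G this, of f] show ?thesis using F True by simp
qed

section \<open>The basis elements as antisymmetrized products\<close>

text \<open>Coefficients of X w_k(X) in powers of X^2: the factor X makes the odd w_k even, and
  P_{k,s} becomes the coefficient of (X^2)^s.\<close>

definition xi_coeff :: "nat \<Rightarrow> nat \<Rightarrow> nat \<Rightarrow> xpoly" where
  "xi_coeff n k j = (if j = 0 then 0 else Pcoeff n k (int j))"

text \<open>One of the two terms of xi_k before antisymmetrisation. It is odd in X_a and even in
  X_b, so a functional of fixed parities sees at most one of the two terms.\<close>

definition xi_half :: "nat \<Rightarrow> nat \<Rightarrow> nat \<Rightarrow> nat \<Rightarrow> Xpoly" where
  "xi_half n k a b = Var a * bez (\<lambda>j. Const (xi_coeff n k j)) (\<lambda>i. Const (elem_sym n (2 * int i))) n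
     (Var a ^ 2) (Var b ^ 2)"

lemma X_mult_wH: "X * wH n k X = (\<Sum>j\<le>n. Const (xi_coeff n k j) * (X ^ 2) ^ j)"
proof -
  have "(\<Sum>j\<le>n. Const (xi_coeff n k j) * (X ^ 2) ^ j) = (\<Sum>j=1..n. Const (xi_coeff n k j) * (X ^ 2) ^ j)"
    by (rule sum.mono_neutral_right) (auto simp: xi_coeff_def)
  also have "\<dots> = (\<Sum>s=1..n. X * (Const (Pcoeff n k (int s)) * X ^ Suc (2 * (s - 1))))"
  proof (intro sum.cong refl)
    fix j assume "j \<in> {1..n}"
    then obtain i where "j = Suc i" by (cases j) auto
    thus "Const (xi_coeff n k j) * (X ^ 2) ^ j = X * (Const (Pcoeff n k (int j)) * X ^ Suc (2 * (j - 1)))"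
      by (simp add: xi_coeff_def power_mult[symmetric] mult.left_commute[of X] flip: power_Suc)
  qed
  finally show ?thesis by (simp add: wH_eq sum_distrib_left)
qed

lemma vH0_eq: "vH0 n X = (\<Sum>j\<le>n. Const (elem_sym n (2 * int j)) * (X ^ 2) ^ j)"
  by (simp add: vH0_def power_mult atLeast0AtMost)

lemma rename_xi_half: "rename h (xi_half n k a b) = xi_half n k (h a) (h b)"
  unfolding xi_half_def
  by (simp add: rename_mult bez_hom[OF rename.comm_ring_hom_axioms] rename_power)

lemma rename_vH: "rename h (vH n r X) = vH n r (rename h X)"
  by (simp add: vH_def rename_sum rename_mult rename_power)

lemma rename_wH: "rename h (wH n r X) = wH n r (rename h X)"
  by (simp add: wH_def rename_vH rename_mult)

text \<open>The defining right-hand side collapses to 2 (X_1 w(X_1) v_0(X_2) - v_0(X_1) X_2 w(X_2)),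
  which is 2 (X_1^2 - X_2^2) S for the symmetric Bezoutian S. Cancelling 2 (X_1 + X_2) leaves xi =
  (X_1 - X_2) S.\<close>

lemma xi_eq_halves: "xi n k = xi_half n k 1 2 - xi_half n k 2 1"
proof -
  define X1 X2 :: Xpoly where "X1 = Var 1" and "X2 = Var 2"
  define S where "S = bez (\<lambda>j. Const (xi_coeff n k j)) (\<lambda>i. Const (elem_sym n (2 * int i))) n (X1 ^ 2) (X2 ^ 2)"
  have halves: "xi_half n k 1 2 - xi_half n k 2 1 = (X1 - X2) * S"
    unfolding xi_half_def S_def X1_def X2_def
    by (subst (2) bez_sym) (simp add: algebra_simps)
  have "(X1 ^ 2 - X2 ^ 2) * S = X1 * wH n k X1 * vH0 n X2 - vH0 n X1 * (X2 * wH n k X2)"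
    unfolding S_def diff_mult_bez X_mult_wH vH0_eq ..
  moreover have "(X1 + X2) * (2 * ((X1 - X2) * S)) = 2 * ((X1 ^ 2 - X2 ^ 2) * S)"
    by (simp add: algebra_simps power2_eq_square)
  ultimately have "(X1 + X2) * (2 * ((X1 - X2) * S)) = 2 * (X1 * wH n k X1 * vH0 n X2 - vH0 n X1 * (X2 * wH n k X2))"
    by simp
  also have "\<dots> = (X1 - X2) * (vH0 n X1 * wH n k X2 + vH0 n X2 * wH n k X1)
       + (X1 + X2) * (- vH0 n X1 * wH n k X2 + vH0 n X2 * wH n k X1)"
    by (simp add: algebra_simps)
  also have "\<dots> = (X1 + X2) * (2 * xi n k)" by (simp only: xi_eq X1_def X2_def)
  finally have *: "(X1 + X2) * (2 * ((X1 - X2) * S)) = (X1 + X2) * (2 * xi n k)" .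
  have "Xeval (\<lambda>_. 1) (\<lambda>_. 1) (X1 + X2) \<noteq> 0"
    by (simp add: X1_def X2_def Xeval.hom_add)
  hence "X1 + X2 \<noteq> 0" by force
  with * have "xi n k = (X1 - X2) * S" by simp
  thus ?thesis by (simp only: halves)
qed

lemma xi_eq_alt: "xi n k = alt 2 (xi_half n k 1 2)"
proof -
  have "{1..2::nat} = {1, 2}" by auto
  hence "{\<sigma>. \<sigma> permutes {1..2::nat}} = {id, Transposition.transpose 1 2}"
    by (auto simp: permutes_doubleton_iff)
  moreover have "id \<noteq> Transposition.transpose (1::nat) 2"
    by (metis eq_id_iff one_eq_numeral_iff semiring_norm(85) transpose_apply_first)
  ultimately show ?thesis
    by (simp add: alt_def xi_eq_halves rename_xi_half rename_id sign_swap_id)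
qed

lemma poly_vars_rename: "poly_vars (rename f p) \<subseteq> f ` poly_vars (p :: 'a::comm_semiring_1 mpoly)"
proof -
  have single: "poly_vars (rename f (Poly_Mapping.single m a)) \<subseteq> f ` Poly_Mapping.keys m" for m and a :: 'a
  proof -
    have "poly_vars (Var (f i) ^ k :: 'a mpoly) \<subseteq> {f i}" for i k
      using poly_vars_prod_subset[of "{..<k}" "\<lambda>_. Var (f i)" "{f i}"] by simp
    hence "poly_vars (\<Prod>i\<in>Poly_Mapping.keys m. Var (f i) ^ Poly_Mapping.lookup m i :: 'a mpoly) \<subseteq> f ` Poly_Mapping.keys m"
      by (intro poly_vars_prod_subset) blast
    thus ?thesis
      unfolding rename_single using poly_vars_mult[of "Const a" "\<Prod>i\<in>Poly_Mapping.keys m. Var (f i) ^ Poly_Mapping.lookup m i"] by auto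
  qed
  have eq: "rename f p = (\<Sum>m\<in>Poly_Mapping.keys p. rename f (Poly_Mapping.single m (Poly_Mapping.lookup p m)))"
    by (subst mpoly_sum_monomials) (simp add: rename_sum)
  have sub: "poly_vars (sum g I) \<subseteq> (\<Union>i\<in>I. poly_vars (g i))" for g :: "(nat \<Rightarrow>\<^sub>0 nat) \<Rightarrow> 'a mpoly" and I
  proof (induction I rule: infinite_finite_induct)
    case (insert i I)
    thus ?case using poly_vars_add[of "g i" "sum g I"] by auto
  qed auto
  have "poly_vars (rename f p) \<subseteq> (\<Union>m\<in>Poly_Mapping.keys p. f ` Poly_Mapping.keys m)"
    unfolding eq by (rule order_trans[OF sub]) (use single in blast)
  also have "\<dots> = f ` poly_vars p" by (auto simp: poly_vars_def)
  finally show ?thesis .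
qed

text \<open>Iteration of \<open>wedge_alt\<close>: the c-th factor moves to the variables d c + 1,
  ..., d c + d, and the partial antisymmetrisations are absorbed by the last one.\<close>

lemma wedges_alt:
  assumes "\<And>k. k \<in> set K \<Longrightarrow> poly_vars (F k) \<subseteq> {1..d}"
  shows "wedges d (map (\<lambda>k. alt d (F k)) K)
    = alt (d * length K) (\<Prod>c<length K. rename (\<lambda>i. i + d * c) (F (K ! c)))"
  using assms
proof (induction K)
  case Nil
  show ?case by (simp add: alt_def)
next
  case (Cons k K)
  have vars: "poly_vars (\<Prod>c<length K. rename (\<lambda>i. i + d * c) (F (K ! c))) \<subseteq> {1..d * length K}"
  proof (rule poly_vars_prod_subset)
    fix c assume c: "c \<in> {..<length K}"
    have "poly_vars (rename (\<lambda>i. i + d * c) (F (K ! c))) \<subseteq> (\<lambda>i. i + d * c) ` {1..d}"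
      by (rule order_trans[OF poly_vars_rename image_mono[OF Cons.prems]]) (use c in simp)
    moreover have "i + d * c \<in> {1..d * length K}" if "i \<in> {1..d}" for i
    proof -
      have "i + d * c \<le> d * Suc c" using that by simp
      also have "\<dots> \<le> d * length K" using c by (intro mult_le_mono2) auto
      finally show ?thesis using that by auto
    qed
    ultimately show "poly_vars (rename (\<lambda>i. i + d * c) (F (K ! c))) \<subseteq> {1..d * length K}" by blast
  qed
  have "wedges d (map (\<lambda>k. alt d (F k)) (k # K)) = wedge d (d * length K) (alt d (F k))
      (alt (d * length K) (\<Prod>c<length K. rename (\<lambda>i. i + d * c) (F (K ! c))))"
    using Cons by simp
  also have "\<dots> = alt (d + d * length K) (F k * rename (\<lambda>i. i + d) (\<Prod>c<length K. rename (\<lambda>i. i + d * c) (F (K ! c))))"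
    by (rule wedge_alt[OF _ vars]) (use Cons.prems in auto)
  also have "F k * rename (\<lambda>i. i + d) (\<Prod>c<length K. rename (\<lambda>i. i + d * c) (F (K ! c)))
      = (\<Prod>c<length (k # K). rename (\<lambda>i. i + d * c) (F ((k # K) ! c)))"
  proof -
    have "(\<lambda>i::nat. i + d) \<circ> (\<lambda>i. i + d * c) = (\<lambda>i. i + d * Suc c)" for c
      by (auto simp: fun_eq_iff)
    moreover have "rename (\<lambda>i. i + d * 0) (F k) = F k" using rename_id[of "F k"] by (simp add: id_def)
    ultimately show ?thesis
      by (simp add: prod.lessThan_Suc_shift rename_prod rename_rename del: prod.lessThan_Suc)
  qed
  finally show ?case by simp
qed

section \<open>Monomial expansions of the generators and their degree bounds\<close>

lemma vH_eq_sum_single: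
  "vH n r (Var a) = (\<Sum>s=1..n. Poly_Mapping.single (Poly_Mapping.single a (2 * (s - 1))) (Pcoeff n r (int s)))"
  by (simp add: vH_def Var_power Const_mult_single)

lemma wH_eq_sum_single:
  "wH n r (Var a) = (\<Sum>s=1..n. Poly_Mapping.single (Poly_Mapping.single a (Suc (2 * (s - 1)))) (Pcoeff n r (int s)))"
  by (simp add: wH_eq Var_power Const_mult_single del: power_Suc)

lemma xi_half_eq_sum_single:
  "xi_half n k a b = (\<Sum>j\<le>n. \<Sum>i<j. \<Sum>r<j - i.
     Poly_Mapping.single (Poly_Mapping.single a (Suc (2 * (i + r))) + Poly_Mapping.single b (2 * (j - Suc r)))
       (xi_coeff n k j * elem_sym n (2 * int i) - xi_coeff n k i * elem_sym n (2 * int j)))"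
  unfolding xi_half_def bez_def sum_distrib_left
proof (intro sum.cong refl)
  fix i j r
  have "Var a * ((Var a ^ 2) ^ (i + r) * (Var b ^ 2) ^ (j - Suc r)) =
     Poly_Mapping.single (Poly_Mapping.single a (Suc (2 * (i + r))) + Poly_Mapping.single b (2 * (j - Suc r))) (1::xpoly)"
    by (simp only: power_mult[symmetric] mult.assoc[symmetric] power_Suc[symmetric]) (simp add: Var_power mult_single del: power_Suc)
  thus "Var a * ((Const (xi_coeff n k j) * Const (elem_sym n (2 * int i)) - Const (xi_coeff n k i) * Const (elem_sym n (2 * int j))) *
      ((Var a ^ 2) ^ (i + r) * (Var b ^ 2) ^ (j - Suc r))) =
    Poly_Mapping.single (Poly_Mapping.single a (Suc (2 * (i + r))) + Poly_Mapping.single b (2 * (j - Suc r)))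
       (xi_coeff n k j * elem_sym n (2 * int i) - xi_coeff n k i * elem_sym n (2 * int j))"
    by (simp add: mult.left_commute[of "Var a"] Const_mult_single flip: Const.hom_mult Const.hom_minus)
qed

lemma elem_sym_in_sym_polys [simp]: "elem_sym n k \<in> sym_polys (2 * n)"
proof (cases "k < 0")
  case False
  define F where "F = {S. S \<subseteq> {1..2 * n} \<and> card S = nat k}"
  have e: "elem_sym n k = (\<Sum>S\<in>F. \<Prod>i\<in>S. Var i)"
    using False by (simp add: elem_sym_def F_def)
  have "rename \<pi> (elem_sym n k) = elem_sym n k" if \<pi>: "\<pi> permutes {1..2 * n}" for \<pi>
  proof -
    have inj: "inj \<pi>" using \<pi> permutes_inj by blast
    have F: "(`) \<pi> ` F = F"
    proof -
      have sub: "(`) \<rho> ` F \<subseteq> F" if "\<rho> permutes {1..2 * n}" for \<rho>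
      proof (clarify)
        fix S assume S: "S \<in> F"
        hence "\<rho> ` S \<subseteq> {1..2 * n}" using permutes_image[OF that] by (auto simp: F_def)
        moreover have "card (\<rho> ` S) = card S" using that by (intro card_image) (meson inj_on_subset permutes_inj subset_UNIV)
        ultimately show "\<rho> ` S \<in> F" using S by (simp add: F_def)
      qed
      have "S \<in> (`) \<pi> ` F" if "S \<in> F" for S
      proof
        show "inv \<pi> ` S \<in> F" using sub[OF permutes_inv[OF \<pi>]] that by blast
        show "S = \<pi> ` (inv \<pi> ` S)" using \<pi> by (simp add: image_comp permutes_inv_o)
      qed
      thus ?thesis using sub[OF \<pi>] by blast
    qed
    have "rename \<pi> (elem_sym n k) = (\<Sum>S\<in>F. \<Prod>i\<in>\<pi> ` S. Var i)"
      unfolding e rename_sum rename_prod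
      by (intro sum.cong refl) (use inj in \<open>simp add: prod.reindex inj_on_def\<close>)
    also have "\<dots> = (\<Sum>S\<in>(`) \<pi> ` F. \<Prod>i\<in>S. Var i)"
      by (subst sum.reindex) (use inj in \<open>auto simp: inj_on_def inj_image_eq_iff\<close>)
    finally show ?thesis by (simp add: F e)
  qed
  moreover have "poly_vars (elem_sym n k) \<subseteq> {1..2 * n}"
  proof -
    have "poly_vars (sum g I) \<subseteq> A" if "\<And>i. i \<in> I \<Longrightarrow> poly_vars (g i) \<subseteq> A" for g :: "nat set \<Rightarrow> xpoly" and I A
      using that
    proof (induction I rule: infinite_finite_induct)
      case (insert i I)
      thus ?case using poly_vars_add[of "g i" "sum g I"] by auto
    qed auto
    moreover have "poly_vars (\<Prod>i\<in>S. Var i :: xpoly) \<subseteq> {1..2 * n}" if "S \<in> F" for S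
      using that by (intro poly_vars_prod_subset) (auto simp: F_def)
    ultimately show ?thesis by (simp add: e)
  qed
  ultimately show ?thesis by (simp add: sym_polys_def)
qed (simp add: elem_sym_def)

lemma Pcoeff_in_sym_polys [simp]: "Pcoeff n r s \<in> sym_polys (2 * n)"
  by (induction n r s rule: Pcoeff.induct) (auto intro!: sym_polys_diff sym_polys_mult)

lemma vH_poly_frag: "vH n r (Var a) \<in> poly_frag n {a}"
  unfolding vH_eq_sum_single by (intro poly_frag_sum poly_frag_single) (auto simp: lookup_single when_def)

lemma wH_poly_frag: "wH n r (Var a) \<in> poly_frag n {a}"
  unfolding wH_eq_sum_single by (intro poly_frag_sum poly_frag_single) (auto simp: lookup_single when_def)

lemma xi_half_poly_frag:
  assumes "a \<noteq> b"
  shows "xi_half n k a b \<in> poly_frag n {a, b}"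
  unfolding xi_half_eq_sum_single
proof (intro poly_frag_sum poly_frag_single)
  fix j i r :: nat assume *: "j \<in> {..n}" "i \<in> {..<j}" "r \<in> {..<j - i}"
  show "Poly_Mapping.keys (Poly_Mapping.single a (Suc (2 * (i + r))) + Poly_Mapping.single b (2 * (j - Suc r))) \<subseteq> {a, b}"
    using Poly_Mapping.keys_add[of "Poly_Mapping.single a (Suc (2 * (i + r)))" "Poly_Mapping.single b (2 * (j - Suc r))"]
    by (auto split: if_splits)
  fix s
  \<comment> \<open>From i + r < j <= n, the odd exponent is at most 2n - 1 and the even one at most
    2n - 2.\<close>
  show "Poly_Mapping.lookup (Poly_Mapping.single a (Suc (2 * (i + r))) + Poly_Mapping.single b (2 * (j - Suc r))) s < 2 * n"
    using * assms by (auto simp: lookup_add lookup_single when_def)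
qed (auto simp: xi_coeff_def intro!: sym_polys_diff sym_polys_mult)

text \<open>The tensor that \<open>alt\<close> turns into the basis element. Slots are assigned in
  order: one to each v, one to each w, two consecutive ones to each xi.\<close>

definition basis_poly :: "nat \<Rightarrow> nat list \<times> nat list \<times> nat list \<Rightarrow> Xpoly" where
  "basis_poly n = (\<lambda>(I, J, K).
     (\<Prod>a<length I. vH n (I ! a) (Var (Suc a)))
     * ((\<Prod>b<length J. wH n (J ! b) (Var (Suc (length I + b))))
     * (\<Prod>c<length K. xi_half n (K ! c) (Suc (length I + length J + 2 * c)) (Suc (Suc (length I + length J + 2 * c))))))"

lemma alt_1: 
  assumes "poly_vars P \<subseteq> {1}"
  shows "alt 1 P = P"
  by (simp add: alt_def rename_id)

lemma basis_elem_eq_alt: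
  "basis_elem n (I, J, K) = alt (length I + length J + 2 * length K) (basis_poly n (I, J, K))"
proof -
  have v: "wedges 1 (map (\<lambda>i. vH n i (Var 1)) I) = alt (length I) (\<Prod>a<length I. vH n (I ! a) (Var (Suc a)))"
    using wedges_alt[of I "\<lambda>i. vH n i (Var 1)" 1] poly_frag_vars[OF vH_poly_frag[of n _ 1]]
    by (simp add: alt_1[unfolded One_nat_def] rename_vH)
  have w: "wedges 1 (map (\<lambda>i. wH n i (Var 1)) J) = alt (length J) (\<Prod>a<length J. wH n (J ! a) (Var (Suc a)))"
    using wedges_alt[of J "\<lambda>i. wH n i (Var 1)" 1] poly_frag_vars[OF wH_poly_frag[of n _ 1]]
    by (simp add: alt_1[unfolded One_nat_def] rename_wH)
  have "poly_vars (xi_half n k 1 2) \<subseteq> {1..2}" for k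
    using poly_frag_vars[OF xi_half_poly_frag[of 1 2 n k]] by auto
  hence x: "wedges 2 (map (xi n) K) = alt (2 * length K) (\<Prod>c<length K. xi_half n (K ! c) (Suc (2 * c)) (Suc (Suc (2 * c))))"
    using wedges_alt[of K "\<lambda>k. xi_half n k 1 2" 2] unfolding xi_eq_alt[abs_def]
    by (simp add: rename_xi_half)
  have vv: "poly_vars (\<Prod>a<length I. vH n (I ! a) (Var (Suc a))) \<subseteq> {1..length I}"
  proof (rule poly_vars_prod_subset)
    fix a assume "a \<in> {..<length I}"
    thus "poly_vars (vH n (I ! a) (Var (Suc a))) \<subseteq> {1..length I}"
      using poly_frag_vars[OF vH_poly_frag[of n "I ! a" "Suc a"]] by auto
  qed
  have wv: "poly_vars (\<Prod>a<length J. wH n (J ! a) (Var (Suc a))) \<subseteq> {1..length J}"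
  proof (rule poly_vars_prod_subset)
    fix a assume "a \<in> {..<length J}"
    thus "poly_vars (wH n (J ! a) (Var (Suc a))) \<subseteq> {1..length J}"
      using poly_frag_vars[OF wH_poly_frag[of n "J ! a" "Suc a"]] by auto
  qed
  have xv: "poly_vars (\<Prod>c<length K. xi_half n (K ! c) (Suc (2 * c)) (Suc (Suc (2 * c)))) \<subseteq> {1..2 * length K}"
  proof (rule poly_vars_prod_subset)
    fix c assume "c \<in> {..<length K}"
    thus "poly_vars (xi_half n (K ! c) (Suc (2 * c)) (Suc (Suc (2 * c)))) \<subseteq> {1..2 * length K}"
      using poly_frag_vars[OF xi_half_poly_frag[of "Suc (2 * c)" "Suc (Suc (2 * c))" n "K ! c"]] by auto
  qed
  have "wedge (length J) (2 * length K)
         (wedges 1 (map (\<lambda>j. wH n j (Var 1)) J)) (wedges 2 (map (xi n) K))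
     = alt (length J + 2 * length K) ((\<Prod>b<length J. wH n (J ! b) (Var (Suc b)))
     * (\<Prod>c<length K. xi_half n (K ! c) (Suc (length J + 2 * c)) (Suc (Suc (length J + 2 * c)))))"
    unfolding w x wedge_alt[OF wv xv] by (simp add: rename_prod rename_xi_half add_ac)
  moreover have "poly_vars ((\<Prod>b<length J. wH n (J ! b) (Var (Suc b)))
     * (\<Prod>c<length K. xi_half n (K ! c) (Suc (length J + 2 * c)) (Suc (Suc (length J + 2 * c))))) \<subseteq> {1..length J + 2 * length K}"
  proof -
    have "poly_vars (\<Prod>c<length K. xi_half n (K ! c) (Suc (length J + 2 * c)) (Suc (Suc (length J + 2 * c)))) \<subseteq> {1..length J + 2 * length K}"
    proof (rule poly_vars_prod_subset)
      fix c assume "c \<in> {..<length K}"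
      thus "poly_vars (xi_half n (K ! c) (Suc (length J + 2 * c)) (Suc (Suc (length J + 2 * c)))) \<subseteq> {1..length J + 2 * length K}"
        using poly_frag_vars[OF xi_half_poly_frag[of "Suc (length J + 2 * c)" "Suc (Suc (length J + 2 * c))" n "K ! c"]] by auto
    qed
    moreover have "{1..length J} \<subseteq> {1..length J + 2 * length K}" by auto
    ultimately show ?thesis
      by (intro order_trans[OF poly_vars_mult] Un_least order_trans[OF wv])
  qed
  ultimately show ?thesis
    unfolding basis_elem_def prod.case v
    by (simp add: wedge_alt[OF vv] basis_poly_def rename_mult rename_prod rename_xi_half rename_wH add_ac)
qed

lemma basis_poly_poly_frag:
  assumes "n \<ge> 1"
  shows "basis_poly n (I, J, K) \<in> poly_frag n {1..length I + length J + 2 * length K}"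
proof -
  let ?A = "\<Union>a\<in>{..<length I}. {Suc a}" and ?B = "\<Union>b\<in>{..<length J}. {Suc (length I + b)}"
  let ?C = "\<Union>c\<in>{..<length K}. {Suc (length I + length J + 2 * c), Suc (Suc (length I + length J + 2 * c))}"
  have "basis_poly n (I, J, K) \<in> poly_frag n (?A \<union> (?B \<union> ?C))"
    unfolding basis_poly_def prod.case
  proof (intro poly_frag_mult poly_frag_prod assms vH_poly_frag wH_poly_frag xi_half_poly_frag)
    fix c d :: nat assume "c \<noteq> d"
    hence "2 * c \<noteq> 2 * d" "2 * c \<noteq> Suc (2 * d)" "Suc (2 * c) \<noteq> 2 * d" by presburger+
    thus "{Suc (length I + length J + 2 * c), Suc (Suc (length I + length J + 2 * c))} \<inter>
      {Suc (length I + length J + 2 * d), Suc (Suc (length I + length J + 2 * d))} = {}" by auto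
  qed auto
  moreover have "?A \<union> (?B \<union> ?C) \<subseteq> {1..length I + length J + 2 * length K}" by auto
  ultimately show ?thesis unfolding poly_frag_def by blast
qed

section \<open>The basis elements lie in the module\<close>

text \<open>v_0 and v_r involve X only through y = X^2. As polynomials in y they show their common
  zeros, and later the n roots of v_0.\<close>

definition even_part :: "nat \<Rightarrow> (nat \<Rightarrow> complex) \<Rightarrow> complex \<Rightarrow> complex" where
  "even_part n x y = (\<Sum>j\<le>n. peval x (elem_sym n (2 * int j)) * y ^ j)"

definition vval :: "nat \<Rightarrow> (nat \<Rightarrow> complex) \<Rightarrow> nat \<Rightarrow> complex \<Rightarrow> complex" where
  "vval n x r y = (\<Sum>s=1..n. peval x (Pcoeff n r (int s)) * y ^ (s - 1))"

lemma Xeval_vH: "Xeval X x (vH n r (Var a)) = vval n x r (X a ^ 2)"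
  by (simp add: vH_def vval_def Xeval.hom_sum Xeval.hom_mult Xeval.hom_power power_mult)

lemma Xeval_wH: "Xeval X x (wH n r (Var a)) = X a * vval n x r (X a ^ 2)"
  by (simp add: wH_def Xeval_vH Xeval.hom_mult)

lemma Xeval_xi_half:
  "Xeval X x (xi_half n k a b) = X a * bez (\<lambda>j. peval x (xi_coeff n k j))
     (\<lambda>i. peval x (elem_sym n (2 * int i))) n (X a ^ 2) (X b ^ 2)"
  by (simp add: xi_half_def Xeval.hom_mult bez_hom[OF Xeval.comm_ring_hom_axioms] Xeval.hom_power)

lemma sum_xi_coeff: "(\<Sum>j\<le>n. peval x (xi_coeff n k j) * y ^ j) = y * vval n x k y"
proof -
  have "(\<Sum>j\<le>n. peval x (xi_coeff n k j) * y ^ j) = (\<Sum>j=1..n. peval x (xi_coeff n k j) * y ^ j)"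
    by (rule sum.mono_neutral_right) (auto simp: xi_coeff_def)
  also have "\<dots> = (\<Sum>s=1..n. y * (peval x (Pcoeff n k (int s)) * y ^ (s - 1)))"
  proof (intro sum.cong refl)
    fix j assume "j \<in> {1..n}"
    then obtain i where "j = Suc i" by (cases j) auto
    thus "peval x (xi_coeff n k j) * y ^ j = y * (peval x (Pcoeff n k (int j)) * y ^ (j - 1))"
      by (simp add: xi_coeff_def)
  qed
  finally show ?thesis by (simp add: vval_def sum_distrib_left)
qed

section \<open>The generating function and the recursion for v_r\<close>

lemma elem_sym_nat: "elem_sym n (int k) = (\<Sum>S | S \<subseteq> {1..2 * n} \<and> card S = k. \<Prod>i\<in>S. Var i)"
  by (simp add: elem_sym_def)

lemma elem_sym_gt:
  assumes "k > 2 * int n"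
  shows "elem_sym n k = 0"
proof -
  have "{S. S \<subseteq> {1..2 * n} \<and> card S = nat k} = {}"
  proof safe
    fix S assume S: "S \<subseteq> {1..2 * n}" "card S = nat k"
    have "card S \<le> card {1..2 * n}" using S(1) by (intro card_mono) auto
    thus "S \<in> {}" using S assms by simp
  qed
  thus ?thesis by (simp only: elem_sym_def sum.empty if_cancel)
qed

lemma elem_sym_0 [simp]: "elem_sym n 0 = 1"
proof -
  have "{S. S \<subseteq> {1..2 * n} \<and> card S = 0} = {{}}" using finite_subset by fastforce
  thus ?thesis by (simp add: elem_sym_def)
qed

lemma Pcoeff_gt:
  assumes "s > int n"
  shows "Pcoeff n r s = 0"
  using assms by (induction n r s rule: Pcoeff.induct) (auto intro!: elem_sym_gt)

lemma prod_one_plus_eq_elem_sym: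
  "(\<Prod>i=1..2 * n. 1 + x i * z) = (\<Sum>k\<le>2 * n. peval x (elem_sym n (int k)) * z ^ k)"
proof -
  have "(\<Prod>i=1..2 * n. 1 + x i * z) = (\<Sum>S\<in>Pow {1..2 * n}. (\<Prod>i\<in>S. x i) * z ^ card S)"
  proof -
    have "(\<Prod>i=1..2 * n. 1 + x i * z) = (\<Prod>i=1..2 * n. x i * z + 1)" by (simp add: add.commute)
    also have "\<dots> = (\<Sum>S\<in>Pow {1..2 * n}. (\<Prod>i\<in>S. x i) * z ^ card S)"
      by (subst prod_add) (auto simp: prod.distrib)
    finally show ?thesis .
  qed
  also have "\<dots> = (\<Sum>k\<le>2 * n. \<Sum>S\<in>{S \<in> Pow {1..2 * n}. card S = k}. (\<Prod>i\<in>S. x i) * z ^ card S)"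
  proof (rule sum.group[symmetric])
    show "card ` Pow {1..2 * n} \<subseteq> {..2 * n}"
    proof clarify
      fix S assume "S \<subseteq> {1..2 * n}"
      hence "card S \<le> card {1..2 * n}" by (intro card_mono) auto
      thus "card S \<le> 2 * n" by simp
    qed
  qed auto
  also have "\<dots> = (\<Sum>k\<le>2 * n. peval x (elem_sym n (int k)) * z ^ k)"
    by (simp add: elem_sym_nat peval.hom_sum peval.hom_prod sum_distrib_right)
  finally show ?thesis .
qed

lemma sum_even_odd:
  "(\<Sum>k\<le>2 * n. h k) = (\<Sum>j\<le>n. h (2 * j)) + (\<Sum>s=1..n. h (2 * s - 1))"
  for h :: "nat \<Rightarrow> 'a::comm_monoid_add"
  by (induction n) (simp_all add: add_ac)

text \<open>v_0 and w_1 collect the even and the odd powers of z in the generating function of the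
  elementary symmetric polynomials.\<close>

lemma even_part_plus_odd_part:
  "even_part n x (z ^ 2) + z * vval n x 1 (z ^ 2) = (\<Prod>i=1..2 * n. 1 + x i * z)"
proof -
  have "(\<Sum>s=1..n. peval x (elem_sym n (int (2 * s - 1))) * z ^ (2 * s - 1)) = z * vval n x 1 (z ^ 2)"
    unfolding vval_def sum_distrib_left
  proof (intro sum.cong refl)
    fix s assume "s \<in> {1..n}"
    then obtain i where "s = Suc i" by (cases s) auto
    thus "peval x (elem_sym n (int (2 * s - 1))) * z ^ (2 * s - 1)
        = z * (peval x (Pcoeff n 1 (int s)) * (z ^ 2) ^ (s - 1))"
      by (simp add: power_mult[symmetric])
  qed
  thus ?thesis
    unfolding prod_one_plus_eq_elem_sym sum_even_odd
    by (simp add: even_part_def power_mult)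
qed

text \<open>The recursion for P_{r,s} removes the constant term of v_r by a multiple of v_0, whose
  constant term is 1, and divides by y.\<close>

lemma vval_Suc:
  assumes "r \<ge> 1"
  shows "y * vval n x (Suc r) y = vval n x r y - peval x (Pcoeff n r 1) * even_part n x y"
proof (cases n)
  case 0
  have "Pcoeff 0 r 1 = 0" by (rule Pcoeff_gt) simp
  thus ?thesis by (simp add: 0 vval_def)
next
  case (Suc m)
  define p where "p = (\<lambda>s. peval x (Pcoeff n r s))"
  define e where "e = (\<lambda>j. peval x (elem_sym n (2 * int j)))"
  have P: "peval x (Pcoeff n (Suc r) (int s)) = p (int s + 1) - e s * p 1" for s
    using assms by (cases r) (simp_all add: p_def e_def peval.hom_minus peval.hom_mult)
  have "y * vval n x (Suc r) y = (\<Sum>s=1..n. (p (int s + 1) - e s * p 1) * y ^ s)"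
    unfolding vval_def sum_distrib_left P
  proof (intro sum.cong refl)
    fix s assume "s \<in> {1..n}"
    then obtain i where "s = Suc i" by (cases s) auto
    thus "y * ((p (int s + 1) - e s * p 1) * y ^ (s - 1)) = (p (int s + 1) - e s * p 1) * y ^ s" by simp
  qed
  also have "\<dots> = (\<Sum>s=1..n. p (int s + 1) * y ^ s) - p 1 * (\<Sum>s=1..n. e s * y ^ s)"
    by (simp add: algebra_simps sum_subtractf sum_distrib_left)
  also have "(\<Sum>s=1..n. e s * y ^ s) = even_part n x y - 1"
  proof -
    have "even_part n x y = e 0 + (\<Sum>s\<in>{..n} - {0}. e s * y ^ s)"
      unfolding even_part_def e_def by (subst sum.remove[of _ 0]) auto
    moreover have "{..n} - {0} = {1..n}" by auto
    ultimately show ?thesis by (simp add: e_def)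
  qed
  \<comment> \<open>The index shift loses only the constant term p 1; at the upper end p (n + 1) = 0
    by \<open>Pcoeff_gt\<close>.\<close>
  also have "(\<Sum>s=1..n. p (int s + 1) * y ^ s) = vval n x r y - p 1"
  proof -
    have "vval n x r y = (\<Sum>s<n. p (int s + 1) * y ^ s)"
      unfolding vval_def p_def by (rule sum.reindex_bij_witness[of _ "Suc" "\<lambda>s. s - 1"]) (auto simp: add.commute)
    also have "\<dots> = p 1 + (\<Sum>s\<in>{..<n} - {0}. p (int s + 1) * y ^ s)"
      using Suc by (subst sum.remove[of _ 0]) auto
    also have "(\<Sum>s\<in>{..<n} - {0}. p (int s + 1) * y ^ s) = (\<Sum>s=1..n. p (int s + 1) * y ^ s)"
    proof (rule sum.mono_neutral_left)
      show "\<forall>s\<in>{1..n} - ({..<n} - {0}). p (int s + 1) * y ^ s = 0"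
      proof
        fix s assume "s \<in> {1..n} - ({..<n} - {0})"
        hence "s = n" by auto
        thus "p (int s + 1) * y ^ s = 0" by (simp add: p_def Pcoeff_gt)
      qed
    qed auto
    finally show ?thesis by simp
  qed
  finally show ?thesis by (simp add: p_def algebra_simps)
qed

text \<open>Away from y = 0, \<open>vval_Suc\<close> passes a common zero of v_0 and v_r on to
  v_(r+1).\<close>

lemma vval_eq_0:
  assumes "even_part n x y = 0" "vval n x 1 y = 0" "y \<noteq> 0" "r \<ge> 1"
  shows "vval n x r y = 0"
  using assms(4)
proof (induction r rule: dec_induct)
  case (step r)
  thus ?case using vval_Suc[of r y n x] assms by simp
qed (use assms in simp)

text \<open>Slot s belongs to one factor of the product. That factor vanishes once the square of the
  value in the slot is a common zero of v_0 and all v_r; for xi this is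
  \<open>bez_eq_0\<close>.\<close>

lemma Xeval_basis_poly_eq_0:
  assumes "even_part n x (Z s ^ 2) = 0" "vval n x 1 (Z s ^ 2) = 0" "Z s \<noteq> 0"
    and "s \<in> {1..length I + length J + 2 * length K}"
    and "\<forall>i\<in>set I. 1 \<le> i" "\<forall>j\<in>set J. 1 \<le> j" "\<forall>k\<in>set K. 1 \<le> k"
  shows "Xeval Z x (basis_poly n (I, J, K)) = 0"
proof -
  have v: "vval n x r (Z s ^ 2) = 0" if "r \<ge> 1" for r
    by (rule vval_eq_0) (use assms that in auto)
  let ?I = "length I" and ?J = "length J"
  consider a where "a < ?I" "s = Suc a" | b where "b < ?J" "s = Suc (?I + b)"
    | c where "c < length K" "s = Suc (?I + ?J + 2 * c) \<or> s = Suc (Suc (?I + ?J + 2 * c))"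
  proof -
    assume A: "\<And>a. a < ?I \<Longrightarrow> s = Suc a \<Longrightarrow> thesis"
      and B: "\<And>b. b < ?J \<Longrightarrow> s = Suc (?I + b) \<Longrightarrow> thesis"
      and C: "\<And>c. c < length K \<Longrightarrow> s = Suc (?I + ?J + 2 * c) \<or> s = Suc (Suc (?I + ?J + 2 * c)) \<Longrightarrow> thesis"
    show thesis
    proof (cases "s \<le> ?I")
      case True
      thus ?thesis using assms(4) by (intro A[of "s - 1"]) auto
    next
      case False
      show ?thesis
      proof (cases "s \<le> ?I + ?J")
        case True
        thus ?thesis using False by (intro B[of "s - ?I - 1"]) auto
      next
        case False
        define t where "t = s - Suc (?I + ?J)"
        have "s = Suc (?I + ?J + t)" "t < 2 * length K" using False assms(4) by (auto simp: t_def)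
        moreover define c where "c = t div 2"
        have "t = 2 * c \<or> t = Suc (2 * c)" unfolding c_def by presburger
        ultimately have "c < length K" "s = Suc (?I + ?J + 2 * c) \<or> s = Suc (Suc (?I + ?J + 2 * c))" by auto
        thus ?thesis by (rule C)
      qed
    qed
  qed
  thus ?thesis
  proof cases
    case 1
    have "Xeval Z x (vH n (I ! a) (Var (Suc a))) = 0"
      using 1 assms(5) v[of "I ! a"] by (simp add: Xeval_vH)
    hence "(\<Prod>a<?I. Xeval Z x (vH n (I ! a) (Var (Suc a)))) = 0" using 1 by (intro prod_zero bexI[of _ a]) auto
    thus ?thesis by (simp add: basis_poly_def Xeval.hom_mult Xeval.hom_prod)
  next
    case 2
    have "Xeval Z x (wH n (J ! b) (Var (Suc (?I + b)))) = 0"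
      using 2 assms(6) v[of "J ! b"] by (simp add: Xeval_wH)
    hence "(\<Prod>b<?J. Xeval Z x (wH n (J ! b) (Var (Suc (?I + b))))) = 0" using 2 by (intro prod_zero bexI[of _ b]) auto
    thus ?thesis by (simp add: basis_poly_def Xeval.hom_mult Xeval.hom_prod)
  next
    case 3
    have "bez (\<lambda>j. peval x (xi_coeff n (K ! c) j)) (\<lambda>i. peval x (elem_sym n (2 * int i))) n (Z s ^ 2) w = 0" for w
      using 3 assms by (intro bez_eq_0) (simp_all add: sum_xi_coeff v flip: even_part_def)
    moreover from this have "bez (\<lambda>j. peval x (xi_coeff n (K ! c) j)) (\<lambda>i. peval x (elem_sym n (2 * int i))) n w (Z s ^ 2) = 0" for w
      by (subst bez_sym)
    ultimately have "Xeval Z x (xi_half n (K ! c) (Suc (?I + ?J + 2 * c)) (Suc (Suc (?I + ?J + 2 * c)))) = 0"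
      using 3(2) by (auto simp: Xeval_xi_half)
    hence "(\<Prod>c<length K. Xeval Z x (xi_half n (K ! c) (Suc (?I + ?J + 2 * c)) (Suc (Suc (?I + ?J + 2 * c))))) = 0"
      using 3 by (intro prod_zero bexI[of _ c]) auto
    thus ?thesis by (simp add: basis_poly_def Xeval.hom_mult Xeval.hom_prod)
  qed
qed

text \<open>The factors 1 + t z and 1 - t z make the generating function vanish at both 1/t and
  -1/t, so its even and odd parts vanish separately.\<close>

lemma even_odd_parts_vanish:
  fixes x :: "nat \<Rightarrow> complex"
  assumes "n \<ge> 1" "t \<noteq> 0" and z: "z = inverse t \<or> z = - inverse t"
  defines "x' \<equiv> x(2 * n - 1 := t, 2 * n := - t)"
  shows "even_part n x' (z ^ 2) = 0" "vval n x' 1 (z ^ 2) = 0"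
proof -
  have ne: "2 * n - 1 \<noteq> 2 * n" using assms by simp
  have pr: "(\<Prod>i=1..2 * n. 1 + x' i * w) = 0" if "w = inverse t \<or> w = - inverse t" for w
  proof -
    have "\<exists>i\<in>{1..2 * n}. 1 + x' i * w = 0"
    proof (cases "w = inverse t")
      case True
      thus ?thesis using assms by (intro bexI[of _ "2 * n"]) auto
    next
      case False
      thus ?thesis using assms that ne by (intro bexI[of _ "2 * n - 1"]) auto
    qed
    thus ?thesis by simp
  qed
  define E where "E = even_part n x' (z ^ 2)"
  define V where "V = z * vval n x' 1 (z ^ 2)"
  have "E + V = 0"
    unfolding E_def V_def even_part_plus_odd_part using z by (rule pr)
  moreover have "even_part n x' ((- z) ^ 2) + (- z) * vval n x' 1 ((- z) ^ 2) = 0"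
    unfolding even_part_plus_odd_part using z by (intro pr) auto
  hence "E - V = 0" by (simp add: E_def V_def)
  moreover have "2 * E = (E + V) + (E - V)" "2 * V = (E + V) - (E - V)" by simp_all
  ultimately have "2 * E = 0" "2 * V = 0" by (simp_all only: add_0 diff_self)
  thus "even_part n x' (z ^ 2) = 0" "vval n x' 1 (z ^ 2) = 0"
    using z assms(2) by (auto simp: E_def V_def)
qed

lemma basis_elem_in_U_module:
  assumes "n \<ge> 1" "l \<ge> 1" "t \<in> index_triples n l"
  shows "basis_elem n t \<in> U_module n l"
proof -
  obtain I J K where t: "t = (I, J, K)" by (cases t)
  have l: "length I + length J + 2 * length K = l"
    and pos: "\<forall>i\<in>set I. 1 \<le> i" "\<forall>j\<in>set J. 1 \<le> j" "\<forall>k\<in>set K. 1 \<le> k"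
    using assms(3) by (auto simp: t index_triples_def)
  have e: "basis_elem n t = alt l (basis_poly n (I, J, K))"
    by (simp add: t basis_elem_eq_alt l)
  have "basis_elem n t \<in> ext_power n l"
    unfolding e using basis_poly_poly_frag[OF assms(1), of I J K] l by (intro alt_in_ext_power) simp
  moreover have "Xeval (X(l := z)) (x(2 * n - 1 := \<tau>, 2 * n := - \<tau>)) (basis_elem n t) = 0"
    if "\<tau> \<noteq> 0" and z: "z = inverse \<tau> \<or> z = - inverse \<tau>" for X x \<tau> z
    unfolding e Xeval_alt
  proof (rule sum.neutral, rule ballI)
    fix \<sigma> assume "\<sigma> \<in> {\<sigma>. \<sigma> permutes {1..l}}"
    hence \<sigma>: "\<sigma> permutes {1..l}" by simp
    \<comment> \<open>In the summand of \<open>\<sigma>\<close> this is the slot that receives the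
      value z.\<close>
    let ?s = "inv \<sigma> l" and ?x = "x(2 * n - 1 := \<tau>, 2 * n := - \<tau>)"
    have s: "(X(l := z) \<circ> \<sigma>) ?s = z" using permutes_inverses(1)[OF \<sigma>, of l] by simp
    have "Xeval (X(l := z) \<circ> \<sigma>) ?x (basis_poly n (I, J, K)) = 0"
    proof (rule Xeval_basis_poly_eq_0[where s = ?s])
      show "?s \<in> {1..length I + length J + 2 * length K}"
        using permutes_in_image[OF permutes_inv[OF \<sigma>], of l] assms(2) l by simp
    qed (use even_odd_parts_vanish[OF assms(1) that, of x] s that pos in auto)
    thus "of_int (sign \<sigma>) * Xeval (X(l := z) \<circ> \<sigma>) ?x (basis_poly n (I, J, K)) = 0" by simp
  qed
  ultimately show ?thesis by (simp add: U_module_def)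
qed

section \<open>Coordinates of antisymmetric polynomials\<close>

definition tmon :: "nat \<Rightarrow> (nat \<Rightarrow> nat) \<Rightarrow> nat \<Rightarrow>\<^sub>0 nat" where
  "tmon l f = (\<Sum>i\<in>{1..l}. Poly_Mapping.single i (f i))"

lemma lookup_tmon: "Poly_Mapping.lookup (tmon l f) i = (if i \<in> {1..l} then f i else 0)"
  by (simp add: tmon_def lookup_sum lookup_single when_def)

lemma tmon_cong: "(\<And>i. i \<in> {1..l} \<Longrightarrow> f i = g i) \<Longrightarrow> tmon l f = tmon l g"
  by (rule poly_mapping_eqI) (simp add: lookup_tmon)

lemma tmon_lookup: "Poly_Mapping.keys m \<subseteq> {1..l} \<Longrightarrow> tmon l (Poly_Mapping.lookup m) = m"
  by (rule poly_mapping_eqI) (auto simp: lookup_tmon in_keys_iff)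

lemma map_key_tmon:
  assumes "\<pi> permutes {1..l}"
  shows "Poly_Mapping.map_key \<pi> (tmon l f) = tmon l (f \<circ> \<pi>)"
  by (rule poly_mapping_eqI)
     (use assms permutes_in_image[OF assms] in \<open>simp add: map_key.rep_eq permutes_inj lookup_tmon\<close>)

lemma lookup_of_int_mult [simp]:
  "Poly_Mapping.lookup (of_int k * P) m = of_int k * Poly_Mapping.lookup P (m :: nat \<Rightarrow>\<^sub>0 nat)"
  for P :: "'a::comm_ring_1 mpoly"
  using lookup_Const_mult[of "of_int k" P m] by (simp only: Const.hom_of_int)

lemma lookup_tmon_permute:
  assumes "P \<in> ext_power n l" "\<pi> permutes {1..l}"
  shows "Poly_Mapping.lookup P (tmon l (f \<circ> \<pi>)) = of_int (sign \<pi>) * Poly_Mapping.lookup P (tmon l f)"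
proof -
  have "rename \<pi> P = of_int (sign \<pi>) * P" using assms by (simp add: ext_power_def)
  hence "Poly_Mapping.lookup (rename \<pi> P) (tmon l f) = Poly_Mapping.lookup (of_int (sign \<pi>) * P) (tmon l f)"
    by simp
  thus ?thesis
    by (simp add: lookup_rename[OF permutes_bij[OF assms(2)]] map_key_tmon[OF assms(2)])
qed

definition subset_enum :: "nat set \<Rightarrow> nat \<Rightarrow> nat" where
  "subset_enum S i = sorted_list_of_set S ! (i - 1)"

lemma bij_betw_subset_enum:
  assumes "finite S" "card S = l"
  shows "bij_betw (subset_enum S) {1..l} S"
proof -
  have "bij_betw ((!) (sorted_list_of_set S)) {..<l} S"
    using assms bij_betw_nth[of "sorted_list_of_set S" "{..<l}" S] by simp
  moreover have "bij_betw (\<lambda>i. i - 1) {1..l} {..<l}"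
    by (rule bij_betwI[of _ _ _ Suc]) auto
  ultimately have "bij_betw ((!) (sorted_list_of_set S) \<circ> (\<lambda>i. i - 1)) {1..l} S"
    by (rule bij_betw_trans[rotated])
  thus ?thesis unfolding subset_enum_def[abs_def] o_def .
qed

text \<open>The coefficient of the monomial with increasing exponents, that is, the coordinate of P
  at the exterior product of the X^s for s in S.\<close>

definition coord :: "nat \<Rightarrow> Xpoly \<Rightarrow> nat set \<Rightarrow> xpoly" where
  "coord l P S = Poly_Mapping.lookup P (tmon l (subset_enum S))"

text \<open>The sign is that of the permutation sorting f. It is quantified before P and n, because
  it becomes a coefficient of a linear relation that holds for all P.\<close>

lemma ex_tuple_sign:
  assumes "inj_on f {1..l}"
  shows "\<exists>\<epsilon>::int. (\<epsilon> = 1 \<or> \<epsilon> = - 1) \<and> (\<forall>n. \<forall>P\<in>ext_power n l.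
    Poly_Mapping.lookup P (tmon l f) = of_int \<epsilon> * coord l P (f ` {1..l}))"
proof -
  let ?S = "f ` {1..l}"
  define e where "e = subset_enum ?S"
  have e: "bij_betw e {1..l} ?S"
    unfolding e_def by (rule bij_betw_subset_enum) (use assms in \<open>auto simp: card_image\<close>)
  define \<pi> where "\<pi> = (\<lambda>i. if i \<in> {1..l} then inv_into {1..l} e (f i) else i)"
  have "bij_betw (inv_into {1..l} e \<circ> f) {1..l} {1..l}"
    by (rule bij_betw_trans[OF inj_on_imp_bij_betw[OF assms] bij_betw_inv_into[OF e]])
  hence "bij_betw \<pi> {1..l} {1..l}"
    by (rule bij_betw_cong[THEN iffD1, rotated]) (simp add: \<pi>_def)
  hence \<pi>: "\<pi> permutes {1..l}"
    by (rule bij_imp_permutes) (auto simp: \<pi>_def)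
  have "tmon l f = tmon l (e \<circ> \<pi>)"
  proof (rule tmon_cong)
    fix i assume i: "i \<in> {1..l}"
    hence "f i \<in> e ` {1..l}" using e by (auto simp: bij_betw_def)
    thus "f i = (e \<circ> \<pi>) i" using i by (simp add: \<pi>_def f_inv_into_f)
  qed
  hence "\<forall>n. \<forall>P\<in>ext_power n l. Poly_Mapping.lookup P (tmon l f) = of_int (sign \<pi>) * coord l P ?S"
    by (simp add: lookup_tmon_permute[OF _ \<pi>] coord_def e_def)
  moreover have "sign \<pi> = 1 \<or> sign \<pi> = - 1" by (cases \<pi> rule: sign_cases) auto
  ultimately show ?thesis by blast
qed

definition tuple_sign :: "nat \<Rightarrow> (nat \<Rightarrow> nat) \<Rightarrow> int" where
  "tuple_sign l f = (SOME \<epsilon>. (\<epsilon> = 1 \<or> \<epsilon> = - 1) \<and> (\<forall>n. \<forall>P\<in>ext_power n l.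
    Poly_Mapping.lookup P (tmon l f) = of_int \<epsilon> * coord l P (f ` {1..l})))"

lemma tuple_sign:
  assumes "inj_on f {1..l}"
  shows "tuple_sign l f = 1 \<or> tuple_sign l f = - 1"
    and "P \<in> ext_power n l \<Longrightarrow> Poly_Mapping.lookup P (tmon l f) = of_int (tuple_sign l f) * coord l P (f ` {1..l})"
  using someI_ex[OF ex_tuple_sign[OF assms], folded tuple_sign_def] by blast+

text \<open>Transposing two slots with equal exponents fixes the monomial and changes the sign of
  its coefficient.\<close>

lemma lookup_tmon_not_inj:
  assumes "P \<in> ext_power n l" "\<not> inj_on f {1..l}"
  shows "Poly_Mapping.lookup P (tmon l f) = 0"
proof -
  obtain a b where ab: "a \<in> {1..l}" "b \<in> {1..l}" "a \<noteq> b" "f a = f b"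
    using assms(2) by (auto simp: inj_on_def)
  define p where "p = Poly_Mapping.lookup P (tmon l f)"
  have "f \<circ> Transposition.transpose a b = f"
    using ab by (auto simp: fun_eq_iff Transposition.transpose_def)
  moreover have "Transposition.transpose a b permutes {1..l}" using ab by (intro permutes_swap_id)
  ultimately have p: "p = - p"
    using lookup_tmon_permute[OF assms(1), of "Transposition.transpose a b" f] ab
    by (simp add: sign_swap_id p_def)
  have "Poly_Mapping.lookup p m = 0" for m
    using arg_cong[OF p, of "\<lambda>p. Poly_Mapping.lookup p m"] by simp
  thus ?thesis by (simp add: p_def[symmetric] poly_mapping_eqI)
qed

definition subsets :: "nat \<Rightarrow> nat \<Rightarrow> nat set set" where
  "subsets N l = {S. S \<subseteq> {..<N} \<and> card S = l}"

lemma finite_subsets [simp]: "finite (subsets N l)"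
  by (rule finite_subset[of _ "Pow {..<N}"]) (auto simp: subsets_def)

lemma card_subsets: "card (subsets N l) = N choose l"
  using n_subsets[of "{..<N}" l] by (simp add: subsets_def)

lemma ext_power_eqI:
  assumes P: "P \<in> ext_power n l" and Q: "Q \<in> ext_power n l"
    and eq: "\<And>S. S \<in> subsets (2 * n) l \<Longrightarrow> coord l P S = coord l Q S"
  shows "P = Q"
proof (rule poly_mapping_eqI)
  fix m
  show "Poly_Mapping.lookup P m = Poly_Mapping.lookup Q m"
  proof (cases "Poly_Mapping.keys m \<subseteq> {1..l} \<and> (\<forall>i. Poly_Mapping.lookup m i < 2 * n)")
    case False
    hence "m \<notin> Poly_Mapping.keys P" "m \<notin> Poly_Mapping.keys Q"
      using P Q by (auto simp: ext_power_altdef poly_frag_def)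
    thus ?thesis by (simp add: in_keys_iff)
  next
    case True
    define f where "f = Poly_Mapping.lookup m"
    have m: "m = tmon l f" using True by (simp add: f_def tmon_lookup)
    show ?thesis
    proof (cases "inj_on f {1..l}")
      case True
      hence "f ` {1..l} \<in> subsets (2 * n) l"
        using \<open>_ \<and> _\<close> by (auto simp: subsets_def card_image f_def)
      thus ?thesis using tuple_sign(2)[OF True P] tuple_sign(2)[OF True Q] eq by (simp add: m)
    next
      case False
      thus ?thesis using lookup_tmon_not_inj[OF P] lookup_tmon_not_inj[OF Q] by (simp add: m)
    qed
  qed
qed

lemma coord_in_sym_polys: "P \<in> ext_power n l \<Longrightarrow> coord l P S \<in> sym_polys (2 * n)"
  unfolding coord_def ext_power_altdef by (blast intro: poly_frag_lookup)

section \<open>Divisibility of determinants of elements of the module\<close>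

text \<open>As a polynomial in X_1, ..., X_(l-1) the specialised P is zero, so the coefficient of
  each monomial in these variables vanishes; the sum is this coefficient for the exponents
  g.\<close>

lemma last_slot_extraction:
  assumes "P \<in> poly_frag n {1..l}" "l \<ge> 1" and zero: "\<And>X. Xeval (X(l := z)) x P = 0"
  shows "(\<Sum>i<2 * n. peval x (Poly_Mapping.lookup P (tmon l (g(l := i)))) * z ^ i) = 0"
proof -
  define c where "c = (\<lambda>m. peval x (Poly_Mapping.lookup P m))"
  define K where "K = Poly_Mapping.keys P"
  \<comment> \<open>Exponents in the first l - 1 slots; a fibre of \<open>res\<close> collects the
    monomials that differ in slot l only.\<close>
  define res where "res = (\<lambda>m::nat \<Rightarrow>\<^sub>0 nat. tmon (l - 1) (Poly_Mapping.lookup m))"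
  define d where "d = (\<lambda>\<mu>. \<Sum>m\<in>{m \<in> K. res m = \<mu>}. c m * z ^ Poly_Mapping.lookup m l)"
  have K: "finite K" "\<And>m. m \<in> K \<Longrightarrow> Poly_Mapping.keys m \<subseteq> {1..l}"
    "\<And>m i. m \<in> K \<Longrightarrow> Poly_Mapping.lookup m i < 2 * n"
    using assms(1) by (auto simp: K_def poly_frag_def)
  have l: "{1..l} = insert l {1..<l}" using assms(2) by auto
  have "(\<Sum>\<mu>\<in>res ` K. d \<mu> * (\<Prod>i\<in>{1..<l}. X i ^ Poly_Mapping.lookup \<mu> i)) = 0" for X
  proof -
    have "0 = Xeval (X(l := z)) x P" using zero by simp
    also have "\<dots> = (\<Sum>m\<in>K. c m * (\<Prod>i\<in>{1..l}. (X(l := z)) i ^ Poly_Mapping.lookup m i))"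
      unfolding Xeval_altdef poly_subst_def c_def K_def[symmetric]
      by (intro sum.cong refl arg_cong2[where f = "(*)"] monomial_eval_superset) (use K in auto)
    also have "\<dots> = (\<Sum>m\<in>K. c m * z ^ Poly_Mapping.lookup m l * (\<Prod>i\<in>{1..<l}. X i ^ Poly_Mapping.lookup (res m) i))"
    proof (intro sum.cong refl)
      fix m
      have "(\<Prod>i\<in>{1..<l}. (X(l := z)) i ^ Poly_Mapping.lookup m i) = (\<Prod>i\<in>{1..<l}. X i ^ Poly_Mapping.lookup (res m) i)"
        by (intro prod.cong) (auto simp: res_def lookup_tmon)
      thus "c m * (\<Prod>i\<in>{1..l}. (X(l := z)) i ^ Poly_Mapping.lookup m i)
          = c m * z ^ Poly_Mapping.lookup m l * (\<Prod>i\<in>{1..<l}. X i ^ Poly_Mapping.lookup (res m) i)"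
        unfolding l by simp
    qed
    also have "\<dots> = (\<Sum>\<mu>\<in>res ` K. \<Sum>m\<in>{m \<in> K. res m = \<mu>}. c m * z ^ Poly_Mapping.lookup m l * (\<Prod>i\<in>{1..<l}. X i ^ Poly_Mapping.lookup (res m) i))"
      by (rule sum.image_gen[OF K(1)])
    also have "\<dots> = (\<Sum>\<mu>\<in>res ` K. d \<mu> * (\<Prod>i\<in>{1..<l}. X i ^ Poly_Mapping.lookup \<mu> i))"
      by (simp add: d_def sum_distrib_right)
    finally show ?thesis ..
  qed
  moreover have "s = t" if "s \<in> res ` K" "t \<in> res ` K" and st: "\<And>i. i \<in> {1..<l} \<Longrightarrow> Poly_Mapping.lookup s i = Poly_Mapping.lookup t i" for s t
  proof (rule poly_mapping_eqI)
    fix i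
    show "Poly_Mapping.lookup s i = Poly_Mapping.lookup t i"
    proof (cases "i \<in> {1..<l}")
      case False
      hence "i \<notin> {1..l - 1}" by auto
      thus ?thesis using that(1,2) by (auto simp: res_def lookup_tmon)
    qed (rule st)
  qed
  ultimately have d0: "d \<mu> = 0" if "\<mu> \<in> res ` K" for \<mu>
    using that K(1) by (intro monomials_independent[where A = "{1..<l}" and F = "res ` K" and e = Poly_Mapping.lookup and c = d]) auto
  define \<mu> where "\<mu> = tmon (l - 1) g"
  define h where "h = (\<lambda>i. tmon l (g(l := i)))"
  have hl: "Poly_Mapping.lookup (h i) l = i" for i using assms(2) by (simp add: h_def lookup_tmon)
  have "d \<mu> = 0"
  proof (cases "\<mu> \<in> res ` K")
    case False
    hence "{m \<in> K. res m = \<mu>} = {}" by auto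
    thus ?thesis by (simp only: d_def sum.empty)
  qed (rule d0)
  moreover have "d \<mu> = (\<Sum>m\<in>h ` {..<2 * n}. c m * z ^ Poly_Mapping.lookup m l)"
    unfolding d_def
  proof (rule sum.mono_neutral_left)
    show "{m \<in> K. res m = \<mu>} \<subseteq> h ` {..<2 * n}"
    proof clarify
      fix m assume m: "m \<in> K" "\<mu> = res m"
      have "m = h (Poly_Mapping.lookup m l)"
      proof (rule poly_mapping_eqI)
        fix i
        consider "i = l" | "i \<in> {1..l - 1}" | "i \<notin> {1..l}" using assms(2) by force
        thus "Poly_Mapping.lookup m i = Poly_Mapping.lookup (h (Poly_Mapping.lookup m l)) i"
        proof cases
          case 2
          have "Poly_Mapping.lookup \<mu> i = Poly_Mapping.lookup (res m) i" using m by simp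
          thus ?thesis using 2 by (auto simp: h_def \<mu>_def res_def lookup_tmon split: if_splits)
        next
          case 3
          thus ?thesis using K(2)[OF m(1)] by (auto simp: h_def lookup_tmon in_keys_iff)
        qed (simp add: hl)
      qed
      thus "m \<in> h ` {..<2 * n}" using K(3)[OF m(1)] by blast
    qed
    show "\<forall>m\<in>h ` {..<2 * n} - {m \<in> K. res m = \<mu>}. c m * z ^ Poly_Mapping.lookup m l = 0"
    proof
      fix m assume m: "m \<in> h ` {..<2 * n} - {m \<in> K. res m = \<mu>}"
      then obtain i where i: "m = h i" by blast
      have "res m = \<mu>"
        unfolding res_def \<mu>_def i by (rule tmon_cong) (auto simp: h_def lookup_tmon)
      hence "m \<notin> K" using m by blast
      thus "c m * z ^ Poly_Mapping.lookup m l = 0" by (simp add: c_def K_def in_keys_iff)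
    qed
  qed simp
  moreover have "inj_on h {..<2 * n}"
    by (rule inj_onI) (metis hl)
  ultimately have "(\<Sum>i<2 * n. c (h i) * z ^ i) = 0" by (simp add: sum.reindex hl)
  thus ?thesis by (simp add: c_def h_def)
qed

text \<open>2n - 2 and 2n - 1 are the largest exponents of their parity. This keeps the powers in
  \<open>contraction\<close> nonnegative and makes its relations triangular.\<close>

definition top_elem :: "nat \<Rightarrow> nat set \<Rightarrow> nat" where
  "top_elem n S = (if 2 * n - 2 \<in> S then 2 * n - 2 else 2 * n - 1)"

text \<open>With x = x_(2n-1), slot l is contracted with the evaluation at 1/x, restricted to the
  exponents of one parity; a power of x clears the denominators. The other slots carry S without its
  top element.\<close>

definition contraction :: "nat \<Rightarrow> nat \<Rightarrow> nat set \<Rightarrow> Xpoly \<Rightarrow> xpoly" where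
  "contraction n l S P = (\<Sum>i | i < 2 * n \<and> (even i \<longleftrightarrow> even (top_elem n S)).
     Var (2 * n - 1) ^ (top_elem n S - i)
     * Poly_Mapping.lookup P (tmon l ((subset_enum (S - {top_elem n S}))(l := i))))"

lemma parity_le_top_elem:
  assumes "i < 2 * n" "even i \<longleftrightarrow> even (top_elem n S)"
  shows "i \<le> top_elem n S"
  using assms unfolding top_elem_def by (auto split: if_splits)

lemma sum_vars_dvd_contraction:
  assumes "n \<ge> 1" "l \<ge> 1" "P \<in> U_module n l"
  shows "Var (2 * n - 1) + Var (2 * n) dvd contraction n l S P"
proof -
  let ?\<pi> = "Var (2 * n - 1) + Var (2 * n) :: xpoly"
  have ne: "2 * n - 1 \<noteq> 2 * n" using assms by simp
  define \<tau> where "\<tau> = top_elem n S"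
  define C where "C = {i. i < 2 * n \<and> (even i \<longleftrightarrow> even \<tau>)}"
  define C' where "C' = {i. i < 2 * n \<and> \<not> (even i \<longleftrightarrow> even \<tau>)}"
  have fin: "finite C" "finite C'" and CC: "{..<2 * n} = C \<union> C'" "C \<inter> C' = {}" by (auto simp: C_def C'_def)
  have P: "P \<in> poly_frag n {1..l}" using assms(3) by (simp add: U_module_def ext_power_altdef)
  \<comment> \<open>The extra factor x_(2n-1) disposes of the points with t = 0, where 1/t is
    meaningless; primality of the linear form removes it at the end.\<close>
  have "?\<pi> dvd Var (2 * n - 1) * contraction n l S P"
    unfolding sum_vars_dvd_peval_iff[OF ne]
  proof
    fix x :: "nat \<Rightarrow> complex"
    define t where "t = x (2 * n - 1)"
    define y where "y = x(2 * n := - t)"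
    show "peval (x(2 * n := - x (2 * n - 1))) (Var (2 * n - 1) * contraction n l S P) = 0"
    proof (cases "t = 0")
      case True
      thus ?thesis using ne by (simp add: peval.hom_mult t_def)
    next
      case False
      define a where "a = (\<lambda>i. peval y (Poly_Mapping.lookup P (tmon l ((subset_enum (S - {\<tau>}))(l := i)))))"
      have y: "y(2 * n - 1 := t, 2 * n := - t) = y" using ne by (auto simp: y_def t_def fun_eq_iff)
      have z: "(\<Sum>i<2 * n. a i * z ^ i) = 0" if z: "z = inverse t \<or> z = - inverse t" for z
        unfolding a_def
      proof (rule last_slot_extraction[OF P assms(2)])
        fix X
        have "Xeval (X(l := inverse t)) (y(2 * n - 1 := t, 2 * n := - t)) P = 0"
          "Xeval (X(l := - inverse t)) (y(2 * n - 1 := t, 2 * n := - t)) P = 0"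
          using assms(3) False unfolding U_module_def by blast+
        thus "Xeval (X(l := z)) y P = 0" using z unfolding y by blast
      qed
      define u where "u = inverse t"
      define E where "E = (\<Sum>i\<in>C. a i * u ^ i)"
      define D where "D = (\<Sum>i\<in>C'. a i * u ^ i)"
      have "E + D = 0"
        using z[of u] fin CC by (simp add: u_def E_def D_def sum.union_disjoint)
      moreover have "(\<Sum>i\<in>C. a i * (- u) ^ i) + (\<Sum>i\<in>C'. a i * (- u) ^ i) = 0"
        using z[of "- u"] fin CC by (simp add: u_def sum.union_disjoint)
      \<comment> \<open>Passing from 1/t to -1/t changes the sign of exactly one of the two parity
        parts E and D, so both vanish.\<close>
      moreover have "(\<Sum>i\<in>C. a i * (- u) ^ i) = (if even \<tau> then E else - E)"
        by (auto simp: E_def C_def sum_negf[symmetric] intro!: sum.cong)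
      moreover have "(\<Sum>i\<in>C'. a i * (- u) ^ i) = (if even \<tau> then - D else D)"
        by (auto simp: D_def C'_def sum_negf[symmetric] intro!: sum.cong)
      ultimately have "E + D = 0" "E - D = 0" by (auto split: if_splits simp: algebra_simps)
      moreover have "2 * E = (E + D) + (E - D)" by simp
      ultimately have E: "E = 0" by simp
      have "peval y (contraction n l S P) = (\<Sum>i\<in>C. t ^ (\<tau> - i) * a i)"
        using ne by (simp add: contraction_def peval.hom_sum peval.hom_mult peval.hom_power a_def \<tau>_def C_def y_def t_def)
      also have "\<dots> = t ^ \<tau> * E"
        unfolding E_def sum_distrib_left
      proof (intro sum.cong refl)
        fix i assume "i \<in> C"
        hence "i \<le> \<tau>" using parity_le_top_elem by (simp add: C_def \<tau>_def)
        hence "t ^ \<tau> = t ^ (\<tau> - i) * t ^ i" by (simp flip: power_add)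
        thus "t ^ (\<tau> - i) * a i = t ^ \<tau> * (a i * u ^ i)" using False by (simp add: u_def field_simps)
      qed
      finally show ?thesis using E by (simp add: peval.hom_mult y_def t_def)
    qed
  qed
  moreover have "\<not> ?\<pi> dvd Var (2 * n - 1)"
  proof -
    have "peval ((\<lambda>_. 1)(2 * n := - 1)) (Var (2 * n - 1) :: xpoly) \<noteq> 0" using ne by simp
    thus ?thesis unfolding sum_vars_dvd_peval_iff[OF ne] by metis
  qed
  ultimately show ?thesis
    using prime_sum_vars[OF ne] unfolding prime_elem_def by blast
qed

text \<open>Matrix of a change of coordinates. Column S' is a unit vector if S' avoids 2n - 2 and 2n
  - 1; otherwise it expresses the contraction for S' in the coordinates.\<close>

definition contraction_coeff :: "nat \<Rightarrow> nat \<Rightarrow> nat set \<Rightarrow> nat set \<Rightarrow> xpoly" where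
  "contraction_coeff n l S S' = (if S' \<inter> {2 * n - 2, 2 * n - 1} = {} then of_bool (S = S')
     else \<Sum>i | i < 2 * n \<and> (even i \<longleftrightarrow> even (top_elem n S')) \<and> i \<notin> S' - {top_elem n S'} \<and> insert i (S' - {top_elem n S'}) = S.
       of_int (tuple_sign l ((subset_enum (S' - {top_elem n S'}))(l := i))) * Var (2 * n - 1) ^ (top_elem n S' - i))"

context
  fixes n l :: nat and S' :: "nat set"
  assumes n: "n \<ge> 1" and l: "l \<ge> 1" and S': "S' \<in> subsets (2 * n) l"
    and bad: "S' \<inter> {2 * n - 2, 2 * n - 1} \<noteq> {}"
begin

private lemma top: "top_elem n S' \<in> S'" "top_elem n S' < 2 * n"
  using bad n by (auto simp: top_elem_def)

private lemma rest: "finite (S' - {top_elem n S'})" "card (S' - {top_elem n S'}) = l - 1"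
proof -
  have "finite S'" using S' finite_subset[of S' "{..<2 * n}"] by (auto simp: subsets_def)
  thus "finite (S' - {top_elem n S'})" "card (S' - {top_elem n S'}) = l - 1"
    using top S' by (auto simp: subsets_def)
qed

private lemma tuple_image: "((subset_enum (S' - {top_elem n S'}))(l := i)) ` {1..l} = insert i (S' - {top_elem n S'})"
proof -
  have "{1..l} = insert l {1..l - 1}" using l by auto
  moreover have "((subset_enum (S' - {top_elem n S'}))(l := i)) ` {1..l - 1} = subset_enum (S' - {top_elem n S'}) ` {1..l - 1}"
    by (intro image_cong) (use l in auto)
  ultimately show ?thesis
    using bij_betw_imp_surj_on[OF bij_betw_subset_enum[OF rest]] by (simp only: image_insert fun_upd_same)
qed

private lemma tuple_inj_iff:
  "inj_on ((subset_enum (S' - {top_elem n S'}))(l := i)) {1..l} \<longleftrightarrow> i \<notin> S' - {top_elem n S'}"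
proof -
  let ?f = "(subset_enum (S' - {top_elem n S'}))(l := i)"
  have "inj_on ?f {1..l} \<longleftrightarrow> card (?f ` {1..l}) = l"
    using inj_on_iff_eq_card[of "{1..l}" ?f] by simp
  also have "\<dots> \<longleftrightarrow> card (insert i (S' - {top_elem n S'})) = l" by (simp only: tuple_image)
  also have "\<dots> \<longleftrightarrow> i \<notin> S' - {top_elem n S'}"
    using rest l by (cases "i \<in> S' - {top_elem n S'}") (simp_all add: insert_absorb)
  finally show ?thesis .
qed

text \<open>An exponent i that already occurs in another slot gives coefficient 0 by antisymmetry;
  every other i gives a coordinate up to sign.\<close>

lemma sum_coord_contraction_coeff:
  assumes P: "P \<in> ext_power n l"
  shows "(\<Sum>S\<in>subsets (2 * n) l. coord l P S * contraction_coeff n l S S') = contraction n l S' P"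
proof -
  define \<tau> where "\<tau> = top_elem n S'"
  define R where "R = S' - {\<tau>}"
  define f where "f = (\<lambda>i. (subset_enum R)(l := i))"
  define C where "C = {i. i < 2 * n \<and> (even i \<longleftrightarrow> even \<tau>)}"
  define C' where "C' = {i \<in> C. i \<notin> R}"
  define g where "g = (\<lambda>i. of_int (tuple_sign l (f i)) * Var (2 * n - 1) ^ (\<tau> - i) :: xpoly)"
  have fin: "finite C" by (simp add: C_def)
  have cc: "contraction_coeff n l S S' = (\<Sum>i\<in>{i \<in> C'. insert i R = S}. g i)" for S
  proof -
    have "contraction_coeff n l S S' = (\<Sum>i | i < 2 * n \<and> (even i \<longleftrightarrow> even \<tau>) \<and> i \<notin> R \<and> insert i R = S. g i)"
      using bad unfolding contraction_coeff_def g_def f_def R_def \<tau>_def by (simp only: if_False)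
    also have "{i. i < 2 * n \<and> (even i \<longleftrightarrow> even \<tau>) \<and> i \<notin> R \<and> insert i R = S} = {i \<in> C'. insert i R = S}"
      by (auto simp: C_def C'_def)
    finally show ?thesis .
  qed
  have ins: "insert i R \<in> subsets (2 * n) l" if "i \<in> C'" for i
    using that rest l S' by (auto simp: C'_def C_def R_def \<tau>_def subsets_def)
  have "(\<Sum>S\<in>subsets (2 * n) l. coord l P S * contraction_coeff n l S S')
      = (\<Sum>S\<in>subsets (2 * n) l. \<Sum>i\<in>{i \<in> C'. insert i R = S}. coord l P (insert i R) * g i)"
    unfolding cc sum_distrib_left by (intro sum.cong) auto
  also have "\<dots> = (\<Sum>i\<in>C'. coord l P (insert i R) * g i)"
    by (rule sum.group) (use ins fin in \<open>auto simp: C'_def\<close>)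
  also have "\<dots> = (\<Sum>i\<in>C'. Var (2 * n - 1) ^ (\<tau> - i) * Poly_Mapping.lookup P (tmon l (f i)))"
  proof (intro sum.cong refl)
    fix i assume i: "i \<in> C'"
    have "inj_on (f i) {1..l}" unfolding f_def R_def \<tau>_def tuple_inj_iff using i by (simp add: C'_def R_def \<tau>_def)
    moreover have "f i ` {1..l} = insert i R"
      unfolding f_def R_def \<tau>_def by (rule tuple_image)
    ultimately have "Poly_Mapping.lookup P (tmon l (f i)) = of_int (tuple_sign l (f i)) * coord l P (insert i R)"
      using tuple_sign(2)[of "f i" l P n] P by simp
    thus "coord l P (insert i R) * g i = Var (2 * n - 1) ^ (\<tau> - i) * Poly_Mapping.lookup P (tmon l (f i))"
      by (simp add: g_def mult_ac)
  qed
  also have "\<dots> = (\<Sum>i\<in>C. Var (2 * n - 1) ^ (\<tau> - i) * Poly_Mapping.lookup P (tmon l (f i)))"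
  proof (rule sum.mono_neutral_left[OF fin], goal_cases)
    case 2
    show ?case
    proof
      fix i assume i: "i \<in> C - C'"
      have "\<not> inj_on (f i) {1..l}" unfolding f_def R_def \<tau>_def tuple_inj_iff using i by (simp add: C'_def R_def \<tau>_def)
      thus "Var (2 * n - 1) ^ (\<tau> - i) * Poly_Mapping.lookup P (tmon l (f i)) = 0"
        using lookup_tmon_not_inj[OF P] by simp
    qed
  qed (auto simp: C'_def)
  also have "\<dots> = contraction n l S' P"
    by (simp add: contraction_def C_def f_def R_def \<tau>_def)
  finally show ?thesis .
qed

text \<open>Replacing the top element by a different exponent of the same parity lowers the sum of
  the set; keeping it gives the coefficient 1 or -1.\<close>

lemma contraction_coeff_bad:
  "contraction_coeff n l S S' \<noteq> 0 \<Longrightarrow> S = S' \<or> \<Sum>S < \<Sum>S'"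
  "contraction_coeff n l S' S' dvd 1"
proof -
  define \<tau> where "\<tau> = top_elem n S'"
  define R where "R = S' - {\<tau>}"
  have R: "S' = insert \<tau> R" "\<tau> \<notin> R" "finite R" using top rest by (auto simp: R_def \<tau>_def)
  define I where "I = (\<lambda>S. {i. i < 2 * n \<and> (even i \<longleftrightarrow> even \<tau>) \<and> i \<notin> R \<and> insert i R = S})"
  define g where "g = (\<lambda>i. of_int (tuple_sign l ((subset_enum R)(l := i))) * Var (2 * n - 1) ^ (\<tau> - i) :: xpoly)"
  have cc: "contraction_coeff n l S S' = (\<Sum>i\<in>I S. g i)" for S
    using bad unfolding contraction_coeff_def g_def R_def \<tau>_def I_def by (simp only: if_False)
  show "S = S' \<or> \<Sum>S < \<Sum>S'" if "contraction_coeff n l S S' \<noteq> 0"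
  proof -
    obtain i where i: "i \<in> I S"
      using \<open>contraction_coeff n l S S' \<noteq> 0\<close> unfolding cc by (metis sum.neutral)
    hence "i \<le> \<tau>" using parity_le_top_elem by (simp add: I_def \<tau>_def)
    moreover have "\<Sum>S = i + \<Sum>R" "\<Sum>S' = \<tau> + \<Sum>R" using i R by (auto simp: I_def)
    ultimately show ?thesis using i R by (cases "i = \<tau>") (auto simp: I_def)
  qed
  have "I S' = {\<tau>}"
    using R top(2)[folded \<tau>_def] by (auto simp: I_def)
  hence "contraction_coeff n l S' S' = g \<tau>" by (simp add: cc)
  moreover have "inj_on ((subset_enum R)(l := \<tau>)) {1..l}"
    unfolding R_def \<tau>_def tuple_inj_iff by simp
  hence "g \<tau> = 1 \<or> g \<tau> = - 1"
    using tuple_sign(1)[of "(subset_enum R)(l := \<tau>)" l] by (auto simp: g_def)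
  ultimately show "contraction_coeff n l S' S' dvd 1" by auto
qed

end

text \<open>In the Leibniz expansion by columns, every term contains one entry from each column in
  B.\<close>

lemma det_col_dvd:
  fixes A :: "'a::comm_ring_1 mat"
  assumes A: "A \<in> carrier_mat N N" and B: "B \<subseteq> {..<N}"
    and dvd: "\<And>i j. i < N \<Longrightarrow> j \<in> B \<Longrightarrow> d dvd A $$ (i, j)"
  shows "d ^ card B dvd det A"
  unfolding det_col[OF A]
proof (intro dvd_sum dvd_mult)
  fix p assume "p \<in> {p. p permutes {0..<N}}"
  hence p: "p permutes {0..<N}" by simp
  have "d ^ card B = (\<Prod>j\<in>B. d)" by simp
  also have "\<dots> dvd (\<Prod>j\<in>B. A $$ (p j, j))"
  proof (rule prod_dvd_prod)
    fix j assume "j \<in> B"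
    thus "d dvd A $$ (p j, j)" using B permutes_in_image[OF p, of j] by (intro dvd) auto
  qed
  also have "\<dots> dvd (\<Prod>j<N. A $$ (p j, j))" by (rule prod_dvd_prod_subset) (use B in auto)
  finally show "d ^ card B dvd (\<Prod>j<N. A $$ (p j, j))" .
qed

section \<open>Coordinate determinants\<close>

lemma det_in_sym_polys:
  assumes A: "A \<in> carrier_mat M M" and "\<And>i j. i < M \<Longrightarrow> j < M \<Longrightarrow> A $$ (i, j) \<in> sym_polys N"
  shows "det A \<in> sym_polys N"
  unfolding det_col[OF A]
proof (intro sym_polys_sum sym_polys_mult sym_polys_prod)
  fix p assume "p \<in> {p. p permutes {0..<M}}"
  hence p: "p permutes {0..<M}" by simp
  show "signof p \<in> sym_polys N" by (auto simp: sign_def intro: sym_polys_uminus)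
  fix j assume "j \<in> {..<M}"
  thus "A $$ (p j, j) \<in> sym_polys N" using permutes_in_image[OF p, of j] assms(2) by auto
qed

definition coord_mat :: "nat \<Rightarrow> (nat \<Rightarrow> Xpoly) \<Rightarrow> nat set list \<Rightarrow> xpoly mat" where
  "coord_mat l F Ss = mat (length Ss) (length Ss) (\<lambda>(i, j). coord l (F i) (Ss ! j))"

lemma coord_mat_carrier [simp]: "coord_mat l F Ss \<in> carrier_mat (length Ss) (length Ss)"
  by (simp add: coord_mat_def)

text \<open>Ordering the sets by their sums makes the matrix of \<open>contraction_coeff\<close>
  triangular; between different sets of equal sum its entry is 0.\<close>

definition sum_sorted_subsets :: "nat \<Rightarrow> nat \<Rightarrow> nat set list \<Rightarrow> bool" where
  "sum_sorted_subsets N l Ss \<longleftrightarrow> distinct Ss \<and> set Ss = subsets N l \<and> sorted (map (\<lambda>S. \<Sum>S) Ss)"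

lemma ex_sum_sorted_subsets: "\<exists>Ss. sum_sorted_subsets N l Ss"
proof -
  obtain xs where "set xs = subsets N l" "distinct xs"
    using finite_distinct_list[OF finite_subsets] by blast
  hence "sum_sorted_subsets N l (sort_key (\<lambda>S. \<Sum>S) xs)"
    by (simp add: sum_sorted_subsets_def)
  thus ?thesis by blast
qed

lemma length_sum_sorted_subsets: "sum_sorted_subsets N l Ss \<Longrightarrow> length Ss = N choose l"
  by (metis card_subsets distinct_card sum_sorted_subsets_def)

lemma sum_over_list: "distinct xs \<Longrightarrow> (\<Sum>k<length xs. f (xs ! k)) = (\<Sum>x\<in>set xs. f x)"
  by (rule sum.reindex_bij_betw[OF bij_betw_nth]) simp_all

lemma card_bad_subsets:
  assumes "n \<ge> 1"
  shows "card {S \<in> subsets (2 * n) l. S \<inter> {2 * n - 2, 2 * n - 1} \<noteq> {}} = ((2 * n) choose l) - ((2 * n - 2) choose l)"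
proof -
  have "{S \<in> subsets (2 * n) l. S \<inter> {2 * n - 2, 2 * n - 1} \<noteq> {}} = subsets (2 * n) l - subsets (2 * n - 2) l"
  proof -
    have "{..<2 * n} - {2 * n - 2, 2 * n - 1} = {..<2 * n - 2}" using assms by auto
    hence "S \<subseteq> {..<2 * n - 2} \<longleftrightarrow> S \<subseteq> {..<2 * n} \<and> S \<inter> {2 * n - 2, 2 * n - 1} = {}" for S by blast
    thus ?thesis by (auto simp: subsets_def)
  qed
  moreover have "subsets (2 * n - 2) l \<subseteq> subsets (2 * n) l" by (auto simp: subsets_def)
  ultimately show ?thesis by (simp add: card_Diff_subset card_subsets)
qed

text \<open>Multiplication by a matrix of invertible determinant replaces the columns of the sets
  meeting {2n-2, 2n-1} by contractions, which are divisible by the linear form. The number of these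
  sets is the exponent.\<close>

lemma last_sum_vars_power_dvd_det:
  assumes n: "n \<ge> 1" and l: "l \<ge> 1" and Ss: "sum_sorted_subsets (2 * n) l Ss"
    and F: "\<And>i. i < length Ss \<Longrightarrow> F i \<in> U_module n l"
  shows "(Var (2 * n - 1) + Var (2 * n)) ^ (((2 * n) choose l) - ((2 * n - 2) choose l)) dvd det (coord_mat l F Ss)"
proof -
  define M where "M = length Ss"
  define A where "A = coord_mat l F Ss"
  define G where "G = mat M M (\<lambda>(i, j). contraction_coeff n l (Ss ! i) (Ss ! j))"
  define bad where "bad = (\<lambda>S::nat set. S \<inter> {2 * n - 2, 2 * n - 1} \<noteq> {})"
  define B where "B = {j. j < M \<and> bad (Ss ! j)}"
  have carr: "A \<in> carrier_mat M M" "G \<in> carrier_mat M M" by (simp_all add: A_def G_def M_def)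
  have d: "distinct Ss" "set Ss = subsets (2 * n) l" and srt: "sorted (map (\<lambda>S. \<Sum>S) Ss)"
    using Ss by (auto simp: sum_sorted_subsets_def)
  have mem: "Ss ! j \<in> subsets (2 * n) l" if "j < M" for j
    using that d(2) by (metis M_def nth_mem)
  have ext: "F i \<in> ext_power n l" if "i < M" for i
    using F that by (auto simp: U_module_def M_def)
  \<comment> \<open>Entry (i, j) can be nonzero only if the set at i is the set at j or has a
    smaller sum, and then it is not listed later.\<close>
  have "upper_triangular G"
  proof (rule upper_triangularI)
    fix i j assume ij: "j < i" "i < dim_row G"
    hence M: "i < M" "j < M" by (auto simp: G_def)
    have "\<Sum>(Ss ! j) \<le> \<Sum>(Ss ! i)"
      using sorted_nth_mono[OF srt, of j i] ij M by (simp add: M_def)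
    moreover have "Ss ! i \<noteq> Ss ! j" using d(1) M ij by (simp add: M_def nth_eq_iff_index_eq)
    ultimately have "contraction_coeff n l (Ss ! i) (Ss ! j) = 0"
      using contraction_coeff_bad(1)[OF n l mem[OF M(2)], of "Ss ! i"]
      by (cases "bad (Ss ! j)") (force simp: bad_def, simp add: bad_def contraction_coeff_def)
    thus "G $$ (i, j) = 0" using M by (simp add: G_def)
  qed
  hence "det G = prod_list (diag_mat G)" by (rule det_upper_triangular[OF _ carr(2)])
  also have "\<dots> dvd 1"
  proof -
    have "G $$ (i, i) dvd 1" if i: "i < M" for i
      using contraction_coeff_bad(2)[OF n l mem[OF i]] i
      by (cases "bad (Ss ! i)") (simp add: G_def bad_def, simp add: G_def bad_def contraction_coeff_def)
    hence "x dvd 1" if "x \<in> set (diag_mat G)" for x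
      using that carr(2) by (auto simp: diag_mat_def)
    thus ?thesis
    proof (induction "diag_mat G" arbitrary: G)
      case Nil
      thus ?case by simp
    next
      case (Cons a xs)
      have "prod_list ys dvd 1" if "\<forall>y\<in>set ys. y dvd 1" for ys :: "xpoly list"
        using that by (induction ys) (auto intro: mult_dvd_mono[of _ 1 _ 1, simplified])
      thus ?case using Cons.prems by blast
    qed
  qed
  finally have unit: "det G dvd 1" .
  have AG: "(A * G) $$ (i, j) = (\<Sum>S\<in>subsets (2 * n) l. coord l (F i) S * contraction_coeff n l S (Ss ! j))"
    if ij: "i < M" "j < M" for i j
  proof -
    have "(A * G) $$ (i, j) = (\<Sum>k<M. coord l (F i) (Ss ! k) * contraction_coeff n l (Ss ! k) (Ss ! j))"
      using ij by (simp add: A_def coord_mat_def G_def scalar_prod_def M_def lessThan_atLeast0)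
    also have "\<dots> = (\<Sum>S\<in>subsets (2 * n) l. coord l (F i) S * contraction_coeff n l S (Ss ! j))"
      using sum_over_list[OF d(1), of "\<lambda>S. coord l (F i) S * contraction_coeff n l S (Ss ! j)"] by (simp add: M_def d(2))
    finally show ?thesis .
  qed
  have "(Var (2 * n - 1) + Var (2 * n)) ^ card B dvd det (A * G)"
  proof (rule det_col_dvd)
    show "A * G \<in> carrier_mat M M" using carr by simp
    fix i j assume i: "i < M" and "j \<in> B"
    hence j: "j < M" "bad (Ss ! j)" by (auto simp: B_def)
    have "(A * G) $$ (i, j) = contraction n l (Ss ! j) (F i)"
      unfolding AG[OF i j(1)] by (rule sum_coord_contraction_coeff[OF n l mem[OF j(1)] _ ext[OF i]]) (use j in \<open>simp add: bad_def\<close>)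
    thus "Var (2 * n - 1) + Var (2 * n) dvd (A * G) $$ (i, j)"
      using sum_vars_dvd_contraction[OF n l F] i by (simp add: M_def)
  qed (auto simp: B_def)
  also have "det (A * G) = det A * det G" by (rule det_mult[OF carr])
  also have "\<dots> dvd det A" using unit mult_dvd_mono[OF dvd_refl[of "det A"] unit] by simp
  also have "card B = card {S \<in> subsets (2 * n) l. bad S}"
  proof (rule bij_betw_same_card[of "(!) Ss"], rule bij_betw_imageI)
    show "inj_on ((!) Ss) B" using d(1) by (auto simp: inj_on_def B_def M_def nth_eq_iff_index_eq)
    show "(!) Ss ` B = {S \<in> subsets (2 * n) l. bad S}"
      using mem d(2) by (auto simp: B_def M_def image_iff) (metis in_set_conv_nth)
  qed
  finally show ?thesis unfolding A_def bad_def card_bad_subsets[OF n] .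
qed

text \<open>The module singles out the last two variables, but the determinant is symmetric, so the
  divisibility spreads to all pairs.\<close>

lemma sum_prod_power_dvd_det:
  assumes n: "n \<ge> 1" and l: "l \<ge> 1" and Ss: "sum_sorted_subsets (2 * n) l Ss"
    and F: "\<And>i. i < length Ss \<Longrightarrow> F i \<in> U_module n l"
  shows "sum_prod (2 * n) ^ (((2 * n) choose l) - ((2 * n - 2) choose l)) dvd det (coord_mat l F Ss)"
proof (rule sum_prod_power_dvd)
  fix i j assume "(i, j) \<in> var_pairs (2 * n)"
  hence ij: "i \<in> {1..2 * n}" "j \<in> {1..2 * n}" "i \<noteq> j" by (auto simp: var_pairs_def)
  let ?d = "det (coord_mat l F Ss)" and ?m = "((2 * n) choose l) - ((2 * n - 2) choose l)"
  \<comment> \<open>\<open>\<tau>\<close> sends 2n to j; then \<open>\<rho>\<close> sends the image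
    of 2n - 1 to i and fixes j.\<close>
  define \<tau> where "\<tau> = Transposition.transpose (2 * n) j"
  define \<rho> where "\<rho> = Transposition.transpose (\<tau> (2 * n - 1)) i"
  have "\<tau> (2 * n - 1) \<in> {1..2 * n}" "\<tau> (2 * n - 1) \<noteq> j"
    using n ij by (auto simp: \<tau>_def Transposition.transpose_def)
  hence \<rho>: "\<rho> permutes {1..2 * n}" "\<rho> j = j"
    using ij by (auto simp: \<rho>_def intro!: permutes_swap_id)
  have \<tau>: "\<tau> permutes {1..2 * n}" using n ij by (auto simp: \<tau>_def intro!: permutes_swap_id)
  have \<pi>: "(\<rho> \<circ> \<tau>) permutes {1..2 * n}" "(\<rho> \<circ> \<tau>) (2 * n - 1) = i" "(\<rho> \<circ> \<tau>) (2 * n) = j"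
    using permutes_compose[OF \<tau> \<rho>(1)] \<rho>(2) by (simp_all add: \<rho>_def \<tau>_def)
  have "(Var (2 * n - 1) + Var (2 * n)) ^ ?m dvd ?d"
    by (rule last_sum_vars_power_dvd_det[OF n l Ss F])
  then obtain q where q: "?d = (Var (2 * n - 1) + Var (2 * n)) ^ ?m * q"
    by (elim dvdE)
  have "?d \<in> sym_polys (2 * n)"
  proof (rule det_in_sym_polys[OF coord_mat_carrier])
    fix a b assume "a < length Ss" "b < length Ss"
    thus "coord_mat l F Ss $$ (a, b) \<in> sym_polys (2 * n)"
      using F by (auto simp: coord_mat_def U_module_def intro!: coord_in_sym_polys)
  qed
  hence "?d = rename (\<rho> \<circ> \<tau>) ?d" using \<pi>(1) by (simp add: sym_polys_def)
  also have "\<dots> = (Var i + Var j) ^ ?m * rename (\<rho> \<circ> \<tau>) q"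
    by (subst q) (simp only: rename_mult rename_power rename_add rename_Var \<pi>)
  finally show "(Var i + Var j) ^ ?m dvd ?d" by (rule dvdI)
qed

section \<open>Counting the index triples\<close>

definition sorted_lists :: "(nat \<Rightarrow> nat \<Rightarrow> bool) \<Rightarrow> nat \<Rightarrow> nat \<Rightarrow> nat list set" where
  "sorted_lists R M k = {L. sorted_wrt R L \<and> (\<forall>i\<in>set L. 1 \<le> i \<and> i \<le> M) \<and> length L = k}"

lemma finite_sorted_lists [simp]: "finite (sorted_lists R M k)"
  by (rule finite_subset[OF _ finite_lists_length_eq[of "{1..M}" k]]) (auto simp: sorted_lists_def)

lemma card_strictly_sorted_lists: "card (sorted_lists (<) M k) = M choose k"
proof -
  have "bij_betw set (sorted_lists (<) M k) {S. S \<subseteq> {1..M} \<and> card S = k}"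
  proof (rule bij_betwI[of _ _ _ sorted_list_of_set])
    show "set \<in> sorted_lists (<) M k \<rightarrow> {S. S \<subseteq> {1..M} \<and> card S = k}"
      by (auto simp: sorted_lists_def distinct_card strict_sorted_iff)
    show "sorted_list_of_set \<in> {S. S \<subseteq> {1..M} \<and> card S = k} \<rightarrow> sorted_lists (<) M k"
      using finite_subset[of _ "{1..M}"] by (fastforce simp: sorted_lists_def)
    show "sorted_list_of_set (set L) = L" if "L \<in> sorted_lists (<) M k" for L
      using that by (simp add: sorted_lists_def strict_sorted_iff sorted_list_of_set.idem_if_sorted_distinct)
    show "set (sorted_list_of_set S) = S" if "S \<in> {S. S \<subseteq> {1..M} \<and> card S = k}" for S
      using that finite_subset[of _ "{1..M}"] by auto
  qed
  thus ?thesis using n_subsets[of "{1..M}" k] by (simp add: bij_betw_same_card)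
qed

lemma strictly_sorted_gap:
  fixes L :: "nat list"
  assumes "sorted_wrt (<) L" "i \<le> j" "j < length L"
  shows "L ! i + (j - i) \<le> L ! j"
  using assms(2,3)
proof (induction j rule: dec_induct)
  case (step j)
  have "L ! j < L ! Suc j" using assms(1) step by (intro sorted_wrt_nth_less) auto
  thus ?case using step by simp
qed simp

text \<open>Adding the position to each entry turns weakly into strictly increasing lists. The
  truncated M + k - 1 gives the right count for M = 0 too.\<close>

lemma card_weakly_sorted_lists: "card (sorted_lists (\<le>) M k) = (M + k - 1) choose k"
proof -
  let ?f = "\<lambda>L::nat list. map (\<lambda>i. L ! i + i) [0..<length L]"
  let ?g = "\<lambda>L::nat list. map (\<lambda>i. L ! i - i) [0..<length L]"
  have lower: "Suc i \<le> L ! i" if "L \<in> sorted_lists (<) M' k" "i < k" for L i M'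
  proof -
    have "1 \<le> L ! 0" using that nth_mem[of 0 L] by (auto simp: sorted_lists_def)
    moreover have "L ! 0 + i \<le> L ! i" using that strictly_sorted_gap[of L 0 i] by (simp add: sorted_lists_def)
    ultimately show ?thesis by linarith
  qed
  have map_mem: "map (\<lambda>i. h i) [0..<k] \<in> sorted_lists R M' k"
    if "\<And>i. i < k \<Longrightarrow> 1 \<le> h i \<and> h i \<le> M'" "\<And>i j. i < j \<Longrightarrow> j < k \<Longrightarrow> R (h i) (h j)" for R M' h
    using that by (simp add: sorted_lists_def sorted_wrt_iff_nth_less)
  have len: "length L = k" if "L \<in> sorted_lists R M' k" for R M' and L :: "nat list"
    using that by (simp add: sorted_lists_def)
  have range: "1 \<le> L ! i" "L ! i \<le> M'" if "L \<in> sorted_lists R M' k" "i < k" for R M' i and L :: "nat list"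
    using that nth_mem[of i L] by (simp_all add: sorted_lists_def)
  have mono: "R (L ! i) (L ! j)" if "L \<in> sorted_lists R M' k" "i < j" "j < k" for R M' i j and L :: "nat list"
    using that by (simp add: sorted_lists_def sorted_wrt_nth_less)
  have "bij_betw ?f (sorted_lists (\<le>) M k) (sorted_lists (<) (M + k - 1) k)"
  proof (rule bij_betwI[of _ _ _ ?g])
    show "?f \<in> sorted_lists (\<le>) M k \<rightarrow> sorted_lists (<) (M + k - 1) k"
    proof
      fix L assume L: "L \<in> sorted_lists (\<le>) M k"
      show "?f L \<in> sorted_lists (<) (M + k - 1) k"
        unfolding len[OF L]
      proof (rule map_mem)
        show "1 \<le> L ! i + i \<and> L ! i + i \<le> M + k - 1" if "i < k" for i
          using range[OF L that] that by linarith
        show "L ! i + i < L ! j + j" if "i < j" "j < k" for i j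
          using mono[OF L that] that by linarith
      qed
    qed
    show "?g \<in> sorted_lists (<) (M + k - 1) k \<rightarrow> sorted_lists (\<le>) M k"
    proof
      fix L assume L: "L \<in> sorted_lists (<) (M + k - 1) k"
      have gap: "L ! i + (j - i) \<le> L ! j" if "i \<le> j" "j < k" for i j
        using strictly_sorted_gap[of L i j] L that by (simp add: sorted_lists_def)
      show "?g L \<in> sorted_lists (\<le>) M k"
        unfolding len[OF L]
      proof (rule map_mem)
        fix i assume i: "i < k"
        show "1 \<le> L ! i - i \<and> L ! i - i \<le> M"
          using gap[of i "k - 1"] range(2)[OF L, of "k - 1"] lower[OF L i] i by linarith
      next
        fix i j :: nat assume "i < j" "j < k"
        thus "L ! i - i \<le> L ! j - j" using gap[of i j] by linarith
      qed
    qed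
    show "?g (?f L) = L" if "L \<in> sorted_lists (\<le>) M k" for L
      by (rule nth_equalityI) simp_all
    show "?f (?g L) = L" if L: "L \<in> sorted_lists (<) (M + k - 1) k" for L
    proof (rule nth_equalityI)
      fix i assume "i < length (?f (?g L))"
      hence "i < k" using len[OF L] by simp
      thus "?f (?g L) ! i = L ! i" using lower[OF L, of i] len[OF L] by simp
    qed simp
  qed
  thus ?thesis using card_strictly_sorted_lists by (simp add: bij_betw_same_card)
qed

section \<open>Index triples of a given shape\<close>

definition shapes :: "nat \<Rightarrow> (nat \<times> nat \<times> nat) set" where
  "shapes l = {(a, b, c). a + b + 2 * c = l}"

lemma finite_shapes [simp]: "finite (shapes l)"
  by (rule finite_subset[of _ "{..l} \<times> {..l} \<times> {..l}"]) (auto simp: shapes_def)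

definition shape_triples :: "nat \<Rightarrow> nat \<times> nat \<times> nat \<Rightarrow> (nat list \<times> nat list \<times> nat list) set" where
  "shape_triples n = (\<lambda>(a, b, c). sorted_lists (<) n a \<times> sorted_lists (<) (n - (a + c)) b
     \<times> sorted_lists (\<le>) (n + 1 - (a + c)) c)"

definition shape_count :: "nat \<Rightarrow> nat \<Rightarrow> nat \<Rightarrow> nat \<Rightarrow> nat" where
  "shape_count n a b c = (n choose a) * ((n - a) choose c) * ((n - a - c) choose b)"

text \<open>As all entries are at least 1, the truncated bounds of \<open>shape_triples\<close>
  agree with the additive ones, also where these would be negative.\<close>

lemma index_triples_eq: "index_triples n l = (\<Union>s\<in>shapes l. shape_triples n s)"
proof -
  have "x + a + c \<le> m \<longleftrightarrow> x \<le> m - (a + c)" if "1 \<le> x" for x a c m :: nat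
    using that by linarith
  thus ?thesis
    by (fastforce simp: index_triples_def shapes_def shape_triples_def sorted_lists_def)
qed

lemma finite_shape_triples [simp]: "finite (shape_triples n s)"
  by (cases s) (simp add: shape_triples_def)

lemma finite_index_triples [simp]: "finite (index_triples n l)"
  by (simp add: index_triples_eq)

text \<open>The lists K are counted by (n + 1 - (a + c)) + c - 1 choose c, whose upper number is n -
  a. For a <= n < a + c the subtraction truncates, but both binomial coefficients are 0.\<close>

lemma card_shape_triples: "card (shape_triples n (a, b, c)) = shape_count n a b c"
proof -
  have "(n + 1 - (a + c) + c - 1) choose c = (n - a) choose c" if "a \<le> n"
  proof (cases "a + c \<le> n")
    case True
    hence "n + 1 - (a + c) + c - 1 = n - a" by simp
    thus ?thesis by simp
  next
    case False
    hence "n + 1 - (a + c) + c - 1 < c" "n - a < c" using that by linarith+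
    thus ?thesis by (simp add: binomial_eq_0)
  qed
  thus ?thesis
    by (cases "a \<le> n")
       (simp_all add: shape_triples_def card_cartesian_product card_strictly_sorted_lists
          card_weakly_sorted_lists shape_count_def)
qed

lemma sum_index_triples:
  "(\<Sum>t\<in>index_triples n l. f t) = (\<Sum>s\<in>shapes l. \<Sum>t\<in>shape_triples n s. f t)"
  unfolding index_triples_eq
  by (rule sum.UNION_disjoint[OF finite_shapes]) (simp, auto simp: shape_triples_def sorted_lists_def)

text \<open>Averaging over an involution: f and its reflection have the same sum, and their mean is
  q everywhere.\<close>

lemma sum_reflection:
  fixes f :: "'a \<Rightarrow> nat"
  assumes "finite A" "\<And>L. L \<in> A \<Longrightarrow> r L \<in> A \<and> r (r L) = L \<and> f L + f (r L) = 2 * q"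
  shows "(\<Sum>L\<in>A. f L) = q * card A"
proof -
  have "(\<Sum>L\<in>A. f L) = (\<Sum>L\<in>A. f (r L))"
    by (rule sum.reindex_bij_witness[of _ r r]) (use assms in auto)
  hence "2 * (\<Sum>L\<in>A. f L) = (\<Sum>L\<in>A. f L + f (r L))" by (simp add: sum.distrib)
  also have "\<dots> = 2 * q * card A" using assms by simp
  finally show ?thesis by simp
qed

text \<open>The involution is i \<mapsto> M + 1 - i on the entries, followed by reversal of the
  list; it gives each entry the mean weight q.\<close>

lemma sum_over_sorted_lists:
  assumes R: "R = (<) \<or> R = (\<le>)" and g: "\<And>i. 1 \<le> i \<Longrightarrow> i \<le> M \<Longrightarrow> g i + g (M + 1 - i) = 2 * q"
  shows "(\<Sum>L\<in>sorted_lists R M k. sum_list (map g L)) = k * q * card (sorted_lists R M k)"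
proof (rule sum_reflection[where r = "\<lambda>L. rev (map (\<lambda>i. M + 1 - i) L)"])
  fix L assume L: "L \<in> sorted_lists R M k"
  have sub: "M + 1 - (M + 1 - i) = i" if "i \<in> set L" for i
    using L that by (auto simp: sorted_lists_def)
  have "rev (map (\<lambda>i. M + 1 - i) (rev (map (\<lambda>i. M + 1 - i) L))) = L"
    using sub by (simp add: rev_map map_idI del: diff_diff_cancel)
  moreover have "sorted_wrt R (rev (map (\<lambda>i. M + 1 - i) L))"
    unfolding sorted_wrt_rev sorted_wrt_map
  proof (rule sorted_wrt_mono_rel)
    show "sorted_wrt R L" using L by (simp add: sorted_lists_def)
    fix x y assume "x \<in> set L" "y \<in> set L" "R x y"
    moreover from this L have "x \<le> M" "y \<le> M" by (auto simp: sorted_lists_def)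
    ultimately show "R (M + 1 - y) (M + 1 - x)" using R by auto
  qed
  hence "rev (map (\<lambda>i. M + 1 - i) L) \<in> sorted_lists R M k"
    using L by (auto simp: sorted_lists_def)
  moreover have "sum_list (map g L) + sum_list (map g (rev (map (\<lambda>i. M + 1 - i) L))) = 2 * (k * q)"
  proof -
    have "sum_list (map g L) + sum_list (map g (rev (map (\<lambda>i. M + 1 - i) L)))
        = sum_list (map (\<lambda>i. g i + g (M + 1 - i)) L)"
      by (simp add: rev_map[symmetric] sum_list_rev o_def sum_list_addf)
    also have "map (\<lambda>i. g i + g (M + 1 - i)) L = map (\<lambda>i. 2 * q) L"
      by (intro map_cong refl g) (use L in \<open>auto simp: sorted_lists_def\<close>)
    also have "sum_list (map (\<lambda>i. 2 * q) L) = length L * (2 * q)" by (simp only: sum_list_triv of_nat_id)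
    finally show ?thesis using L by (simp add: sorted_lists_def)
  qed
  ultimately show "rev (map (\<lambda>i. M + 1 - i) L) \<in> sorted_lists R M k \<and>
      rev (map (\<lambda>i. M + 1 - i) (rev (map (\<lambda>i. M + 1 - i) L))) = L \<and>
      sum_list (map g L) + sum_list (map g (rev (map (\<lambda>i. M + 1 - i) L))) = 2 * (k * q)"
    by blast
qed simp

text \<open>Degree in the x minus degree in the X of the basis element: 2r - 1 for each v_r, 2r - 2
  for each w_r and xi_r, see \<open>homogeneous_basis_elem\<close>.\<close>

definition triple_degree :: "nat list \<times> nat list \<times> nat list \<Rightarrow> nat" where
  "triple_degree = (\<lambda>(I, J, K). sum_list (map (\<lambda>i. 2 * i - 1) I) + sum_list (map (\<lambda>j. 2 * j - 2) J)
     + sum_list (map (\<lambda>k. 2 * k - 2) K))"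

lemma sum_times_factors:
  fixes f g h :: "_ \<Rightarrow> nat"
  assumes "finite A" "finite B" "finite C"
  shows "(\<Sum>(I, J, K)\<in>A \<times> B \<times> C. f I + g J + h K)
    = (\<Sum>I\<in>A. f I) * card B * card C + card A * (\<Sum>J\<in>B. g J) * card C + card A * card B * (\<Sum>K\<in>C. h K)"
  using assms
  by (simp add: sum.cartesian_product[symmetric] sum.distrib sum_distrib_left sum_distrib_right algebra_simps)

text \<open>By reflection, the entries of I, J and K have mean weights n, n - a - c - 1 and n - a -
  c.\<close>

lemma sum_triple_degree_shape:
  "(\<Sum>t\<in>shape_triples n (a, b, c). triple_degree t)
    = shape_count n a b c * (a * n + b * (n - a - c - 1) + c * (n - a - c))"
proof -
  have 1: "(\<Sum>I\<in>sorted_lists (<) n a. sum_list (map (\<lambda>i. 2 * i - 1) I)) = a * n * card (sorted_lists (<) n a)"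
    by (rule sum_over_sorted_lists) auto
  have 2: "(\<Sum>I\<in>sorted_lists (<) (n - (a + c)) b. sum_list (map (\<lambda>i. 2 * i - 2) I))
      = b * (n - (a + c) - 1) * card (sorted_lists (<) (n - (a + c)) b)"
    by (rule sum_over_sorted_lists) auto
  have 3: "(\<Sum>I\<in>sorted_lists (\<le>) (n + 1 - (a + c)) c. sum_list (map (\<lambda>i. 2 * i - 2) I))
      = c * (n - (a + c)) * card (sorted_lists (\<le>) (n + 1 - (a + c)) c)"
    by (rule sum_over_sorted_lists) auto
  have "(\<Sum>t\<in>shape_triples n (a, b, c). triple_degree t)
      = card (shape_triples n (a, b, c)) * (a * n + b * (n - (a + c) - 1) + c * (n - (a + c)))"
    unfolding shape_triples_def triple_degree_def prod.case
    by (subst sum_times_factors, simp, simp, simp, unfold 1 2 3 card_cartesian_product)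
       (simp only: distrib_left mult_ac)
  thus ?thesis by (simp add: card_shape_triples)
qed

section \<open>Generating functions of the weighted shape counts\<close>

lemma sum_binomial_absorb:
  fixes v :: "'a::comm_ring_1"
  shows "(\<Sum>c\<le>m. of_nat (m - c) * (of_nat (m choose c) * G c * v ^ (m - c)))
    = of_nat m * v * (\<Sum>c\<le>m - 1. of_nat ((m - 1) choose c) * G c * v ^ (m - 1 - c))"
proof (cases m)
  case (Suc k)
  have "(\<Sum>c\<le>m. of_nat (m - c) * (of_nat (m choose c) * G c * v ^ (m - c)))
      = (\<Sum>c\<le>k. of_nat (m - c) * (of_nat (m choose c) * G c * v ^ (m - c)))"
    by (simp add: Suc)
  also have "\<dots> = (\<Sum>c\<le>k. of_nat m * v * (of_nat (k choose c) * G c * v ^ (k - c)))"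
  proof (intro sum.cong refl)
    fix c assume c: "c \<in> {..k}"
    have "(m - c) * (m choose c) = m * (k choose c)" using binomial_absorb_comp[of m c] by (simp add: Suc)
    hence A: "of_nat (m - c) * of_nat (m choose c) = (of_nat m * of_nat (k choose c) :: 'a)" by (simp only: flip: of_nat_mult)
    have B: "v ^ (m - c) = v * v ^ (k - c)" using c by (simp add: Suc Suc_diff_le)
    have "of_nat (m - c) * (of_nat (m choose c) * G c * v ^ (m - c)) = of_nat (m - c) * of_nat (m choose c) * (G c * v ^ (m - c))"
      by (simp only: mult.assoc)
    thus "of_nat (m - c) * (of_nat (m choose c) * G c * v ^ (m - c)) = of_nat m * v * (of_nat (k choose c) * G c * v ^ (k - c))"
      unfolding A B by (simp only: mult_ac)
  qed
  finally show ?thesis by (simp add: Suc sum_distrib_left)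
qed simp

lemma sum_binomial_weighted:
  fixes u v :: "'a::comm_ring_1"
  shows "(\<Sum>c\<le>m. of_nat c * (of_nat (m choose c) * u ^ c * v ^ (m - c))) = of_nat m * u * (u + v) ^ (m - 1)"
proof -
  have "(\<Sum>c\<le>m. of_nat c * (of_nat (m choose c) * u ^ c * v ^ (m - c)))
      = (\<Sum>c\<le>m. of_nat (m - c) * (of_nat (m choose c) * v ^ c * u ^ (m - c)))"
    by (rule sum.reindex_bij_witness[of _ "\<lambda>c. m - c" "\<lambda>c. m - c"])
       (auto simp: binomial_symmetric[symmetric] mult_ac)
  also have "\<dots> = of_nat m * u * (v + u) ^ (m - 1)"
    unfolding sum_binomial_absorb binomial_ring ..
  finally show ?thesis by (simp add: add.commute)
qed

text \<open>The mean of \<open>triple_degree\<close> over the triples of shape (a, b, c).\<close>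

definition bracket :: "nat \<Rightarrow> nat \<Rightarrow> nat \<Rightarrow> nat \<Rightarrow> nat" where
  "bracket n a b c = a * n + b * (n - a - c - 1) + c * (n - a - c)"

lemma shape_sum_inner:
  fixes X :: "'a::comm_ring_1"
  assumes "M = n - a - c"
  shows "(\<Sum>b\<le>M. of_nat (M choose b) * X ^ b) = (X + 1) ^ M"
    and "(\<Sum>b\<le>M. of_nat ((M choose b) * bracket n a b c) * X ^ b)
      = of_nat (a * n + c * M) * (X + 1) ^ M + of_nat (M * (M - 1)) * X * (X + 1) ^ (M - 1)"
proof -
  show 1: "(\<Sum>b\<le>M. of_nat (M choose b) * X ^ b) = (X + 1) ^ M"
    unfolding binomial_ring by simp
  have "(\<Sum>b\<le>M. of_nat ((M choose b) * bracket n a b c) * X ^ b)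
      = (\<Sum>b\<le>M. of_nat (a * n + c * M) * (of_nat (M choose b) * X ^ b)
          + of_nat (M - 1) * (of_nat b * (of_nat (M choose b) * X ^ b * 1 ^ (M - b))))"
    unfolding bracket_def assms[symmetric]
    by (intro sum.cong refl)
       (simp only: of_nat_add of_nat_mult distrib_left distrib_right power_one mult_1_right mult_1_left mult_ac add_ac)
  also have "\<dots> = of_nat (a * n + c * M) * (X + 1) ^ M + of_nat (M - 1) * (of_nat M * X * (X + 1) ^ (M - 1))"
    unfolding sum.distrib sum_distrib_left[symmetric] 1 sum_binomial_weighted ..
  finally show "(\<Sum>b\<le>M. of_nat ((M choose b) * bracket n a b c) * X ^ b)
      = of_nat (a * n + c * M) * (X + 1) ^ M + of_nat (M * (M - 1)) * X * (X + 1) ^ (M - 1)"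
    by (simp add: mult_ac)
qed

text \<open>Besides a constant, the weight contains c (m - c) and (m - c)(m - c - 1). Each of their
  factors is absorbed into the binomial coefficients, which lowers m twice.\<close>

lemma shape_sum_middle:
  fixes X :: "'a::comm_ring_1"
  assumes "m = n - a"
  defines "S \<equiv> X ^ 2 + (X + 1)"
  shows "(\<Sum>c\<le>m. of_nat (m choose c) * X ^ (2 * c) * (\<Sum>b\<le>m - c. of_nat ((m - c) choose b) * X ^ b)) = S ^ m"
    and "(\<Sum>c\<le>m. of_nat (m choose c) * X ^ (2 * c) * (\<Sum>b\<le>m - c. of_nat (((m - c) choose b) * bracket n a b c) * X ^ b))
      = of_nat (a * n) * S ^ m + of_nat (m * (m - 1)) * X * (X + 1) ^ 2 * S ^ (m - 2)"
proof -
  define u v where "u = X ^ 2" and "v = X + 1"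
  have S: "S = u + v" by (simp add: S_def u_def v_def)
  have mc: "m - c = n - a - c" for c using assms by simp
  show "(\<Sum>c\<le>m. of_nat (m choose c) * X ^ (2 * c) * (\<Sum>b\<le>m - c. of_nat ((m - c) choose b) * X ^ b)) = S ^ m"
    unfolding shape_sum_inner(1)[OF mc] S binomial_ring u_def v_def power_mult ..
  have "(\<Sum>c\<le>m. of_nat (m choose c) * X ^ (2 * c) * (\<Sum>b\<le>m - c. of_nat (((m - c) choose b) * bracket n a b c) * X ^ b))
    = (\<Sum>c\<le>m. of_nat (m choose c) * u ^ c * (of_nat (a * n + c * (m - c)) * v ^ (m - c) + of_nat ((m - c) * (m - c - 1)) * X * v ^ (m - c - 1)))"
    unfolding shape_sum_inner(2)[OF mc] u_def v_def power_mult ..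
  also have "\<dots> = (\<Sum>c\<le>m. of_nat (a * n) * (of_nat (m choose c) * u ^ c * v ^ (m - c))
      + of_nat (m - c) * (of_nat (m choose c) * (of_nat c * u ^ c) * v ^ (m - c))
      + X * (of_nat (m - c) * (of_nat (m choose c) * u ^ c * (of_nat (m - c - 1) * v ^ (m - c - 1)))))"
    by (intro sum.cong refl) (simp only: of_nat_add of_nat_mult distrib_left distrib_right mult_ac add_ac)
  also have "\<dots> = of_nat (a * n) * S ^ m
      + (\<Sum>c\<le>m. of_nat (m - c) * (of_nat (m choose c) * (of_nat c * u ^ c) * v ^ (m - c)))
      + X * (\<Sum>c\<le>m. of_nat (m - c) * (of_nat (m choose c) * u ^ c * (of_nat (m - c - 1) * v ^ (m - c - 1))))"
    unfolding sum.distrib sum_distrib_left S binomial_ring ..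
  also have "(\<Sum>c\<le>m. of_nat (m - c) * (of_nat (m choose c) * (of_nat c * u ^ c) * v ^ (m - c)))
      = of_nat m * v * (of_nat (m - 1) * u * S ^ (m - 2))"
  proof -
    have "(\<Sum>c\<le>m - 1. of_nat ((m - 1) choose c) * (of_nat c * u ^ c) * v ^ (m - 1 - c))
        = (\<Sum>c\<le>m - 1. of_nat c * (of_nat ((m - 1) choose c) * u ^ c * v ^ (m - 1 - c)))"
      by (simp add: mult_ac)
    thus ?thesis unfolding sum_binomial_absorb sum_binomial_weighted S by (simp add: numeral_2_eq_2)
  qed
  also have "(\<Sum>c\<le>m. of_nat (m - c) * (of_nat (m choose c) * u ^ c * (of_nat (m - c - 1) * v ^ (m - c - 1))))
      = of_nat m * (of_nat (m - 1) * v * S ^ (m - 2))"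
  proof (cases m)
    case (Suc k)
    have "(\<Sum>c\<le>m. of_nat (m - c) * (of_nat (m choose c) * u ^ c * (of_nat (m - c - 1) * v ^ (m - c - 1))))
        = (\<Sum>c\<le>k. of_nat (m - c) * of_nat (m choose c) * (u ^ c * (of_nat (m - c - 1) * v ^ (m - c - 1))))"
      by (simp add: Suc mult_ac)
    also have "\<dots> = (\<Sum>c\<le>k. of_nat m * (of_nat (k - c) * (of_nat (k choose c) * u ^ c * v ^ (k - c))))"
    proof (intro sum.cong refl)
      fix c assume "c \<in> {..k}"
      have "(m - c) * (m choose c) = m * (k choose c)" using binomial_absorb_comp[of m c] by (simp add: Suc)
      hence "of_nat (m - c) * of_nat (m choose c) = (of_nat m * of_nat (k choose c) :: 'a)" by (simp only: flip: of_nat_mult)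
      moreover have "m - c - 1 = k - c" by (simp add: Suc)
      ultimately show "of_nat (m - c) * of_nat (m choose c) * (u ^ c * (of_nat (m - c - 1) * v ^ (m - c - 1)))
          = of_nat m * (of_nat (k - c) * (of_nat (k choose c) * u ^ c * v ^ (k - c)))"
        by (simp only: mult_ac)
    qed
    also have "\<dots> = of_nat m * (of_nat k * v * (u + v) ^ (k - 1))"
      unfolding sum_distrib_left[symmetric] sum_binomial_absorb binomial_ring ..
    finally show ?thesis by (simp add: Suc S)
  qed simp
  also have "of_nat (a * n) * S ^ m + of_nat m * v * (of_nat (m - 1) * u * S ^ (m - 2))
      + X * (of_nat m * (of_nat (m - 1) * v * S ^ (m - 2)))
      = of_nat (a * n) * S ^ m + of_nat (m * (m - 1)) * X * (X + 1) ^ 2 * S ^ (m - 2)"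
  proof -
    \<comment> \<open>u + X = X (X + 1) because u = X^2; v is the second factor X + 1.\<close>
    have key: "v * u + X * v = X * (X + 1) ^ 2" by (simp add: u_def v_def algebra_simps power2_eq_square)
    have "of_nat (a * n) * S ^ m + of_nat m * v * (of_nat (m - 1) * u * S ^ (m - 2))
        + X * (of_nat m * (of_nat (m - 1) * v * S ^ (m - 2)))
        = of_nat (a * n) * S ^ m + of_nat (m * (m - 1)) * (v * u + X * v) * S ^ (m - 2)"
      by (simp only: of_nat_mult distrib_left distrib_right mult_ac add_ac)
    thus ?thesis unfolding key by (simp only: mult_ac)
  qed
  finally show "(\<Sum>c\<le>m. of_nat (m choose c) * X ^ (2 * c) * (\<Sum>b\<le>m - c. of_nat (((m - c) choose b) * bracket n a b c) * X ^ b))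
      = of_nat (a * n) * S ^ m + of_nat (m * (m - 1)) * X * (X + 1) ^ 2 * S ^ (m - 2)" .
qed

text \<open>X marks l. The sums over b, c and a put 1 + X, then X^2, then X into the base of the
  n-th power, which becomes 1 + X + X^2 + X = (X + 1)^2.\<close>

lemma shape_sum_outer:
  fixes X :: "'a::comm_ring_1"
  shows "(\<Sum>a\<le>n. of_nat (n choose a) * X ^ a * (\<Sum>c\<le>n - a. of_nat ((n - a) choose c) * X ^ (2 * c)
      * (\<Sum>b\<le>n - a - c. of_nat ((n - a - c) choose b) * X ^ b))) = (X + 1) ^ (2 * n)"
    and "n \<ge> 1 \<Longrightarrow> (\<Sum>a\<le>n. of_nat (n choose a) * X ^ a * (\<Sum>c\<le>n - a. of_nat ((n - a) choose c) * X ^ (2 * c)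
      * (\<Sum>b\<le>n - a - c. of_nat (((n - a - c) choose b) * bracket n a b c) * X ^ b)))
      = of_nat (n * (2 * n - 1)) * X * (X + 1) ^ (2 * n - 2)"
proof -
  define S where "S = X ^ 2 + (X + 1)"
  have XS: "X + S = (X + 1) ^ 2" by (simp add: S_def power2_eq_square algebra_simps)
  show "(\<Sum>a\<le>n. of_nat (n choose a) * X ^ a * (\<Sum>c\<le>n - a. of_nat ((n - a) choose c) * X ^ (2 * c)
      * (\<Sum>b\<le>n - a - c. of_nat ((n - a - c) choose b) * X ^ b))) = (X + 1) ^ (2 * n)"
    unfolding shape_sum_middle(1)[OF refl]
    unfolding S_def[symmetric] binomial_ring[symmetric] XS power_mult ..
  assume n: "n \<ge> 1"
  have "(\<Sum>a\<le>n. of_nat (n choose a) * X ^ a * (\<Sum>c\<le>n - a. of_nat ((n - a) choose c) * X ^ (2 * c)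
      * (\<Sum>b\<le>n - a - c. of_nat (((n - a - c) choose b) * bracket n a b c) * X ^ b)))
     = (\<Sum>a\<le>n. of_nat n * (of_nat a * (of_nat (n choose a) * X ^ a * S ^ (n - a)))
        + X * (X + 1) ^ 2 * (of_nat (n - a) * (of_nat (n choose a) * X ^ a * (of_nat (n - a - 1) * S ^ (n - a - 2)))))"
    unfolding shape_sum_middle(2)[OF refl] S_def[symmetric]
    by (intro sum.cong refl) (simp only: of_nat_mult distrib_left mult_ac)
  also have "\<dots> = of_nat n * (of_nat n * X * (X + S) ^ (n - 1))
      + X * (X + 1) ^ 2 * (\<Sum>a\<le>n. of_nat (n - a) * (of_nat (n choose a) * X ^ a * (of_nat (n - a - 1) * S ^ (n - a - 2))))"
    unfolding sum.distrib sum_distrib_left[symmetric] sum_binomial_weighted ..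
  also have "(\<Sum>a\<le>n. of_nat (n - a) * (of_nat (n choose a) * X ^ a * (of_nat (n - a - 1) * S ^ (n - a - 2))))
      = of_nat n * (of_nat (n - 1) * (X + S) ^ (n - 2))"
  proof -
    have absorb: "of_nat (m - a) * (of_nat (m choose a) * y) = of_nat m * (of_nat ((m - 1) choose a) * y)" for m a and y :: 'a
    proof -
      have "(m - a) * (m choose a) = m * ((m - 1) choose a)" by (rule binomial_absorb_comp)
      thus ?thesis by (simp only: mult.assoc[symmetric] flip: of_nat_mult)
    qed
    have "(\<Sum>a\<le>n. of_nat (n - a) * (of_nat (n choose a) * X ^ a * (of_nat (n - a - 1) * S ^ (n - a - 2))))
       = (\<Sum>a\<le>n. of_nat n * (of_nat (n - 1) * (of_nat ((n - 2) choose a) * X ^ a * S ^ (n - 2 - a))))"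
    proof (intro sum.cong refl)
      fix a
      have "n - a - 1 = n - 1 - a" "n - 1 - 1 = n - 2" "n - a - 2 = n - 2 - a" by simp_all
      thus "of_nat (n - a) * (of_nat (n choose a) * X ^ a * (of_nat (n - a - 1) * S ^ (n - a - 2)))
         = of_nat n * (of_nat (n - 1) * (of_nat ((n - 2) choose a) * X ^ a * S ^ (n - 2 - a)))"
        using absorb[of n a "of_nat (n - 1 - a) * (X ^ a * S ^ (n - 2 - a))"]
          absorb[of "n - 1" a "X ^ a * S ^ (n - 2 - a)"]
        by (simp add: mult_ac)
    qed
    also have "\<dots> = (\<Sum>a\<le>n - 2. of_nat n * (of_nat (n - 1) * (of_nat ((n - 2) choose a) * X ^ a * S ^ (n - 2 - a))))"
      by (rule sum.mono_neutral_right) (auto simp: binomial_eq_0)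
    finally show ?thesis by (simp only: sum_distrib_left[symmetric] binomial_ring)
  qed
  also have "of_nat n * (of_nat n * X * (X + S) ^ (n - 1)) + X * (X + 1) ^ 2 * (of_nat n * (of_nat (n - 1) * (X + S) ^ (n - 2)))
      = of_nat (n * (2 * n - 1)) * X * (X + 1) ^ (2 * n - 2)"
  proof (cases "n = 1")
    case False
    then obtain k where k: "n = Suc (Suc k)" using n by (metis One_nat_def Suc_le_D le_antisym not0_implies_Suc le_zero_eq)
    have e: "(X + 1) ^ 2 * ((X + 1) ^ 2) ^ k = (X + 1) ^ (2 * n - 2)" "((X + 1) ^ 2) ^ (Suc k) = (X + 1) ^ (2 * n - 2)"
      by (simp_all add: k power_mult[symmetric] power_add[symmetric])
    have "of_nat n * (of_nat n * X * (X + S) ^ (n - 1)) + X * (X + 1) ^ 2 * (of_nat n * (of_nat (n - 1) * (X + S) ^ (n - 2)))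
       = of_nat n * (of_nat n * X * ((X + 1) ^ 2) ^ (Suc k)) + X * of_nat n * of_nat (n - 1) * ((X + 1) ^ 2 * ((X + 1) ^ 2) ^ k)"
      unfolding XS by (simp add: k mult_ac)
    also have "\<dots> = of_nat (n * n + n * (n - 1)) * X * (X + 1) ^ (2 * n - 2)"
      unfolding e by (simp only: of_nat_add of_nat_mult distrib_left distrib_right mult_ac)
    also have "n * n + n * (n - 1) = n * (2 * n - 1)" by (simp add: k)
    finally show ?thesis .
  qed simp
  finally show "(\<Sum>a\<le>n. of_nat (n choose a) * X ^ a * (\<Sum>c\<le>n - a. of_nat ((n - a) choose c) * X ^ (2 * c)
      * (\<Sum>b\<le>n - a - c. of_nat (((n - a - c) choose b) * bracket n a b c) * X ^ b)))
      = of_nat (n * (2 * n - 1)) * X * (X + 1) ^ (2 * n - 2)" .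
qed

lemma of_nat_mult_X_power: "of_nat k * monom (1 :: int) 1 ^ j = monom (int k) j"
proof -
  have "monom (1 :: int) 1 ^ j = monom 1 j"
    by (induction j) (simp_all add: mult_monom)
  hence "of_nat k * monom (1 :: int) 1 ^ j = smult (int k) (monom 1 j)"
    by (simp only: of_nat_poly) simp
  thus ?thesis by (simp only: smult_monom mult_1_right)
qed

lemma coeff_one_plus_X_power: "coeff ((monom 1 1 + 1) ^ N :: int poly) k = int (N choose k)"
proof -
  have "(monom 1 1 + 1) ^ N = (\<Sum>j\<le>N. monom (int (N choose j)) j)"
    unfolding binomial_ring
    by (simp only: of_nat_mult_X_power power_one mult_1_right)
  thus ?thesis by (simp add: coeff_sum binomial_eq_0)
qed

lemma sum_nested_Sigma:
  "(\<Sum>a\<le>n. \<Sum>c\<le>n - a. \<Sum>b\<le>n - a - c. g a c b)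
    = (\<Sum>(a, c, b)\<in>(SIGMA a:{..n}. SIGMA c:{..n - a}. {..n - a - c}). g a c b)"
  for n :: nat
proof -
  have "(\<Sum>c\<le>n - a. \<Sum>b\<le>n - a - c. g a c b) = (\<Sum>(c, b)\<in>(SIGMA c:{..n - a}. {..n - a - c}). g a c b)" for a
    by (rule sum.Sigma) auto
  thus ?thesis by (simp only:) (rule sum.Sigma, auto)
qed

text \<open>Shape (a, b, c) contributes to the power a + b + 2c of X. Shapes outside the summation
  ranges have a vanishing binomial coefficient, so all of \<open>shapes l\<close> may be
  summed.\<close>

lemma shape_sum_eq_coeff:
  "int (\<Sum>(a, b, c)\<in>shapes l. shape_count n a b c * h a b c) = coeff
    (\<Sum>a\<le>n. of_nat (n choose a) * monom 1 1 ^ a * (\<Sum>c\<le>n - a. of_nat ((n - a) choose c) * monom 1 1 ^ (2 * c)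
      * (\<Sum>b\<le>n - a - c. of_nat (((n - a - c) choose b) * h a b c) * monom 1 1 ^ b))) l"
proof -
  define w where "w = (\<lambda>(a, b, c). int (shape_count n a b c * h a b c))"
  define w' where "w' = (\<lambda>(a, c, b). w (a, b, c))"
  define P where "P = (\<lambda>(a, c, b). a + b + 2 * c = l)"
  define B where "B = (SIGMA a:{..n}. SIGMA c:{..n - a}. {..n - a - c})"
  define g where "g = (\<lambda>a c b. if a + b + 2 * c = l then w (a, b, c) else 0)"
  have poly: "(\<Sum>a\<le>n. of_nat (n choose a) * monom 1 1 ^ a * (\<Sum>c\<le>n - a. of_nat ((n - a) choose c) * monom 1 1 ^ (2 * c)
      * (\<Sum>b\<le>n - a - c. of_nat (((n - a - c) choose b) * h a b c) * monom 1 1 ^ b)))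
     = (\<Sum>a\<le>n. \<Sum>c\<le>n - a. \<Sum>b\<le>n - a - c. monom (w (a, b, c)) (a + b + 2 * c))"
    unfolding sum_distrib_left
  proof (intro sum.cong refl)
    fix a c b
    have "a + (2 * c + b) = a + b + 2 * c"
      "int (n choose a) * (int ((n - a) choose c) * int (((n - a - c) choose b) * h a b c)) = w (a, b, c)"
      by (simp_all add: w_def shape_count_def)
    thus "of_nat (n choose a) * monom 1 1 ^ a * (of_nat ((n - a) choose c) * monom 1 1 ^ (2 * c)
        * (of_nat (((n - a - c) choose b) * h a b c) * monom 1 1 ^ b)) = monom (w (a, b, c)) (a + b + 2 * c)"
      by (simp only: of_nat_mult_X_power mult_monom)
  qed
  have "coeff (\<Sum>a\<le>n. \<Sum>c\<le>n - a. \<Sum>b\<le>n - a - c. monom (w (a, b, c)) (a + b + 2 * c)) l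
      = (\<Sum>a\<le>n. \<Sum>c\<le>n - a. \<Sum>b\<le>n - a - c. g a c b)"
    by (simp add: coeff_sum g_def)
  also have "\<dots> = (\<Sum>(a, c, b)\<in>B. g a c b)"
    unfolding B_def by (rule sum_nested_Sigma)
  also have "\<dots> = (\<Sum>s\<in>B. if P s then w' s else 0)"
    by (intro sum.cong refl) (simp add: g_def P_def w'_def split_beta)
  also have "\<dots> = (\<Sum>s\<in>{s \<in> B. P s}. w' s)"
    by (rule sum.inter_filter[symmetric]) (unfold B_def, intro finite_SigmaI, auto)
  also have "\<dots> = (\<Sum>s\<in>{(a, b, c). (a, c, b) \<in> B \<and> P (a, c, b)}. w s)"
    by (rule sum.reindex_bij_witness[of _ "\<lambda>(a, b, c). (a, c, b)" "\<lambda>(a, c, b). (a, b, c)"])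
       (clarsimp simp: w'_def)+
  also have "\<dots> = (\<Sum>s\<in>shapes l. w s)"
  proof (rule sum.mono_neutral_left)
    show "\<forall>s\<in>shapes l - {(a, b, c). (a, c, b) \<in> B \<and> P (a, c, b)}. w s = 0"
    proof (rule ballI)
      fix s assume s: "s \<in> shapes l - {(a, b, c). (a, c, b) \<in> B \<and> P (a, c, b)}"
      obtain a b c where abc: "s = (a, b, c)" by (cases s)
      have "(a, b, c) \<in> shapes l" "\<not> ((a, c, b) \<in> B \<and> P (a, c, b))" using s abc by simp_all
      hence "\<not> (a \<le> n \<and> c \<le> n - a \<and> b \<le> n - a - c)"
        by (simp add: B_def P_def shapes_def)
      hence "n choose a = 0 \<or> (n - a) choose c = 0 \<or> (n - a - c) choose b = 0"
        by (meson binomial_eq_0 not_le)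
      thus "w s = 0" unfolding abc by (auto simp: w_def shape_count_def)
    qed
    show "{(a, b, c). (a, c, b) \<in> B \<and> P (a, c, b)} \<subseteq> shapes l"
      by (clarsimp simp: P_def shapes_def)
  qed simp
  finally show ?thesis unfolding poly by (simp add: w_def case_prod_beta)
qed

lemma card_index_triples: "card (index_triples n l) = (2 * n) choose l"
proof -
  have "card (index_triples n l) = (\<Sum>s\<in>shapes l. card (shape_triples n s))"
    using sum_index_triples[of "\<lambda>_. 1 :: nat" n l] by simp
  also have "\<dots> = (\<Sum>(a, b, c)\<in>shapes l. shape_count n a b c * 1)"
    by (intro sum.cong) (auto simp: card_shape_triples)
  also have "int \<dots> = int ((2 * n) choose l)"
    unfolding shape_sum_eq_coeff
    by (simp only: mult_1_right shape_sum_outer(1) coeff_one_plus_X_power)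
  finally show ?thesis by simp
qed

lemma sum_triple_degree:
  assumes "n \<ge> 1" "l \<ge> 1"
  shows "(\<Sum>t\<in>index_triples n l. triple_degree t) = n * (2 * n - 1) * ((2 * n - 2) choose (l - 1))"
proof -
  have "(\<Sum>t\<in>index_triples n l. triple_degree t) = (\<Sum>(a, b, c)\<in>shapes l. shape_count n a b c * bracket n a b c)"
    unfolding sum_index_triples by (intro sum.cong refl) (auto simp: sum_triple_degree_shape bracket_def)
  also have "int \<dots> = coeff (of_nat (n * (2 * n - 1)) * monom 1 1 * (monom 1 1 + 1) ^ (2 * n - 2)) l"
    unfolding shape_sum_eq_coeff shape_sum_outer(2)[OF assms(1)] ..
  also have "\<dots> = int (n * (2 * n - 1)) * coeff (monom 1 1 * (monom 1 1 + 1) ^ (2 * n - 2)) l"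
    by (simp only: mult.assoc of_nat_poly) simp
  also have "coeff (monom 1 1 * (monom 1 1 + 1) ^ (2 * n - 2)) l = int ((2 * n - 2) choose (l - 1))"
    using assms(2) by (simp add: coeff_monom_mult coeff_one_plus_X_power[unfolded One_nat_def])
  finally show ?thesis by (metis of_nat_eq_iff of_nat_mult)
qed

text \<open>Double counting: each i < 2n lies in 2n - 1 choose l - 1 of the sets, and these i add up
  to n (2n - 1).\<close>

lemma sum_elements_subsets:
  assumes "n \<ge> 1" "l \<ge> 1"
  shows "(\<Sum>S\<in>subsets (2 * n) l. \<Sum>S) = n * (2 * n - 1) * ((2 * n - 1) choose (l - 1))"
proof -
  let ?N = "2 * n"
  have "(\<Sum>S\<in>subsets ?N l. \<Sum>S) = (\<Sum>S\<in>subsets ?N l. \<Sum>i<?N. if i \<in> S then i else 0)"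
    by (intro sum.cong refl sum.mono_neutral_cong_left) (auto simp: subsets_def)
  also have "\<dots> = (\<Sum>i<?N. \<Sum>S\<in>subsets ?N l. if i \<in> S then i else 0)" by (rule sum.swap)
  also have "\<dots> = (\<Sum>i<?N. i * card {S \<in> subsets ?N l. i \<in> S})"
    by (intro sum.cong refl) (simp add: sum.If_cases Int_def)
  also have "\<dots> = (\<Sum>i<?N. i * ((?N - 1) choose (l - 1)))"
  proof (intro sum.cong refl)
    fix i assume i: "i \<in> {..<?N}"
    have "bij_betw (insert i) {T. T \<subseteq> {..<?N} - {i} \<and> card T = l - 1} {S \<in> subsets ?N l. i \<in> S}"
    proof (rule bij_betwI[of _ _ _ "\<lambda>S. S - {i}"])
      show "insert i \<in> {T. T \<subseteq> {..<?N} - {i} \<and> card T = l - 1} \<rightarrow> {S \<in> subsets ?N l. i \<in> S}"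
      proof
        fix T assume T: "T \<in> {T. T \<subseteq> {..<?N} - {i} \<and> card T = l - 1}"
        hence "finite T" "i \<notin> T" using finite_subset[of T "{..<?N} - {i}"] by auto
        thus "insert i T \<in> {S \<in> subsets ?N l. i \<in> S}" using T i assms(2) by (auto simp: subsets_def)
      qed
    qed (use assms(2) in \<open>auto simp: subsets_def\<close>)
    hence "card {S \<in> subsets ?N l. i \<in> S} = card {T. T \<subseteq> {..<?N} - {i} \<and> card T = l - 1}"
      by (simp add: bij_betw_same_card)
    also have "\<dots> = (?N - 1) choose (l - 1)"
      using i n_subsets[of "{..<?N} - {i}" "l - 1"] by simp
    finally show "i * card {S \<in> subsets ?N l. i \<in> S} = i * ((?N - 1) choose (l - 1))" by simp
  qed
  also have "\<dots> = (\<Sum>i<?N. i) * ((?N - 1) choose (l - 1))" by (simp add: sum_distrib_right)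
  also have "(\<Sum>i<?N. i) = n * (?N - 1)"
    using assms(1) by (induction n rule: dec_induct) (simp_all add: algebra_simps)
  finally show ?thesis .
qed

text \<open>Pascal's rule, applied twice. The right-hand side is the degree of D^m, since D has n
  (2n - 1) linear factors; the left-hand side will be the degree of the determinant.\<close>

lemma degree_identity:
  assumes "n \<ge> 1" "l \<ge> 1"
  shows "(\<Sum>t\<in>index_triples n l. triple_degree t) + (\<Sum>S\<in>subsets (2 * n) l. \<Sum>S)
    = n * (2 * n - 1) * (((2 * n) choose l) - ((2 * n - 2) choose l))"
proof -
  obtain N k where N: "2 * n = Suc (Suc N)" and k: "l = Suc k"
    using assms by (metis One_nat_def Suc_le_D add_Suc_right mult_2 plus_nat.simps(2))
  show ?thesis
    unfolding sum_triple_degree[OF assms] sum_elements_subsets[OF assms]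
    unfolding N k by (simp add: distrib_left)
qed

section \<open>Homogeneity\<close>

abbreviation (input) scale :: "complex \<Rightarrow> (nat \<Rightarrow> complex) \<Rightarrow> nat \<Rightarrow> complex" where
  "scale c x \<equiv> (\<lambda>i. c * x i)"

text \<open>A monomial passes the test iff its degree in the x exceeds its degree in the X by d. The
  X thus have weight -1, in keeping with the evaluations at X = 1/x.\<close>

definition homogeneous :: "nat \<Rightarrow> Xpoly \<Rightarrow> bool" where
  "homogeneous d P \<longleftrightarrow> (\<forall>c X x. Xeval X (scale c x) P = c ^ d * Xeval (scale c X) x P)"

lemma homogeneous_mult: "homogeneous d P \<Longrightarrow> homogeneous e Q \<Longrightarrow> homogeneous (d + e) (P * Q)"
  by (simp add: homogeneous_def Xeval.hom_mult power_add)

lemma homogeneous_1: "homogeneous 0 1"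
  by (simp add: homogeneous_def)

lemma homogeneous_prod:
  assumes "finite A" "\<And>a. a \<in> A \<Longrightarrow> homogeneous (d a) (P a)"
  shows "homogeneous (\<Sum>a\<in>A. d a) (\<Prod>a\<in>A. P a)"
  using assms by (induction A rule: finite_induct) (simp_all add: homogeneous_1 homogeneous_mult)

lemma homogeneous_alt:
  assumes "homogeneous d P"
  shows "homogeneous d (alt l P)"
  unfolding homogeneous_def
proof (intro allI)
  fix c X x
  have "Xeval (X \<circ> \<sigma>) (scale c x) P = c ^ d * Xeval (scale c X \<circ> \<sigma>) x P" for \<sigma>
    using assms by (simp add: homogeneous_def o_def)
  thus "Xeval X (scale c x) (alt l P) = c ^ d * Xeval (scale c X) x (alt l P)"
    by (simp add: Xeval_alt sum_distrib_left mult.left_commute)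
qed

section \<open>Weights of the generators\<close>

lemma peval_elem_sym_scale:
  "peval (scale c x) (elem_sym n (int k)) = c ^ k * peval x (elem_sym n (int k))"
  unfolding elem_sym_nat peval.hom_sum peval.hom_prod peval_Var sum_distrib_left
  by (intro sum.cong refl) (simp add: prod.distrib)

lemma peval_elem_sym_scale':
  "peval (scale c x) (elem_sym n (2 * int k)) = c ^ (2 * k) * peval x (elem_sym n (2 * int k))"
  using peval_elem_sym_scale[of c x n "2 * k"] by simp

text \<open>P_{1,s} = e_{2s-1} has degree 2s - 1, and each step of the recursion adds 2. The
  hypotheses keep the subtraction in 2 (s + r) - 3 exact.\<close>

lemma peval_Pcoeff_scale:
  assumes "r \<ge> 1" "s \<ge> 1"
  shows "peval (scale c x) (Pcoeff n r (int s)) = c ^ (2 * (s + r) - 3) * peval x (Pcoeff n r (int s))"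
  using assms
proof (induction r arbitrary: s rule: dec_induct)
  case base
  have "2 * int s - 1 = int (2 * s - 1)" using base by simp
  moreover have "2 * (s + 1) - 3 = 2 * s - 1" by simp
  ultimately show ?case by (simp only: One_nat_def[symmetric] Pcoeff.simps(2)[folded One_nat_def] peval_elem_sym_scale)
next
  case (step r)
  have P: "Pcoeff n (Suc r) (int s) = Pcoeff n r (int (Suc s)) - elem_sym n (2 * int s) * Pcoeff n r (int 1)"
    using step.hyps by (cases r) (simp_all add: add.commute)
  have IH1: "peval (scale c x) (Pcoeff n r (int (Suc s))) = c ^ (2 * (Suc s + r) - 3) * peval x (Pcoeff n r (int (Suc s)))"
    by (rule step.IH) simp
  have IH2: "peval (scale c x) (Pcoeff n r (int 1)) = c ^ (2 * (1 + r) - 3) * peval x (Pcoeff n r (int 1))"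
    by (rule step.IH) simp
  have "c ^ (2 * s) * c ^ (2 * (1 + r) - 3) = c ^ (2 * (s + Suc r) - 3)"
  proof -
    have "2 * s + (2 * (1 + r) - 3) = 2 * (s + Suc r) - 3" using step.hyps by arith
    thus ?thesis by (simp only: flip: power_add)
  qed
  hence "c ^ (2 * s) * u * (c ^ (2 * (1 + r) - 3) * v) = c ^ (2 * (s + Suc r) - 3) * (u * v)" for u v
    by (simp only: mult.assoc mult.left_commute[of u] flip: mult.assoc[of "c ^ (2 * s)"])
  moreover have "2 * (Suc s + r) - 3 = 2 * (s + Suc r) - 3" by simp
  ultimately show ?case
    unfolding P peval.hom_minus peval.hom_mult IH1 IH2 peval_elem_sym_scale'
    by (simp only: right_diff_distrib)
qed

lemma homogeneous_vH:
  assumes "r \<ge> 1"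
  shows "homogeneous (2 * r - 1) (vH n r (Var a))"
  unfolding homogeneous_def Xeval_vH vval_def sum_distrib_left
proof (intro allI sum.cong refl)
  fix c :: complex and X x :: "nat \<Rightarrow> complex" and s assume s: "s \<in> {1..n}"
  have "c ^ (2 * (s + r) - 3) = c ^ (2 * r - 1) * c ^ (2 * (s - 1))"
  proof -
    have "2 * r - 1 + 2 * (s - 1) = 2 * (s + r) - 3" using assms s by auto
    thus ?thesis by (simp only: flip: power_add)
  qed
  thus "peval (scale c x) (Pcoeff n r (int s)) * (X a ^ 2) ^ (s - 1)
      = c ^ (2 * r - 1) * (peval x (Pcoeff n r (int s)) * ((c * X a) ^ 2) ^ (s - 1))"
    using s assms by (simp add: peval_Pcoeff_scale power_mult_distrib power_mult)
qed

lemma homogeneous_wH: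
  assumes "r \<ge> 1"
  shows "homogeneous (2 * r - 2) (wH n r (Var a))"
proof -
  have "Xeval X (scale c x) (wH n r (Var a)) = c ^ (2 * r - 2) * Xeval (scale c X) x (wH n r (Var a))" for c X x
  proof -
    have "vval n (scale c x) r (X a ^ 2) = c ^ (2 * r - 1) * vval n x r ((c * X a) ^ 2)"
      using homogeneous_vH[OF assms, of n a] by (simp add: homogeneous_def Xeval_vH)
    moreover have "c ^ (2 * r - 1) = c ^ (2 * r - 2) * c"
      unfolding power_Suc2[symmetric] using assms by (intro arg_cong[where f = "(^) c"]) arith
    ultimately show ?thesis by (simp add: Xeval_wH)
  qed
  thus ?thesis by (simp add: homogeneous_def)
qed

lemma peval_xi_coeff_mult_elem_sym_scale:
  assumes "k \<ge> 1"
  shows "peval (scale c x) (xi_coeff n k i) * peval (scale c x) (elem_sym n (2 * int j))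
    = c ^ (2 * (i + j + k) - 3) * (peval x (xi_coeff n k i) * peval x (elem_sym n (2 * int j)))"
proof (cases "i = 0")
  case False
  have "c ^ (2 * (i + j + k) - 3) = c ^ (2 * (i + k) - 3) * c ^ (2 * j)"
  proof -
    have "2 * (i + k) - 3 + 2 * j = 2 * (i + j + k) - 3" using assms False by arith
    thus ?thesis by (simp only: flip: power_add)
  qed
  thus ?thesis using False assms
    by (simp add: xi_coeff_def peval_Pcoeff_scale peval_elem_sym_scale')
qed (simp add: xi_coeff_def)

lemma homogeneous_xi_half:
  assumes "k \<ge> 1"
  shows "homogeneous (2 * k - 2) (xi_half n k a b)"
  unfolding homogeneous_def Xeval_xi_half bez_def sum_distrib_left
proof (intro allI sum.cong refl)
  fix c :: complex and X x :: "nat \<Rightarrow> complex" and j i r assume "j \<in> {..n}" "i \<in> {..<j}" "r \<in> {..<j - i}"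
  define F where "F = peval x (xi_coeff n k j) * peval x (elem_sym n (2 * int i)) - peval x (xi_coeff n k i) * peval x (elem_sym n (2 * int j))"
  have F: "peval (scale c x) (xi_coeff n k j) * peval (scale c x) (elem_sym n (2 * int i))
      - peval (scale c x) (xi_coeff n k i) * peval (scale c x) (elem_sym n (2 * int j)) = c ^ (2 * (i + j + k) - 3) * F"
    unfolding peval_xi_coeff_mult_elem_sym_scale[OF assms] F_def
    by (simp add: right_diff_distrib add.commute)
  \<comment> \<open>Degree 2 (i + j + k) - 3 in the x against 2 (i + j) - 1 in the X leaves 2k - 2
    for every i, j and r.\<close>
  have e: "2 * (i + j + k) - 3 = (2 * k - 2) + Suc (2 * (i + r) + 2 * (j - Suc r))"
    using assms \<open>r \<in> {..<j - i}\<close> by auto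
  show "X a * ((peval (scale c x) (xi_coeff n k j) * peval (scale c x) (elem_sym n (2 * int i))
      - peval (scale c x) (xi_coeff n k i) * peval (scale c x) (elem_sym n (2 * int j)))
        * ((X a ^ 2) ^ (i + r) * (X b ^ 2) ^ (j - Suc r)))
    = c ^ (2 * k - 2) * (c * X a * ((peval x (xi_coeff n k j) * peval x (elem_sym n (2 * int i))
      - peval x (xi_coeff n k i) * peval x (elem_sym n (2 * int j)))
        * (((c * X a) ^ 2) ^ (i + r) * ((c * X b) ^ 2) ^ (j - Suc r))))"
    unfolding F F_def[symmetric] e power_mult_distrib power_add power_Suc power_mult
    by (simp only: mult_ac)
qed

lemma homogeneous_basis_elem:
  assumes "t \<in> index_triples n l"
  shows "homogeneous (triple_degree t) (basis_elem n t)"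
proof -
  obtain I J K where t: "t = (I, J, K)" by (cases t)
  have pos: "1 \<le> I ! a" if "a < length I" for a
    using assms nth_mem[OF that] by (simp add: t index_triples_def)
  have posJ: "1 \<le> J ! a" if "a < length J" for a
    using assms nth_mem[OF that] by (simp add: t index_triples_def)
  have posK: "1 \<le> K ! a" if "a < length K" for a
    using assms nth_mem[OF that] by (simp add: t index_triples_def)
  have sl: "(\<Sum>a<length L. f (L ! a)) = sum_list (map f L)" for f :: "nat \<Rightarrow> nat" and L
    by (simp add: sum_list_sum_nth lessThan_atLeast0)
  have "homogeneous ((\<Sum>a<length I. 2 * (I ! a) - 1) + ((\<Sum>a<length J. 2 * (J ! a) - 2) + (\<Sum>a<length K. 2 * (K ! a) - 2)))
    (basis_poly n t)"
    unfolding t basis_poly_def prod.case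
    by (intro homogeneous_mult homogeneous_prod homogeneous_vH homogeneous_wH homogeneous_xi_half)
       (simp_all add: pos[unfolded One_nat_def] posJ[unfolded One_nat_def] posK[unfolded One_nat_def])
  hence "homogeneous (triple_degree t) (basis_poly n t)"
    unfolding sl[of "\<lambda>i. 2 * i - 1"] sl[of "\<lambda>i. 2 * i - 2"] by (simp add: t triple_degree_def add.assoc)
  thus ?thesis unfolding t basis_elem_eq_alt by (rule homogeneous_alt)
qed

text \<open>The homogeneity equation is compared coefficientwise in the X; the monomial belonging to
  S has degree \<Sum>S.\<close>

lemma peval_coord_scale:
  assumes hom: "homogeneous d P" and P: "P \<in> ext_power n l" and S: "S \<in> subsets N l"
  shows "peval (scale c x) (coord l P S) = c ^ (d + \<Sum>S) * peval x (coord l P S)"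
proof -
  define m where "m = tmon l (subset_enum S)"
  define K where "K = Poly_Mapping.keys P"
  define F where "F = (\<lambda>m. peval (scale c x) (Poly_Mapping.lookup P m)
    - c ^ (d + (\<Sum>i\<in>{1..l}. Poly_Mapping.lookup m i)) * peval x (Poly_Mapping.lookup P m))"
  have fr: "P \<in> poly_frag n {1..l}" using P by (simp add: ext_power_altdef)
  have keys: "Poly_Mapping.keys m \<subseteq> {1..l}" if "m \<in> K" for m
    using that fr by (auto simp: K_def poly_frag_def)
  have Xe: "Xeval X y P = (\<Sum>m\<in>K. peval y (Poly_Mapping.lookup P m) * (\<Prod>i\<in>{1..l}. X i ^ Poly_Mapping.lookup m i))" for X y
    unfolding Xeval_altdef poly_subst_def K_def[symmetric]
    by (intro sum.cong refl arg_cong2[where f = "(*)"] monomial_eval_superset) (use keys in auto)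
  have "F m = 0" if "m \<in> K" for m
  proof (rule monomials_independent[where A = "{1..l}" and F = K and e = Poly_Mapping.lookup and c = F, OF _ _ _ _ that])
    fix s t assume st: "s \<in> K" "t \<in> K" "\<And>i. i \<in> {1..l} \<Longrightarrow> Poly_Mapping.lookup s i = Poly_Mapping.lookup t i"
    show "s = t"
    proof (rule poly_mapping_eqI)
      fix i
      show "Poly_Mapping.lookup s i = Poly_Mapping.lookup t i"
      proof (cases "i \<in> {1..l}")
        case False
        hence "i \<notin> Poly_Mapping.keys s" "i \<notin> Poly_Mapping.keys t" using keys st by blast+
        thus ?thesis by (simp add: in_keys_iff)
      qed (rule st)
    qed
  next
    fix X
    have "Xeval X (scale c x) P - c ^ d * Xeval (scale c X) x P = 0"
      using hom by (simp add: homogeneous_def)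
    moreover have "Xeval X (scale c x) P - c ^ d * Xeval (scale c X) x P = (\<Sum>m\<in>K. F m * (\<Prod>i\<in>{1..l}. X i ^ Poly_Mapping.lookup m i))"
      unfolding Xe sum_distrib_left sum_subtractf[symmetric] F_def
      by (intro sum.cong refl) (simp add: power_mult_distrib prod.distrib power_add power_sum left_diff_distrib)
    ultimately show "(\<Sum>m\<in>K. F m * (\<Prod>i\<in>{1..l}. X i ^ Poly_Mapping.lookup m i)) = 0" by simp
  qed (simp_all add: K_def)
  moreover have "F m = 0" if "m \<notin> K" for m
    using that by (simp add: F_def K_def in_keys_iff)
  ultimately have "F m = 0" by blast
  moreover have "(\<Sum>i\<in>{1..l}. Poly_Mapping.lookup m i) = \<Sum>S"
  proof -
    have "finite S" "card S = l" using S finite_subset[of S "{..<N}"] by (auto simp: subsets_def)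
    from sum.reindex_bij_betw[OF bij_betw_subset_enum[OF this], of "\<lambda>i. i"]
    show ?thesis by (simp add: m_def lookup_tmon)
  qed
  ultimately show ?thesis by (simp add: F_def coord_def m_def)
qed

text \<open>Every Leibniz term has the same degree, because a permutation only rearranges the row
  weights.\<close>

lemma peval_det_scale:
  assumes A: "A \<in> carrier_mat M M"
    and entries: "\<And>i j. i < M \<Longrightarrow> j < M \<Longrightarrow> peval (scale c x) (A $$ (i, j)) = c ^ (d i + e j) * peval x (A $$ (i, j))"
  shows "peval (scale c x) (det A) = c ^ ((\<Sum>i<M. d i) + (\<Sum>j<M. e j)) * peval x (det A)"
  unfolding det_col[OF A] peval.hom_sum sum_distrib_left
proof (intro sum.cong refl)
  fix p assume "p \<in> {p. p permutes {0..<M}}"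
  hence p: "p permutes {..<M}" by (simp add: lessThan_atLeast0)
  have "(\<Prod>j<M. peval (scale c x) (A $$ (p j, j))) = (\<Prod>j<M. c ^ (d (p j) + e j) * peval x (A $$ (p j, j)))"
    using permutes_in_image[OF p] by (intro prod.cong refl entries) auto
  also have "\<dots> = c ^ (\<Sum>j<M. d (p j) + e j) * (\<Prod>j<M. peval x (A $$ (p j, j)))"
    by (simp add: prod.distrib power_sum)
  also have "(\<Sum>j<M. d (p j) + e j) = (\<Sum>i<M. d i) + (\<Sum>j<M. e j)"
    using sum.permute[OF p, of d] by (simp add: sum.distrib o_def)
  finally show "peval (scale c x) (signof p * (\<Prod>j<M. A $$ (p j, j)))
      = c ^ ((\<Sum>i<M. d i) + (\<Sum>j<M. e j)) * peval x (signof p * (\<Prod>j<M. A $$ (p j, j)))"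
    by (simp add: peval.hom_mult peval.hom_prod peval.hom_signof mult.left_commute)
qed

lemma card_var_pairs: "card (var_pairs (2 * n)) = n * (2 * n - 1)"
proof -
  have "2 * card (var_pairs N) = N * (N - 1)" for N
  proof (induction N)
    case 0
    have "var_pairs 0 = {}" by (auto simp: var_pairs_def)
    thus ?case by simp
  next
    case (Suc N)
    have "var_pairs (Suc N) = var_pairs N \<union> (\<lambda>i. (i, Suc N)) ` {1..N}"
      by (auto simp: var_pairs_def le_Suc_eq)
    moreover have "var_pairs N \<inter> (\<lambda>i. (i, Suc N)) ` {1..N} = {}" by (auto simp: var_pairs_def)
    moreover have "card ((\<lambda>i. (i, Suc N)) ` {1..N}) = N" by (subst card_image) (auto simp: inj_on_def)
    ultimately have "card (var_pairs (Suc N)) = card (var_pairs N) + N" by (simp add: card_Un_disjoint)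
    thus ?case using Suc by (cases N) simp_all
  qed
  from this[of "2 * n"] show ?thesis by simp
qed

lemma peval_sum_prod_scale: "peval (scale c x) (sum_prod N) = c ^ card (var_pairs N) * peval x (sum_prod N)"
proof -
  have "peval (scale c x) (sum_prod N) = (\<Prod>p\<in>var_pairs N. c * (x (fst p) + x (snd p)))"
    by (simp add: sum_prod_def peval.hom_prod case_prod_beta peval.hom_add distrib_left)
  also have "\<dots> = c ^ card (var_pairs N) * peval x (sum_prod N)"
    by (simp add: prod.distrib sum_prod_def peval.hom_prod case_prod_beta peval.hom_add)
  finally show ?thesis .
qed

text \<open>Where p does not vanish, g is constant on the punctured line through the origin and, by
  continuity, equal to its value at the origin. Multiplication by p extends this to all
  points.\<close>

lemma quotient_of_equal_degrees_constant:
  assumes p: "p \<noteq> 0" and pg: "\<And>c x. peval (scale c x) p = c ^ d * peval x p"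
    and q: "\<And>c x. peval (scale c x) (p * g) = c ^ d * peval x (p * g)"
  shows "g = Const (peval (\<lambda>_. 0) g)"
proof -
  have "peval x g = peval (\<lambda>_. 0) g" if px: "peval x p \<noteq> 0" for x
  proof -
    have const: "peval (scale c x) g = peval x g" if "c \<noteq> 0" for c
      using q[of c x] pg[of c x] px that by (simp add: peval.hom_mult)
    have "((\<lambda>c. peval (scale c x) g) \<longlongrightarrow> peval (scale 0 x) g) (at 0)"
      unfolding peval_def poly_subst_def by (intro tendsto_intros)
    moreover have "((\<lambda>c. peval (scale c x) g) \<longlongrightarrow> peval x g) (at 0)"
      by (rule tendsto_eventually) (simp add: eventually_at_filter const)
    ultimately have "peval (scale 0 x) g = peval x g"
      by (intro tendsto_unique[of "at (0::complex)"]) auto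
    thus ?thesis by simp
  qed
  hence "p * (g - Const (peval (\<lambda>_. 0) g)) = 0"
    by (intro mpoly_eq_0_by_peval) (auto simp: peval.hom_mult peval.hom_minus)
  thus ?thesis using p by simp
qed

text \<open>By \<open>degree_identity\<close> the determinant and D^m have the same degree, so their
  quotient is a constant.\<close>

lemma det_basis_eq_const_mult:
  assumes n: "n \<ge> 1" and l: "l \<ge> 1" and Ss: "sum_sorted_subsets (2 * n) l Ss"
    and ts: "distinct ts" "set ts = index_triples n l"
  shows "\<exists>\<kappa>. det (coord_mat l (\<lambda>i. basis_elem n (ts ! i)) Ss)
    = sum_prod (2 * n) ^ (((2 * n) choose l) - ((2 * n - 2) choose l)) * Const \<kappa>"
proof -
  define m where "m = ((2 * n) choose l) - ((2 * n - 2) choose l)"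
  define A where "A = coord_mat l (\<lambda>i. basis_elem n (ts ! i)) Ss"
  have len: "length ts = length Ss"
    using length_sum_sorted_subsets[OF Ss] card_index_triples[of n l] distinct_card[OF ts(1)] ts(2) by simp
  have ti: "ts ! i \<in> index_triples n l" if "i < length Ss" for i
    using nth_mem[of i ts] that by (simp add: len ts(2))
  have U: "basis_elem n (ts ! i) \<in> U_module n l" if "i < length Ss" for i
    by (rule basis_elem_in_U_module[OF n l ti[OF that]])
  have "sum_prod (2 * n) ^ m dvd det A"
    unfolding A_def m_def by (rule sum_prod_power_dvd_det[OF n l Ss U])
  then obtain g where g: "det A = sum_prod (2 * n) ^ m * g" by (elim dvdE)
  have Sj: "Ss ! j \<in> subsets (2 * n) l" if "j < length Ss" for j
    using nth_mem[OF that] Ss by (simp add: sum_sorted_subsets_def)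
  have D: "(\<Sum>i<length Ss. triple_degree (ts ! i)) + (\<Sum>j<length Ss. \<Sum>(Ss ! j)) = m * card (var_pairs (2 * n))"
  proof -
    have "(\<Sum>i<length Ss. triple_degree (ts ! i)) = (\<Sum>t\<in>index_triples n l. triple_degree t)"
      using sum_over_list[OF ts(1), of triple_degree] by (simp add: len ts(2))
    moreover have "(\<Sum>j<length Ss. \<Sum>(Ss ! j)) = (\<Sum>S\<in>subsets (2 * n) l. \<Sum>S)"
      using sum_over_list[of Ss "\<lambda>S. \<Sum>S"] Ss by (simp add: sum_sorted_subsets_def)
    ultimately show ?thesis
      using degree_identity[OF n l] by (simp add: m_def card_var_pairs)
  qed
  have "peval (scale c x) (det A) = c ^ (m * card (var_pairs (2 * n))) * peval x (det A)" for c x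
    unfolding D[symmetric]
  proof (rule peval_det_scale)
    show "A \<in> carrier_mat (length Ss) (length Ss)" by (simp add: A_def)
    fix i j assume ij: "i < length Ss" "j < length Ss"
    have "peval (scale c x) (coord l (basis_elem n (ts ! i)) (Ss ! j))
      = c ^ (triple_degree (ts ! i) + \<Sum>(Ss ! j)) * peval x (coord l (basis_elem n (ts ! i)) (Ss ! j))"
    proof (rule peval_coord_scale[OF homogeneous_basis_elem[OF ti[OF ij(1)]] _ Sj[OF ij(2)]])
      show "basis_elem n (ts ! i) \<in> ext_power n l" using U[OF ij(1)] by (simp add: U_module_def)
    qed
    thus "peval (scale c x) (A $$ (i, j)) = c ^ (triple_degree (ts ! i) + \<Sum>(Ss ! j)) * peval x (A $$ (i, j))"
      using ij by (simp add: A_def coord_mat_def)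
  qed
  moreover have "peval (scale c x) (sum_prod (2 * n) ^ m) = c ^ (m * card (var_pairs (2 * n))) * peval x (sum_prod (2 * n) ^ m)" for c x
    by (simp add: peval.hom_power peval_sum_prod_scale power_mult_distrib power_mult[symmetric] mult.commute)
  ultimately have "g = Const (peval (\<lambda>_. 0) g)"
    by (intro quotient_of_equal_degrees_constant[of "sum_prod (2 * n) ^ m" "m * card (var_pairs (2 * n))"])
       (simp_all add: sum_prod_nonzero g)
  thus ?thesis using g unfolding A_def m_def by metis
qed

section \<open>Evaluation at the roots of the even part\<close>

definition even_part_deriv :: "nat \<Rightarrow> (nat \<Rightarrow> complex) \<Rightarrow> complex \<Rightarrow> complex" where
  "even_part_deriv n x y = (\<Sum>j\<le>n. peval x (elem_sym n (2 * int j)) * (of_nat j * y ^ (j - 1)))"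

text \<open>n simple roots of v_0, as many as its degree in X^2 permits. The nonvanishing of y,
  v_1(y) and v_0'(y) makes the diagonal weights invertible.\<close>

definition root_set :: "nat \<Rightarrow> (nat \<Rightarrow> complex) \<Rightarrow> complex set \<Rightarrow> bool" where
  "root_set n x Y \<longleftrightarrow> finite Y \<and> card Y = n \<and> (\<forall>y\<in>Y. y \<noteq> 0 \<and> even_part n x y = 0
     \<and> vval n x 1 y \<noteq> 0 \<and> even_part_deriv n x y \<noteq> 0)"

lemma even_part_has_derivative: "(even_part n x has_field_derivative even_part_deriv n x y) (at y)"
  unfolding even_part_def[abs_def] even_part_deriv_def
  by (auto intro!: derivative_eq_intros sum.cong simp: mult_ac)

text \<open>At this point the generating function is (1 + z)^(2n), and z \<mapsto> -z separates its
  parts. The point is chosen because the roots of v_0 become explicit.\<close>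

lemma even_part_ones: "2 * even_part n (\<lambda>_. 1) (z ^ 2) = (1 + z) ^ (2 * n) + (1 - z) ^ (2 * n)"
  and odd_part_ones: "2 * (z * vval n (\<lambda>_. 1) 1 (z ^ 2)) = (1 + z) ^ (2 * n) - (1 - z) ^ (2 * n)"
proof -
  define E where "E = even_part n (\<lambda>_. 1) (z ^ 2)"
  define V where "V = z * vval n (\<lambda>_. 1) 1 (z ^ 2)"
  have p: "E + V = (1 + z) ^ (2 * n)"
    using even_part_plus_odd_part[of n "\<lambda>_. 1" z] by (simp add: E_def V_def)
  have m: "E - V = (1 - z) ^ (2 * n)"
    using even_part_plus_odd_part[of n "\<lambda>_. 1" "- z"] by (simp add: E_def V_def)
  show "2 * E = (1 + z) ^ (2 * n) + (1 - z) ^ (2 * n)" "2 * V = (1 + z) ^ (2 * n) - (1 - z) ^ (2 * n)"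
    unfolding p[symmetric] m[symmetric] by simp_all
qed

text \<open>1 + z and 1 - z are cis(\<theta>) / cos(\<theta>) and its conjugate, so the even part is
  cos(2n \<theta>) / cos(\<theta>)^(2n), and 2n \<theta> is an odd multiple of pi / 2.\<close>

lemma even_part_ones_root:
  assumes "n \<ge> 1" "k < n"
  defines "\<theta> \<equiv> (2 * real k + 1) * pi / (4 * real n)"
  defines "z \<equiv> \<i> * complex_of_real (tan \<theta>)"
  shows "0 < \<theta>" "\<theta> < pi / 2" "even_part n (\<lambda>_. 1) (z ^ 2) = 0"
proof -
  show "0 < \<theta>" using assms by (simp add: \<theta>_def)
  have "2 * real k + 1 < 2 * real n" using assms(2) by linarith
  hence "(2 * real k + 1) * pi < 2 * real n * pi" by simp
  thus "\<theta> < pi / 2" using assms by (simp add: \<theta>_def field_simps)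
  hence c: "cos \<theta> \<noteq> 0" using cos_gt_zero_pi[of \<theta>] \<open>0 < \<theta>\<close> by linarith
  have z: "1 + z = cis \<theta> / cos \<theta>" "1 - z = cis (- \<theta>) / cos \<theta>"
    using c by (simp_all add: z_def complex_eq_iff tan_def)
  have c0: "cos (real (2 * n) * \<theta>) = 0"
  proof -
    have "real (2 * n) * \<theta> = (2 * real k + 1) * (pi / 2)" using assms by (simp add: \<theta>_def)
    also have "cos \<dots> = 0" unfolding cos_zero_iff_int by (rule exI[of _ "2 * int k + 1"]) simp
    finally show ?thesis .
  qed
  have "(1 + z) ^ (2 * n) + (1 - z) ^ (2 * n)
      = (cis (real (2 * n) * \<theta>) + cis (- (real (2 * n) * \<theta>))) / complex_of_real (cos \<theta>) ^ (2 * n)"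
    unfolding z power_divide DeMoivre by (simp add: add_divide_distrib)
  also have "cis (real (2 * n) * \<theta>) + cis (- (real (2 * n) * \<theta>)) = 0"
    using c0 by (simp add: complex_eq_iff)
  finally show "even_part n (\<lambda>_. 1) (z ^ 2) = 0"
    using even_part_ones[of n z] by simp
qed

lemma ex_root_set_ones:
  assumes n: "n \<ge> 1"
  shows "\<exists>Y. root_set n (\<lambda>_. 1) Y"
proof -
  define \<theta> where "\<theta> = (\<lambda>k. (2 * real k + 1) * pi / (4 * real n))"
  define z where "z = (\<lambda>k. \<i> * complex_of_real (tan (\<theta> k)))"
  note root = even_part_ones_root[OF n, folded \<theta>_def, folded z_def]
  have root: "0 < \<theta> k" "\<theta> k < pi / 2" "even_part n (\<lambda>_. 1) (z k ^ 2) = 0" if "k < n" for k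
    using even_part_ones_root[OF n that] by (simp_all add: \<theta>_def z_def)
  have tpos: "tan (\<theta> k) > 0" if "k < n" for k using root[OF that] by (intro tan_gt_zero)
  have zsq: "z k ^ 2 = - complex_of_real (tan (\<theta> k) ^ 2)" for k
    by (simp add: z_def power_mult_distrib)
  \<comment> \<open>The squares are -tan(\<theta> k)^2, and tan is positive and increasing on (0, pi
    / 2).\<close>
  have inj: "inj_on (\<lambda>k. z k ^ 2) {..<n}"
  proof (rule linorder_inj_onI')
    fix i j assume ij: "i \<in> {..<n}" "j \<in> {..<n}" "i < j"
    have "\<theta> i < \<theta> j" using ij n by (simp add: \<theta>_def divide_strict_right_mono)
    hence "tan (\<theta> i) < tan (\<theta> j)" using root[of i] root[of j] ij by (intro tan_monotone) auto
    hence "tan (\<theta> i) ^ 2 < tan (\<theta> j) ^ 2" using tpos[of i] ij by (intro power_strict_mono) auto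
    thus "z i ^ 2 \<noteq> z j ^ 2" unfolding zsq neg_equal_iff_equal of_real_eq_iff by linarith
  qed
  have "root_set n (\<lambda>_. 1) ((\<lambda>k. z k ^ 2) ` {..<n})"
    unfolding root_set_def
  proof (intro conjI ballI)
    fix y assume "y \<in> (\<lambda>k. z k ^ 2) ` {..<n}"
    then obtain k where k: "k < n" "y = z k ^ 2" by blast
    have z0: "z k \<noteq> 0" using tpos[OF k(1)] by (simp add: z_def)
    thus "y \<noteq> 0" by (simp add: k(2))
    show y: "even_part n (\<lambda>_. 1) y = 0" using root(3)[OF k(1)] by (simp add: k(2))
    define a b where "a = 1 + z k" and "b = 1 - z k"
    have a0: "a \<noteq> 0" and b0: "b \<noteq> 0" by (simp_all add: a_def b_def z_def complex_eq_iff)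
    have ab: "a ^ (2 * n) + b ^ (2 * n) = 0"
      using even_part_ones[of n "z k"] y by (simp add: a_def b_def k(2))
    have "2 * (z k * vval n (\<lambda>_. 1) 1 (z k ^ 2)) = a ^ (2 * n) - b ^ (2 * n)"
      unfolding a_def b_def by (rule odd_part_ones)
    also have "\<dots> = 2 * a ^ (2 * n)" using ab by (simp add: add_eq_0_iff)
    finally show "vval n (\<lambda>_. 1) 1 y \<noteq> 0" using a0 by (auto simp: k(2))
    define D where "D = even_part_deriv n (\<lambda>_. 1) y"
    have "((\<lambda>w. even_part n (\<lambda>_. 1) (w ^ 2)) has_field_derivative D * (2 * z k)) (at (z k))"
    proof (rule DERIV_chain2[of "even_part n (\<lambda>_. 1)"])
      show "(even_part n (\<lambda>_. 1) has_field_derivative D) (at (z k ^ 2))"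
        using even_part_has_derivative[of n "\<lambda>_. 1" y] by (simp add: D_def k(2))
      show "((\<lambda>w. w ^ 2) has_field_derivative 2 * z k) (at (z k))"
        by (auto intro!: derivative_eq_intros)
    qed
    hence 1: "((\<lambda>w. 2 * even_part n (\<lambda>_. 1) (w ^ 2)) has_field_derivative 2 * (D * (2 * z k))) (at (z k))"
      by (rule DERIV_cmult)
    have 2: "((\<lambda>w. (1 + w) ^ (2 * n) + (1 - w) ^ (2 * n)) has_field_derivative
        of_nat (2 * n) * (a ^ (2 * n - 1) - b ^ (2 * n - 1))) (at (z k))"
      by (auto intro!: derivative_eq_intros simp: a_def b_def algebra_simps)
    have "2 * (D * (2 * z k)) = of_nat (2 * n) * (a ^ (2 * n - 1) - b ^ (2 * n - 1))"
      using 1 2 unfolding even_part_ones by (rule DERIV_unique)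
    \<comment> \<open>A multiple root would give a^(2n-1) = b^(2n-1), hence (a + b) a^(2n-1) = 0 by
      a^(2n) + b^(2n) = 0, although a + b = 2 and a is nonzero.\<close>
    moreover have "a ^ (2 * n - 1) - b ^ (2 * n - 1) \<noteq> 0"
    proof
      assume "a ^ (2 * n - 1) - b ^ (2 * n - 1) = 0"
      hence e: "b ^ (2 * n - 1) = a ^ (2 * n - 1)" by simp
      have sN: "w ^ (2 * n) = w * w ^ (2 * n - 1)" for w :: complex
        using n by (simp flip: power_Suc)
      have "a * a ^ (2 * n - 1) + b * a ^ (2 * n - 1) = 0" using ab unfolding sN e .
      hence "(a + b) * a ^ (2 * n - 1) = 0" by (simp only: distrib_right)
      thus False using a0 by (simp add: a_def b_def)
    qed
    ultimately show "even_part_deriv n (\<lambda>_. 1) y \<noteq> 0" using n unfolding D_def[symmetric] by auto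
  qed (use inj in \<open>simp_all add: card_image\<close>)
  thus ?thesis by blast
qed

text \<open>On slot s either the even part, or the odd part divided by X, is evaluated at X^2 = u s;
  \<open>k div 2\<close> is the resulting exponent in both cases.\<close>

definition site_eval :: "(nat \<Rightarrow> bool) \<Rightarrow> (nat \<Rightarrow> complex) \<Rightarrow> nat \<Rightarrow> nat \<Rightarrow> complex" where
  "site_eval ev u s k = (if even k = ev s then u s ^ (k div 2) else 0)"

lemma mlin_vH: "mlin {a} x (site_eval ev u) (vH n r (Var a)) = (if ev a then vval n x r (u a) else 0)"
  unfolding vH_eq_sum_single mlin_sum mlin_single vval_def
  by (simp add: lookup_single site_eval_def)

lemma mlin_wH: "mlin {a} x (site_eval ev u) (wH n r (Var a)) = (if ev a then 0 else vval n x r (u a))"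
  unfolding wH_eq_sum_single mlin_sum mlin_single vval_def
  by (simp add: lookup_single site_eval_def)

text \<open>All monomials of \<open>xi_half\<close> are odd in X_a and even in X_b, so only this
  parity pattern detects it.\<close>

lemma mlin_xi_half:
  assumes "a \<noteq> b"
  shows "mlin {a, b} x (site_eval ev u) (xi_half n k a b) = (if \<not> ev a \<and> ev b then
    bez (\<lambda>j. peval x (xi_coeff n k j)) (\<lambda>i. peval x (elem_sym n (2 * int i))) n (u a) (u b) else 0)"
proof -
  have single: "mlin {a, b} x (site_eval ev u) (Poly_Mapping.single (Poly_Mapping.single a (Suc (2 * i)) + Poly_Mapping.single b (2 * j)) q)
      = (if \<not> ev a \<and> ev b then peval x q * (u a ^ i * u b ^ j) else 0)" for i j q
    using assms by (simp add: lookup_add lookup_single site_eval_def)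
  show ?thesis
  proof (cases "\<not> ev a \<and> ev b")
    case True
    show ?thesis unfolding xi_half_eq_sum_single mlin_sum bez_def single if_P[OF True] by (simp only: peval.hom_minus peval.hom_mult)
  next
    case False
    show ?thesis unfolding xi_half_eq_sum_single mlin_sum single if_not_P[OF False] by simp
  qed
qed

lemma vval_at_root:
  assumes "root_set n x Y" "y \<in> Y" "r \<ge> 1"
  shows "vval n x r y = vval n x 1 y * inverse y ^ (r - 1)"
  using assms(3)
proof (induction r rule: dec_induct)
  case (step r)
  have y: "y \<noteq> 0" "even_part n x y = 0" using assms by (auto simp: root_set_def)
  have "y * vval n x (Suc r) y = vval n x r y"
    using vval_Suc[OF step.hyps(1), of y n x] y by simp
  hence "vval n x (Suc r) y = vval n x r y * inverse y" using y by (simp add: field_simps)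
  moreover obtain q where "r = Suc q" using step by (cases r) auto
  ultimately show ?case using step.IH by simp
qed simp

text \<open>Diagonal value at a root y of v_0 of the Bezoutian of y v_1(y) and v_0.\<close>

definition pair_weight :: "nat \<Rightarrow> (nat \<Rightarrow> complex) \<Rightarrow> complex \<Rightarrow> complex" where
  "pair_weight n x y = - (y * vval n x 1 y) * even_part_deriv n x y"

text \<open>At two different roots of v_0 both products in the numerator of the Bezoutian vanish. On
  the diagonal \<open>bez_diag\<close> applies, and v_k(y) = v_1(y) y^(1-k) gives the dependence on
  k.\<close>

lemma bez_at_roots:
  assumes "root_set n x Y" "y \<in> Y" "z \<in> Y" "k \<ge> 1"
  shows "bez (\<lambda>j. peval x (xi_coeff n k j)) (\<lambda>i. peval x (elem_sym n (2 * int i))) n y z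
    = (if y = z then pair_weight n x y * inverse y ^ (k - 1) else 0)"
proof (cases "y = z")
  case True
  have "(\<Sum>j\<le>n. peval x (elem_sym n (2 * int j)) * y ^ j) = 0"
    using assms by (auto simp: root_set_def even_part_def)
  moreover have "((\<lambda>y. \<Sum>j\<le>n. peval x (elem_sym n (2 * int j)) * y ^ j) has_field_derivative even_part_deriv n x y) (at y)"
    using even_part_has_derivative[of n x y] unfolding even_part_def[abs_def] .
  ultimately have "bez (\<lambda>j. peval x (xi_coeff n k j)) (\<lambda>i. peval x (elem_sym n (2 * int i))) n y y
      = - (\<Sum>j\<le>n. peval x (xi_coeff n k j) * y ^ j) * even_part_deriv n x y"
    by (rule bez_diag)
  also have "\<dots> = pair_weight n x y * inverse y ^ (k - 1)"
    unfolding sum_xi_coeff vval_at_root[OF assms(1,2,4)] pair_weight_def by simp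
  finally show ?thesis using True by simp
next
  case False
  have "even_part n x y = 0" "even_part n x z = 0" using assms by (auto simp: root_set_def)
  hence "(y - z) * bez (\<lambda>j. peval x (xi_coeff n k j)) (\<lambda>i. peval x (elem_sym n (2 * int i))) n y z = 0"
    unfolding diff_mult_bez even_part_def by simp
  thus ?thesis using False by simp
qed

text \<open>The value of \<open>basis_poly\<close> under site functionals at roots of v_0, see
  \<open>mlin_basis_poly\<close>. Its zeros are selection rules: v needs an even slot, w an odd one,
  xi an odd and an even slot at the same root.\<close>

definition slot_weight :: "nat \<Rightarrow> (nat \<Rightarrow> complex) \<Rightarrow> nat list \<times> nat list \<times> nat list
    \<Rightarrow> (nat \<Rightarrow> bool) \<Rightarrow> (nat \<Rightarrow> complex) \<Rightarrow> complex" where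
  "slot_weight n x = (\<lambda>(I, J, K) ev u.
     (\<Prod>a<length I. if ev (Suc a) then vval n x 1 (u (Suc a)) * inverse (u (Suc a)) ^ (I ! a - 1) else 0)
     * ((\<Prod>b<length J. if \<not> ev (Suc (length I + b)) then vval n x 1 (u (Suc (length I + b)))
          * inverse (u (Suc (length I + b))) ^ (J ! b - 1) else 0)
     * (\<Prod>c<length K. if \<not> ev (Suc (length I + length J + 2 * c)) \<and> ev (Suc (Suc (length I + length J + 2 * c)))
          \<and> u (Suc (length I + length J + 2 * c)) = u (Suc (Suc (length I + length J + 2 * c)))
        then pair_weight n x (u (Suc (Suc (length I + length J + 2 * c))))
          * inverse (u (Suc (Suc (length I + length J + 2 * c)))) ^ (K ! c - 1) else 0)))"

lemma mlin_basis_poly: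
  assumes Y: "root_set n x Y" and u: "\<And>s. s \<in> {1..length I + length J + 2 * length K} \<Longrightarrow> u s \<in> Y"
    and pos: "\<forall>i\<in>set I. 1 \<le> i" "\<forall>j\<in>set J. 1 \<le> j" "\<forall>k\<in>set K. 1 \<le> k"
  shows "mlin {1..length I + length J + 2 * length K} x (site_eval ev u) (basis_poly n (I, J, K))
    = slot_weight n x (I, J, K) ev u"
proof -
  let ?p = "\<lambda>c. Suc (length I + length J + 2 * c)" and ?q = "\<lambda>c. Suc (Suc (length I + length J + 2 * c))"
  let ?A = "\<Union>a\<in>{..<length I}. {Suc a}" and ?B = "\<Union>b\<in>{..<length J}. {Suc (length I + b)}"
  let ?C = "\<Union>c\<in>{..<length K}. {?p c, ?q c}"
  let ?v = "\<Prod>a<length I. vH n (I ! a) (Var (Suc a))"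
  let ?w = "\<Prod>b<length J. wH n (J ! b) (Var (Suc (length I + b)))"
  let ?x = "\<Prod>c<length K. xi_half n (K ! c) (?p c) (?q c)"
  have set_eq: "{1..length I + length J + 2 * length K} = ?A \<union> (?B \<union> ?C)"
  proof
    show "{1..length I + length J + 2 * length K} \<subseteq> ?A \<union> (?B \<union> ?C)"
    proof
      fix s assume s: "s \<in> {1..length I + length J + 2 * length K}"
      consider "s \<le> length I" | "length I < s" "s \<le> length I + length J" | "length I + length J < s" by linarith
      thus "s \<in> ?A \<union> (?B \<union> ?C)"
      proof cases
        case 1
        hence "s - 1 < length I" "s = Suc (s - 1)" using s by auto
        thus ?thesis by blast
      next
        case 2
        hence "s - length I - 1 < length J" "s = Suc (length I + (s - length I - 1))" by auto
        thus ?thesis by blast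
      next
        case 3
        define c where "c = (s - Suc (length I + length J)) div 2"
        have "s = ?p c \<or> s = ?q c" "c < length K" using 3 s unfolding c_def by auto
        thus ?thesis by blast
      qed
    qed
  qed auto
  have disjC: "{?p c, ?q c} \<inter> {?p d, ?q d} = {}" if "c \<noteq> d" for c d
  proof -
    have "2 * c \<noteq> 2 * d" "2 * c \<noteq> Suc (2 * d)" "Suc (2 * c) \<noteq> 2 * d" using that by presburger+
    thus ?thesis by auto
  qed
  have vars: "poly_vars (vH n r (Var a)) \<subseteq> {a}" "poly_vars (wH n r (Var a)) \<subseteq> {a}"
    "a \<noteq> b \<Longrightarrow> poly_vars (xi_half n r a b) \<subseteq> {a, b}" for r a b
    by (rule poly_frag_vars, rule vH_poly_frag, rule poly_frag_vars, rule wH_poly_frag,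
        rule poly_frag_vars, erule xi_half_poly_frag)
  have vv: "poly_vars ?v \<subseteq> ?A" using vars(1) by (intro poly_vars_prod_subset) blast
  have wv: "poly_vars ?w \<subseteq> ?B" using vars(2) by (intro poly_vars_prod_subset) blast
  have xv: "poly_vars ?x \<subseteq> ?C"
  proof (rule poly_vars_prod_subset)
    fix c assume "c \<in> {..<length K}"
    moreover have "poly_vars (xi_half n (K ! c) (?p c) (?q c)) \<subseteq> {?p c, ?q c}" by (rule vars(3)) simp
    ultimately show "poly_vars (xi_half n (K ! c) (?p c) (?q c)) \<subseteq> ?C" by blast
  qed
  have uA: "u (Suc a) \<in> Y" if "a < length I" for a using that by (intro u) simp
  have uB: "u (Suc (length I + b)) \<in> Y" if "b < length J" for b using that by (intro u) simp
  have uC: "u (?p c) \<in> Y" "u (?q c) \<in> Y" if "c < length K" for c using that by (auto intro!: u)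
  have 1: "mlin ?A x (site_eval ev u) ?v
      = (\<Prod>a<length I. if ev (Suc a) then vval n x 1 (u (Suc a)) * inverse (u (Suc a)) ^ (I ! a - 1) else 0)"
  proof -
    have "mlin ?A x (site_eval ev u) ?v = (\<Prod>a<length I. mlin {Suc a} x (site_eval ev u) (vH n (I ! a) (Var (Suc a))))"
      by (rule mlin_prod) (use vars(1) in auto)
    also have "\<dots> = (\<Prod>a<length I. if ev (Suc a) then vval n x 1 (u (Suc a)) * inverse (u (Suc a)) ^ (I ! a - 1) else 0)"
    proof (intro prod.cong refl)
      fix a assume "a \<in> {..<length I}"
      hence "u (Suc a) \<in> Y" "I ! a \<ge> 1" using uA pos(1) nth_mem by auto
      from vval_at_root[OF Y this] show "mlin {Suc a} x (site_eval ev u) (vH n (I ! a) (Var (Suc a)))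
        = (if ev (Suc a) then vval n x 1 (u (Suc a)) * inverse (u (Suc a)) ^ (I ! a - 1) else 0)"
        unfolding mlin_vH by (simp only:)
    qed
    finally show ?thesis .
  qed
  have 2: "mlin ?B x (site_eval ev u) ?w = (\<Prod>b<length J. if \<not> ev (Suc (length I + b)) then vval n x 1 (u (Suc (length I + b)))
          * inverse (u (Suc (length I + b))) ^ (J ! b - 1) else 0)"
  proof -
    have "mlin ?B x (site_eval ev u) ?w = (\<Prod>b<length J. mlin {Suc (length I + b)} x (site_eval ev u) (wH n (J ! b) (Var (Suc (length I + b)))))"
      by (rule mlin_prod) (use vars(2) in auto)
    also have "\<dots> = (\<Prod>b<length J. if \<not> ev (Suc (length I + b)) then vval n x 1 (u (Suc (length I + b)))
          * inverse (u (Suc (length I + b))) ^ (J ! b - 1) else 0)"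
    proof (intro prod.cong refl)
      fix b assume "b \<in> {..<length J}"
      hence "u (Suc (length I + b)) \<in> Y" "J ! b \<ge> 1" using uB pos(2) nth_mem by auto
      from vval_at_root[OF Y this] show "mlin {Suc (length I + b)} x (site_eval ev u) (wH n (J ! b) (Var (Suc (length I + b))))
        = (if \<not> ev (Suc (length I + b)) then vval n x 1 (u (Suc (length I + b)))
          * inverse (u (Suc (length I + b))) ^ (J ! b - 1) else 0)"
        unfolding mlin_wH by (simp only: if_not_P if_P not_not if_cancel split: if_split) blast
    qed
    finally show ?thesis .
  qed
  have 3: "mlin ?C x (site_eval ev u) ?x = (\<Prod>c<length K. if \<not> ev (?p c) \<and> ev (?q c) \<and> u (?p c) = u (?q c)
        then pair_weight n x (u (?q c)) * inverse (u (?q c)) ^ (K ! c - 1) else 0)"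
  proof -
    have "mlin ?C x (site_eval ev u) ?x = (\<Prod>c<length K. mlin {?p c, ?q c} x (site_eval ev u) (xi_half n (K ! c) (?p c) (?q c)))"
      by (rule mlin_prod) (simp, simp, rule vars(3), simp, rule disjC)
    also have "\<dots> = (\<Prod>c<length K. if \<not> ev (?p c) \<and> ev (?q c) \<and> u (?p c) = u (?q c)
        then pair_weight n x (u (?q c)) * inverse (u (?q c)) ^ (K ! c - 1) else 0)"
    proof (intro prod.cong refl)
      fix c assume "c \<in> {..<length K}"
      hence c: "u (?p c) \<in> Y" "u (?q c) \<in> Y" "K ! c \<ge> 1" using uC pos(3) nth_mem by auto
      have "?p c \<noteq> ?q c" by simp
      from mlin_xi_half[OF this, of x ev u n "K ! c"] bez_at_roots[OF Y c]
      show "mlin {?p c, ?q c} x (site_eval ev u) (xi_half n (K ! c) (?p c) (?q c))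
        = (if \<not> ev (?p c) \<and> ev (?q c) \<and> u (?p c) = u (?q c)
        then pair_weight n x (u (?q c)) * inverse (u (?q c)) ^ (K ! c - 1) else 0)"
        by (simp split del: if_split cong: if_cong) (auto split: if_split)
    qed
    finally show ?thesis .
  qed
  have "mlin (?A \<union> (?B \<union> ?C)) x (site_eval ev u) (?v * (?w * ?x))
      = mlin ?A x (site_eval ev u) ?v * mlin (?B \<union> ?C) x (site_eval ev u) (?w * ?x)"
  proof (rule mlin_mult[OF _ _ _ vv])
    show "poly_vars (?w * ?x) \<subseteq> ?B \<union> ?C"
      by (rule order_trans[OF poly_vars_mult Un_mono[OF wv xv]])
  qed auto
  also have "mlin (?B \<union> ?C) x (site_eval ev u) (?w * ?x) = mlin ?B x (site_eval ev u) ?w * mlin ?C x (site_eval ev u) ?x"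
    by (rule mlin_mult[OF _ _ _ wv xv]) auto
  finally show ?thesis
    unfolding set_eq basis_poly_def slot_weight_def prod.case 1 2 3 .
qed

section \<open>Linear independence at a single point\<close>

text \<open>The bound is put on coefficients instead of \<open>degree\<close>, so that k = 0 means
  the zero function.\<close>

definition poly_lt :: "nat \<Rightarrow> (complex \<Rightarrow> complex) \<Rightarrow> bool" where
  "poly_lt k h \<longleftrightarrow> (\<exists>p. (\<forall>z. h z = poly p z) \<and> (\<forall>i\<ge>k. coeff p i = 0))"

lemma poly_lt_monom: "e < k \<Longrightarrow> poly_lt k (\<lambda>z. c * z ^ e)"
  unfolding poly_lt_def by (rule exI[of _ "monom c e"]) (simp add: poly_monom)

lemma poly_lt_sum:
  assumes "\<And>a. a \<in> A \<Longrightarrow> poly_lt k (h a)"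
  shows "poly_lt k (\<lambda>z. \<Sum>a\<in>A. h a z)"
proof -
  from assms obtain p where p: "\<And>a. a \<in> A \<Longrightarrow> (\<forall>z. h a z = poly (p a) z) \<and> (\<forall>i\<ge>k. coeff (p a) i = 0)"
    unfolding poly_lt_def by metis
  show ?thesis
    unfolding poly_lt_def using p by (intro exI[of _ "\<Sum>a\<in>A. p a"]) (simp add: poly_sum coeff_sum)
qed

text \<open>Coordinates outside U are arbitrary. U is shrunk step by step, and for the empty set the
  property says that f is zero.\<close>

definition vanishes_at_sites :: "complex set \<Rightarrow> ((nat \<Rightarrow> complex) \<Rightarrow> complex) \<Rightarrow> nat set \<Rightarrow> bool" where
  "vanishes_at_sites Y f U \<longleftrightarrow> (\<forall>Z. inj_on Z U \<longrightarrow> Z ` U \<subseteq> Y \<longrightarrow> f Z = 0)"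

text \<open>Multiplying by linear factors makes the function vanish at all points of \<open>Y\<close> in the variable
  \<open>d\<close>, and the degree bound still forces it to be zero.\<close>

lemma free_variable:
  assumes Y: "finite Y" "card Y = n" and U: "finite U" "d \<in> U" "C \<subseteq> U - {d}"
    and deg: "\<And>Z. poly_lt k (\<lambda>z. f (Z(d := z)))" and card: "k + card C \<le> n"
    and coinc: "\<And>Z r. r \<in> U - {d} - C \<Longrightarrow> Z r = Z d \<Longrightarrow> f Z = 0"
    and van: "vanishes_at_sites Y f U"
  shows "vanishes_at_sites Y f (U - {d})"
  unfolding vanishes_at_sites_def
proof (intro allI impI)
  fix Z assume Z: "inj_on Z (U - {d})" "Z ` (U - {d}) \<subseteq> Y"
  obtain p where p: "\<And>z. f (Z(d := z)) = poly p z" "\<And>i. i \<ge> k \<Longrightarrow> coeff p i = 0"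
    using deg[of Z] unfolding poly_lt_def by blast
  define L where "L = (\<Prod>r\<in>C. [:- Z r, 1:])"
  have finC: "finite C" using U finite_subset by blast
  have L0: "L \<noteq> 0" unfolding L_def using finC by simp
  have zero: "poly (p * L) y = 0" if y: "y \<in> Y" for y
  proof -
    \<comment> \<open>A value from Y meets a coordinate in C, where L vanishes, or another
      coordinate of U, where f does, or it is new and \<open>van\<close> applies.\<close>
    consider r where "r \<in> C" "Z r = y" | r where "r \<in> U - {d} - C" "Z r = y" | "y \<notin> Z ` (U - {d})"
      using U(3) by blast
    thus ?thesis
    proof cases
      case 1
      hence "poly L y = 0" unfolding L_def poly_prod using finC by (intro prod_zero) auto
      thus ?thesis by simp
    next
      case 2
      hence "f (Z(d := y)) = 0" by (intro coinc[of r]) auto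
      thus ?thesis by (simp add: p)
    next
      case 3
      have ins: "U = insert d (U - {d})" using U(2) by blast
      have eq: "(Z(d := y)) ` (U - {d}) = Z ` (U - {d})" by (rule image_cong) auto
      have "inj_on (Z(d := y)) (insert d (U - {d}))"
        unfolding inj_on_insert using Z(1) 3 eq by (auto simp: inj_on_def)
      moreover have "(Z(d := y)) ` insert d (U - {d}) \<subseteq> Y" using Z(2) y eq by auto
      ultimately have "f (Z(d := y)) = 0" using van ins unfolding vanishes_at_sites_def by metis
      thus ?thesis by (simp add: p)
    qed
  qed
  have "p = 0"
  proof (rule ccontr)
    assume p0: "p \<noteq> 0"
    have "degree p < k" using p(2) p0 leading_coeff_0_iff not_le by blast
    moreover have "degree L = card C" unfolding L_def by (subst degree_prod_eq_sum_degree) auto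
    ultimately have "degree (p * L) < n" using p0 L0 card by (simp add: degree_mult_eq)
    moreover have "card Y \<le> card {y. poly (p * L) y = 0}"
      using zero p0 L0 by (intro card_mono poly_roots_finite) auto
    moreover have "card {y. poly (p * L) y = 0} \<le> degree (p * L)"
      using p0 L0 by (intro card_poly_roots_bound) simp
    ultimately show False using Y by simp
  qed
  thus "f Z = 0" using p(1)[of "Z d"] by simp
qed

lemma free_variables:
  assumes "finite D" "U \<inter> D = {}" "vanishes_at_sites Y f (U \<union> D)"
    and "\<And>d U'. d \<in> D \<Longrightarrow> d \<in> U' \<Longrightarrow> U \<subseteq> U' \<Longrightarrow> U' \<subseteq> U \<union> D \<Longrightarrow> vanishes_at_sites Y f U' \<Longrightarrow> vanishes_at_sites Y f (U' - {d})"
  shows "vanishes_at_sites Y f U"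
  using assms
proof (induction D rule: finite_induct)
  case (insert d D)
  have "vanishes_at_sites Y f (U \<union> insert d D - {d})"
    by (rule insert.prems(3)) (use insert.prems in auto)
  moreover have "U \<union> insert d D - {d} = U \<union> D" using insert by auto
  ultimately have "vanishes_at_sites Y f (U \<union> D)" by simp
  thus ?case
  proof (rule insert.IH[rotated])
    show "U \<inter> D = {}" using insert.prems by auto
    show "vanishes_at_sites Y f (U' - {d'})"
      if "d' \<in> D" "d' \<in> U'" "U \<subseteq> U'" "U' \<subseteq> U \<union> D" "vanishes_at_sites Y f U'" for d' U'
      by (rule insert.prems(3)) (use that in auto)
  qed
qed simp

text \<open>Here the index bounds enter. W is freed first: coincidences within W kill f, and each of
  the card V + card Q other coordinates costs one linear factor, which the degree bound on W just
  allows. Coincidences within Q do not kill f, so there all remaining coordinates cost a factor; as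
  the freed one is itself among card V + card Q, the bound for Q may be larger by one. V comes last
  and costs no factor.\<close>

lemma vanishes_everywhere:
  assumes Y: "finite Y" "card Y = n" and fin: "finite V" "finite W" "finite Q"
    and disj: "V \<inter> W = {}" "V \<inter> Q = {}" "W \<inter> Q = {}" and le: "card V + card Q \<le> n"
    and coV: "\<And>Z a b. a \<in> V \<Longrightarrow> b \<in> V \<Longrightarrow> a \<noteq> b \<Longrightarrow> Z a = Z b \<Longrightarrow> f Z = 0"
    and coW: "\<And>Z a b. a \<in> W \<Longrightarrow> b \<in> W \<Longrightarrow> a \<noteq> b \<Longrightarrow> Z a = Z b \<Longrightarrow> f Z = 0"
    and dV: "\<And>Z d. d \<in> V \<Longrightarrow> poly_lt n (\<lambda>z. f (Z(d := z)))"
    and dW: "\<And>Z d. d \<in> W \<Longrightarrow> poly_lt (n - (card V + card Q)) (\<lambda>z. f (Z(d := z)))"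
    and dQ: "\<And>Z d. d \<in> Q \<Longrightarrow> poly_lt (n + 1 - (card V + card Q)) (\<lambda>z. f (Z(d := z)))"
    and van: "vanishes_at_sites Y f (V \<union> Q \<union> W)"
  shows "f Z = 0"
proof -
  have VQ: "card (V \<union> Q) = card V + card Q" using fin disj by (simp add: card_Un_disjoint)
  have "vanishes_at_sites Y f (V \<union> Q)"
  proof (rule free_variables[OF fin(2) _ van])
    fix d U' assume A: "d \<in> W" "d \<in> U'" "V \<union> Q \<subseteq> U'" "U' \<subseteq> V \<union> Q \<union> W" "vanishes_at_sites Y f U'"
    show "vanishes_at_sites Y f (U' - {d})"
    proof (rule free_variable[OF Y _ A(2) _ dW[OF A(1)] _ _ A(5), where C = "V \<union> Q"])
      show "finite U'" using A(4) fin finite_subset by blast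
      show "V \<union> Q \<subseteq> U' - {d}" using A disj by blast
      show "n - (card V + card Q) + card (V \<union> Q) \<le> n" using le VQ by simp
      show "f Z = 0" if "r \<in> U' - {d} - (V \<union> Q)" "Z r = Z d" for Z r
        using that A by (intro coW[of r d]) auto
    qed
  qed (use disj in auto)
  hence "vanishes_at_sites Y f V"
  proof (rule free_variables[OF fin(3) disj(2)])
    fix d U' assume A: "d \<in> Q" "d \<in> U'" "V \<subseteq> U'" "U' \<subseteq> V \<union> Q" "vanishes_at_sites Y f U'"
    show "vanishes_at_sites Y f (U' - {d})"
    proof (rule free_variable[OF Y _ A(2) _ dQ[OF A(1)] _ _ A(5), where C = "U' - {d}"])
      show finU: "finite U'" using A(4) fin finite_subset by blast
      have "card U' \<le> card V + card Q" unfolding VQ[symmetric] using A(4) fin by (intro card_mono) auto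
      moreover have "card (U' - {d}) = card U' - 1" "card U' > 0"
        using A(2) finU card_gt_0_iff by auto
      ultimately show "n + 1 - (card V + card Q) + card (U' - {d}) \<le> n" using le by linarith
    qed auto
  qed
  hence "vanishes_at_sites Y f ({} \<union> V)" by simp
  hence "vanishes_at_sites Y f {}"
  proof (rule free_variables[OF fin(1), rotated])
    fix d U' assume A: "d \<in> V" "d \<in> U'" "{} \<subseteq> U'" "U' \<subseteq> {} \<union> V" "vanishes_at_sites Y f U'"
    show "vanishes_at_sites Y f (U' - {d})"
    proof (rule free_variable[OF Y _ A(2) _ dV[OF A(1)] _ _ A(5), where C = "{}"])
      show "finite U'" using A(4) fin finite_subset by blast
      show "f Z = 0" if "r \<in> U' - {d} - {}" "Z r = Z d" for Z r
        using that A by (intro coV[of r d]) auto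
    qed auto
  qed simp
  thus ?thesis by (simp add: vanishes_at_sites_def)
qed

text \<open>The slots \<open>1, \<dots>, l\<close> of $v_I \wedge w_J \wedge \xi_K$: \<open>V\<close> and \<open>W\<close> are those of $v_I$ and $w_J$,
  and the \<open>c\<close>-th factor of $\xi_K$ occupies \<open>p c\<close> and \<open>q c\<close>.\<close>

locale slots =
  fixes l1 l2 m :: nat
begin

definition "V = {1..l1}"
definition "W = {l1 + 1..l1 + l2}"
definition "p c = Suc (l1 + l2 + 2 * c)"
definition "q c = Suc (Suc (l1 + l2 + 2 * c))"
definition "P = p ` {..<m}"
definition "Q = q ` {..<m}"
definition "l = l1 + l2 + 2 * m"

lemma slots_eq: "{1..l} = V \<union> W \<union> P \<union> Q"
proof
  show "{1..l} \<subseteq> V \<union> W \<union> P \<union> Q"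
  proof
    fix s assume s: "s \<in> {1..l}"
    show "s \<in> V \<union> W \<union> P \<union> Q"
    proof (cases "s \<le> l1 + l2")
      case True
      thus ?thesis using s by (auto simp: V_def W_def)
    next
      case False
      define c where "c = (s - Suc (l1 + l2)) div 2"
      have "s = p c \<or> s = q c" "c < m" using False s unfolding c_def p_def q_def l_def by auto
      thus ?thesis by (auto simp: P_def Q_def)
    qed
  qed
qed (auto simp: V_def W_def P_def Q_def p_def q_def l_def)

lemma inj_q: "q c = q d \<longleftrightarrow> c = d"
  by (auto simp: p_def q_def)

lemma p_neq_q: "p c \<noteq> q d"
  unfolding p_def q_def by presburger

lemma disjoint_slots: "V \<inter> W = {}" "V \<inter> P = {}" "V \<inter> Q = {}" "W \<inter> P = {}" "W \<inter> Q = {}" "P \<inter> Q = {}"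
  using p_neq_q by (auto simp: V_def W_def P_def Q_def p_def q_def)

lemma P_E: assumes "s \<in> P" obtains d where "d < m" "s = p d"
  using assms unfolding P_def by blast

lemma Q_E: assumes "s \<in> Q" obtains d where "d < m" "s = q d"
  using assms unfolding Q_def by blast

lemma slot_notin:
  "s \<in> V \<Longrightarrow> s \<notin> W \<and> s \<notin> P \<and> s \<notin> Q" "s \<in> W \<Longrightarrow> s \<notin> V \<and> s \<notin> P \<and> s \<notin> Q"
  "s \<in> P \<Longrightarrow> s \<notin> V \<and> s \<notin> W \<and> s \<notin> Q" "s \<in> Q \<Longrightarrow> s \<notin> V \<and> s \<notin> W \<and> s \<notin> P"
  using disjoint_slots unfolding disjoint_iff by metis+

lemma finite_slots [simp]: "finite V" "finite W" "finite P" "finite Q"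
  by (simp_all add: V_def W_def P_def Q_def)

lemma card_slots: "card V = l1" "card W = l2" "card Q = m"
  by (simp_all add: V_def W_def Q_def card_image inj_on_def inj_q)

text \<open>The symmetries of the slot layout: permutations of V, permutations of W, and
  permutations of the pairs (p c, q c). By \<open>slot_weight_nonzeroD\<close> no others
  contribute.\<close>

definition block_perms :: "(nat \<Rightarrow> nat) set" where
  "block_perms = {\<sigma>. \<sigma> permutes {1..l} \<and> \<sigma> ` V \<subseteq> V \<and> \<sigma> ` W \<subseteq> W
     \<and> (\<forall>c<m. \<exists>d<m. \<sigma> (p c) = p d \<and> \<sigma> (q c) = q d)}"

lemma finite_block_perms [simp]: "finite block_perms"
  by (rule finite_subset[OF _ finite_permutations[of "{1..l}"]]) (auto simp: block_perms_def)

lemma block_perms_bij: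
  assumes "\<sigma> \<in> block_perms"
  shows "bij_betw \<sigma> V V" "bij_betw \<sigma> W W" "bij_betw \<sigma> P P" "bij_betw \<sigma> Q Q"
proof -
  have inj: "inj_on \<sigma> A" for A
    using assms by (auto simp: block_perms_def intro: inj_on_subset[OF permutes_inj])
  have sub: "\<sigma> ` V \<subseteq> V" "\<sigma> ` W \<subseteq> W" "\<sigma> ` P \<subseteq> P" "\<sigma> ` Q \<subseteq> Q"
    using assms by (auto simp: block_perms_def P_def Q_def)
  show "bij_betw \<sigma> V V" "bij_betw \<sigma> W W" "bij_betw \<sigma> P P" "bij_betw \<sigma> Q Q"
    using endo_inj_surj[OF _ sub(1) inj] endo_inj_surj[OF _ sub(2) inj] endo_inj_surj[OF _ sub(3) inj]
      endo_inj_surj[OF _ sub(4) inj] inj by (simp_all add: bij_betw_def)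
qed

text \<open>With \<open>\<tau>\<close> exchanging the members of every pair and
  \<open>\<rho>\<close> acting like \<open>\<sigma>\<close> on P only, \<open>\<sigma>\<close> is
  the square of the composition of \<open>\<tau>\<close> and \<open>\<rho>\<close>. So equal entries
  of K reinforce each other instead of cancelling.\<close>

lemma sign_pair_perm:
  assumes "\<sigma> \<in> block_perms" "\<And>s. s \<in> V \<union> W \<Longrightarrow> \<sigma> s = s"
  shows "sign \<sigma> = 1"
proof -
  define \<tau> where "\<tau> = (\<lambda>s. if s \<in> P then Suc s else if s \<in> Q then s - 1 else s)"
  define \<rho> where "\<rho> = (\<lambda>s. if s \<in> P then \<sigma> s else s)"
  have \<sigma>: "\<sigma> permutes {1..l}" "\<And>c. c < m \<Longrightarrow> \<exists>d<m. \<sigma> (p c) = p d \<and> \<sigma> (q c) = q d"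
    using assms(1) by (simp_all add: block_perms_def)
  have pP: "p c \<in> P" "q c \<in> Q" "p c \<notin> Q" "q c \<notin> P" if "c < m" for c
    using that p_neq_q by (auto simp: P_def Q_def) metis
  have \<tau>p: "\<tau> (p c) = q c" "\<tau> (q c) = p c" if "c < m" for c
    using pP[OF that] by (simp_all add: \<tau>_def p_def q_def)
  have \<rho>p: "\<rho> (p c) = \<sigma> (p c)" "\<rho> (q c) = q c" if "c < m" for c
    using pP[OF that] by (simp_all add: \<rho>_def)
  have off: "\<tau> s = s" "\<rho> s = s" if "s \<notin> P \<union> Q" for s using that by (simp_all add: \<tau>_def \<rho>_def)
  have cases: "(\<exists>c<m. s = p c) \<or> (\<exists>c<m. s = q c) \<or> s \<notin> P \<union> Q" for s by (auto simp: P_def Q_def)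
  have \<tau>\<tau>: "\<tau> (\<tau> s) = s" for s using cases[of s] \<tau>p off by metis
  have "bij_betw \<tau> (P \<union> Q) (P \<union> Q)"
  proof (rule bij_betwI[of _ _ _ \<tau>])
    have "\<tau> s \<in> P \<union> Q" if "s \<in> P \<union> Q" for s using cases[of s] \<tau>p pP that by (metis UnI1 UnI2)
    thus "\<tau> \<in> P \<union> Q \<rightarrow> P \<union> Q" "\<tau> \<in> P \<union> Q \<rightarrow> P \<union> Q" by blast+
  qed (simp_all add: \<tau>\<tau>)
  hence "\<tau> permutes P \<union> Q" by (rule bij_imp_permutes) (simp add: off)
  hence \<tau>perm: "permutation \<tau>" by (auto simp: permutation_permutes intro!: exI[of _ "P \<union> Q"])
  have "bij_betw \<rho> P P"
    using block_perms_bij(3)[OF assms(1)] by (rule bij_betw_cong[THEN iffD1, rotated]) (simp add: \<rho>_def)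
  hence "\<rho> permutes P" by (rule bij_imp_permutes) (simp add: \<rho>_def)
  hence \<rho>perm: "permutation \<rho>" by (auto simp: permutation_permutes intro!: exI[of _ P])
  have "\<sigma> s = (\<tau> \<circ> \<rho> \<circ> \<tau> \<circ> \<rho>) s" for s
  proof -
    consider c where "c < m" "s = p c" | c where "c < m" "s = q c" | "s \<notin> P \<union> Q" using cases[of s] by blast
    thus ?thesis
    proof cases
      case 1
      obtain d where "d < m" "\<sigma> (p c) = p d" using \<sigma>(2)[OF 1(1)] by blast
      thus ?thesis using 1 by (simp add: \<tau>p \<rho>p)
    next
      case 2
      obtain d where "d < m" "\<sigma> (p c) = p d" "\<sigma> (q c) = q d" using \<sigma>(2)[OF 2(1)] by blast
      thus ?thesis using 2 by (simp add: \<tau>p \<rho>p)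
    next
      case 3
      have "\<sigma> s = s"
      proof (cases "s \<in> {1..l}")
        case True
        thus ?thesis using 3 slots_eq assms(2) by blast
      qed (use permutes_not_in[OF \<sigma>(1)] in blast)
      thus ?thesis using off[OF 3] by simp
    qed
  qed
  hence "\<sigma> = \<tau> \<circ> \<rho> \<circ> \<tau> \<circ> \<rho>" by blast
  hence "sign \<sigma> = sign \<tau> * sign \<rho> * sign \<tau> * sign \<rho>"
    using \<tau>perm \<rho>perm by (simp add: sign_compose permutation_compose)
  thus ?thesis by (cases \<tau> rule: sign_cases; cases \<rho> rule: sign_cases) simp_all
qed

definition ev :: "nat \<Rightarrow> bool" where "ev s \<longleftrightarrow> s \<in> V \<union> Q"

text \<open>The members of a pair share a site: a slot of P takes that of its partner in Q. With
  distinct sites on V, Q and W, exactly the m sites of Q then occur in both parities.\<close>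

definition rep :: "nat \<Rightarrow> nat" where "rep s = (if s \<in> P then Suc s else s)"

lemma rep_p: "c < m \<Longrightarrow> rep (p c) = q c"
  by (simp add: rep_def P_def) (simp add: p_def q_def)

lemma rep_not_P: "s \<notin> P \<Longrightarrow> rep s = s"
  by (simp add: rep_def)

text \<open>Each xi needs an odd and an even slot at one site, and only the pairs (p d, q d) offer
  this. So K has at most m entries; by m <= length K all pairs are taken, which leaves V to the v
  and W to the w.\<close>

lemma slot_weight_nonzeroD:
  assumes \<sigma>: "\<sigma> permutes {1..l}" and X: "inj_on X (V \<union> Q \<union> W)"
    and len: "length I + length J + 2 * length K = l" and mK: "m \<le> length K"
    and nz: "slot_weight n x (I, J, K) (ev \<circ> \<sigma>) (X \<circ> rep \<circ> \<sigma>) \<noteq> 0"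
  shows "length I = l1 \<and> length J = l2 \<and> length K = m \<and> \<sigma> \<in> block_perms"
proof -
  let ?a = "length I" and ?b = "length J"
  define p' where "p' = (\<lambda>c. Suc (?a + ?b + 2 * c))"
  define q' where "q' = (\<lambda>c. Suc (Suc (?a + ?b + 2 * c)))"
  have prod_nz: "g c \<noteq> 0" if "(\<Prod>c<N. g c) \<noteq> (0::complex)" "c < N" for g c and N :: nat
    using that prod_zero_iff[of "{..<N}" g] by blast
  have 1: "ev (\<sigma> (Suc s))" if "s < ?a" for s
  proof -
    have "(\<Prod>a<?a. if (ev \<circ> \<sigma>) (Suc a) then vval n x 1 ((X \<circ> rep \<circ> \<sigma>) (Suc a)) * inverse ((X \<circ> rep \<circ> \<sigma>) (Suc a)) ^ (I ! a - 1) else 0) \<noteq> 0"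
      using nz unfolding slot_weight_def prod.case by (simp only: mult_eq_0_iff de_Morgan_disj simp_thms)
    from prod_nz[OF this that] show ?thesis by (simp split: if_splits)
  qed
  have 2: "\<not> ev (\<sigma> (Suc (?a + s)))" if "s < ?b" for s
  proof -
    have "(\<Prod>b<?b. if \<not> (ev \<circ> \<sigma>) (Suc (?a + b)) then vval n x 1 ((X \<circ> rep \<circ> \<sigma>) (Suc (?a + b)))
          * inverse ((X \<circ> rep \<circ> \<sigma>) (Suc (?a + b))) ^ (J ! b - 1) else 0) \<noteq> 0"
      using nz unfolding slot_weight_def prod.case by (simp only: mult_eq_0_iff de_Morgan_disj simp_thms)
    from prod_nz[OF this that] show ?thesis by (simp split: if_splits)
  qed
  have 3: "\<not> ev (\<sigma> (p' c)) \<and> ev (\<sigma> (q' c)) \<and> X (rep (\<sigma> (p' c))) = X (rep (\<sigma> (q' c)))" if "c < length K" for c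
  proof -
    have "(\<Prod>c<length K. if \<not> (ev \<circ> \<sigma>) (p' c) \<and> (ev \<circ> \<sigma>) (q' c) \<and> (X \<circ> rep \<circ> \<sigma>) (p' c) = (X \<circ> rep \<circ> \<sigma>) (q' c)
        then pair_weight n x ((X \<circ> rep \<circ> \<sigma>) (q' c)) * inverse ((X \<circ> rep \<circ> \<sigma>) (q' c)) ^ (K ! c - 1) else 0) \<noteq> 0"
      using nz unfolding slot_weight_def prod.case p'_def q'_def by (simp only: mult_eq_0_iff de_Morgan_disj simp_thms)
    from prod_nz[OF this that] show ?thesis by (simp split: if_splits)
  qed
  have inj: "\<sigma> s = \<sigma> t \<longleftrightarrow> s = t" for s t using permutes_inj[OF \<sigma>] by (auto simp: inj_def)
  have mem: "\<sigma> s \<in> V \<union> W \<union> P \<union> Q" if "1 \<le> s" "s \<le> l" for s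
  proof -
    have "\<sigma> s \<in> {1..l}" using permutes_in_image[OF \<sigma>, of s] that by simp
    thus ?thesis by (simp only: slots_eq)
  qed
  have pair: "\<exists>d<m. \<sigma> (p' c) = p d \<and> \<sigma> (q' c) = q d" if c: "c < length K" for c
  proof -
    have range: "1 \<le> p' c" "p' c \<le> l" using c len by (simp_all add: p'_def)
    have sq: "\<sigma> (q' c) \<in> V \<union> Q" using 3[OF c] by (simp add: ev_def)
    have "\<sigma> (p' c) \<notin> V \<union> Q" using 3[OF c] by (simp add: ev_def)
    hence sp: "\<sigma> (p' c) \<in> W \<union> P" using mem[OF range(1,2)] by simp
    have "\<sigma> (q' c) \<notin> P" using sq slot_notin(1,4) by (simp only: Un_iff) metis
    hence rq: "rep (\<sigma> (q' c)) = \<sigma> (q' c)" by (rule rep_not_P)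
    have rpm: "rep (\<sigma> (p' c)) \<in> W \<union> Q"
    proof (cases "\<sigma> (p' c) \<in> P")
      case True
      then obtain d where "d < m" "\<sigma> (p' c) = p d" by (rule P_E)
      hence "rep (\<sigma> (p' c)) = q d" by (simp only: rep_p)
      thus ?thesis using \<open>d < m\<close> by (simp add: Q_def)
    next
      case False
      thus ?thesis using sp rep_not_P[OF False] by simp
    qed
    have "rep (\<sigma> (p' c)) = rep (\<sigma> (q' c))"
    proof (rule inj_onD[OF X])
      show "X (rep (\<sigma> (p' c))) = X (rep (\<sigma> (q' c)))" using 3[OF c] by blast
      show "rep (\<sigma> (p' c)) \<in> V \<union> Q \<union> W" using rpm by blast
      show "rep (\<sigma> (q' c)) \<in> V \<union> Q \<union> W" unfolding rq using sq by blast
    qed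
    hence e: "rep (\<sigma> (p' c)) = \<sigma> (q' c)" by (simp only: rq)
    have "\<sigma> (p' c) \<in> P"
    proof (rule ccontr)
      assume "\<sigma> (p' c) \<notin> P"
      hence "\<sigma> (p' c) = \<sigma> (q' c)" "\<sigma> (p' c) \<in> W" using e rep_not_P[of "\<sigma> (p' c)"] sp by simp_all
      thus False using sq slot_notin(2)[of "\<sigma> (p' c)"] by simp
    qed
    then obtain d where d: "d < m" "\<sigma> (p' c) = p d" by (rule P_E)
    hence "\<sigma> (q' c) = q d" using e rep_p[OF d(1)] by simp
    thus ?thesis using d by blast
  qed
  then obtain D where D: "\<And>c. c < length K \<Longrightarrow> D c < m \<and> \<sigma> (p' c) = p (D c) \<and> \<sigma> (q' c) = q (D c)"
    by metis
  have injD: "inj_on D {..<length K}"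
  proof (rule inj_onI)
    fix c d assume "c \<in> {..<length K}" "d \<in> {..<length K}" "D c = D d"
    hence "\<sigma> (p' c) = \<sigma> (p' d)" using D[of c] D[of d] by simp
    thus "c = d" by (simp add: inj p'_def)
  qed
  have "card {..<length K} \<le> card {..<m}"
    by (rule card_inj_on_le[OF injD]) (use D in auto)
  hence K: "length K = m" using mK by simp
  have surjD: "D ` {..<m} = {..<m}"
    by (rule endo_inj_surj) (use D injD K in auto)
  have Vmem: "\<sigma> s \<in> V" if s: "s \<in> {1..?a}" for s
  proof -
    have "s - 1 < ?a" "Suc (s - 1) = s" using s by auto
    hence "\<sigma> s \<in> V \<union> Q" using 1[of "s - 1"] by (simp add: ev_def)
    moreover have "\<sigma> s \<notin> Q"
    proof
      assume "\<sigma> s \<in> Q"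
      then obtain d where "d < m" "\<sigma> s = q d" by (rule Q_E)
      moreover from \<open>d < m\<close> have "d \<in> D ` {..<m}" by (simp add: surjD)
      then obtain c where "c < m" "d = D c" by auto
      ultimately have "\<sigma> s = \<sigma> (q' c)" using D[of c] K by simp
      hence "s = q' c" by (simp add: inj)
      thus False using s by (simp add: q'_def)
    qed
    ultimately show ?thesis by blast
  qed
  have Wmem: "\<sigma> s \<in> W" if s: "s \<in> {?a + 1..?a + ?b}" for s
  proof -
    have s': "s - ?a - 1 < ?b" "Suc (?a + (s - ?a - 1)) = s" using s by auto
    have "\<sigma> s \<notin> V \<union> Q" using 2[OF s'(1)] unfolding s'(2) by (simp add: ev_def)
    moreover have "\<sigma> s \<in> V \<union> W \<union> P \<union> Q" using s len by (intro mem) simp_all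
    ultimately have "\<sigma> s \<in> W \<union> P" by simp
    moreover have "\<sigma> s \<notin> P"
    proof
      assume "\<sigma> s \<in> P"
      then obtain d where "d < m" "\<sigma> s = p d" by (rule P_E)
      moreover from \<open>d < m\<close> have "d \<in> D ` {..<m}" by (simp add: surjD)
      then obtain c where "c < m" "d = D c" by auto
      ultimately have "\<sigma> s = \<sigma> (p' c)" using D[of c] K by simp
      hence "s = p' c" by (simp add: inj)
      thus False using s by (simp add: p'_def)
    qed
    ultimately show ?thesis by blast
  qed
  have "card {1..?a} \<le> card V"
    by (rule card_inj_on_le[of \<sigma>]) (use Vmem inj in \<open>auto simp: inj_on_def\<close>)
  moreover have "card {?a + 1..?a + ?b} \<le> card W"
    by (rule card_inj_on_le[of \<sigma>]) (use Wmem inj in \<open>auto simp: inj_on_def\<close>)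
  \<comment> \<open>Both lengths are bounded while their sum is fixed, so both bounds are
    attained.\<close>
  ultimately have "?a \<le> l1" "?b \<le> l2" by (simp_all add: card_slots)
  hence ab: "?a = l1" "?b = l2" using len K by (simp_all add: l_def)
  have "\<sigma> \<in> block_perms"
    unfolding block_perms_def
  proof (intro CollectI conjI allI impI)
    show "\<sigma> ` V \<subseteq> V" using Vmem ab by (auto simp: V_def)
    show "\<sigma> ` W \<subseteq> W" using Wmem ab by (auto simp: W_def)
    fix c assume "c < m"
    thus "\<exists>d<m. \<sigma> (p c) = p d \<and> \<sigma> (q c) = q d"
      using pair[of c] K ab by (simp add: p'_def q'_def p_def q_def)
  qed (rule \<sigma>)
  thus ?thesis using ab K by blast
qed

end

section \<open>Recovering sorted lists from matched entries\<close>

lemma strictly_sorted_match: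
  fixes I I' :: "nat list"
  assumes I: "sorted_wrt (<) I" and I': "sorted_wrt (<) I'" and len: "length I = length I'"
    and match: "\<And>a. a < length I \<Longrightarrow> \<pi> a < length I' \<and> I ! a = I' ! \<pi> a"
  shows "I = I' \<and> (\<forall>a<length I. \<pi> a = a)"
proof -
  have d: "distinct I" "distinct I'" using I I' by (simp_all add: strict_sorted_iff)
  have "set I \<subseteq> set I'"
  proof
    fix i assume "i \<in> set I"
    then obtain a where "a < length I" "i = I ! a" by (metis in_set_conv_nth)
    thus "i \<in> set I'" using match[of a] nth_mem[of "\<pi> a" I'] by simp
  qed
  moreover have "card (set I) = card (set I')" using d len by (simp add: distinct_card)
  ultimately have "set I = set I'" by (intro card_subset_eq) simp_all
  hence eq: "I = I'" using I I' by (intro strict_sorted_equal) simp_all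
  have "\<pi> a = a" if "a < length I" for a
    using match[OF that] that eq nth_eq_iff_index_eq[OF d(2), of a "\<pi> a"] by auto
  thus ?thesis using eq by blast
qed

text \<open>Entries may repeat, so D itself is not determined; the lists agree as multisets, and
  sortedness does the rest.\<close>

lemma sorted_match:
  fixes K K' :: "nat list"
  assumes K: "sorted K" and K': "sorted K'" and len: "length K = N" "length K' = N"
    and D: "inj_on D {..<N}" "\<And>c. c < N \<Longrightarrow> D c < N \<and> K ! c = K' ! D c"
  shows "K = K'"
proof -
  have mset_nth: "mset L = image_mset ((!) L) (mset_set {..<N})" if "length L = N" for L :: "nat list"
  proof -
    have "mset L = mset (map ((!) L) [0..<N])" using that map_nth[of L] by simp
    thus ?thesis by (simp add: lessThan_atLeast0)
  qed
  have surj: "D ` {..<N} = {..<N}" by (rule endo_inj_surj) (use D in auto)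
  have "mset K = image_mset ((!) K) (mset_set {..<N})" by (rule mset_nth[OF len(1)])
  also have "\<dots> = image_mset (\<lambda>c. K' ! D c) (mset_set {..<N})"
    by (rule image_mset_cong) (use D(2) in simp)
  also have "\<dots> = image_mset ((!) K') (image_mset D (mset_set {..<N}))"
    by (simp add: image_mset.compositionality o_def)
  also have "image_mset D (mset_set {..<N}) = mset_set {..<N}"
    using image_mset_mset_set[OF D(1)] surj by simp
  also have "image_mset ((!) K') (mset_set {..<N}) = mset K'" by (rule mset_nth[OF len(2), symmetric])
  finally have "mset K = mset K'" .
  hence "sort K' = K" by (intro properties_for_sort K)
  thus ?thesis using K' by (simp add: sorted_sort_id)
qed

context slots
begin

definition "R = V \<union> Q \<union> W"

text \<open>The exponent of the inverse site carried by slot s, which is the index minus 1. A pair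
  is counted at its slot in Q only.\<close>

definition expo :: "nat list \<times> nat list \<times> nat list \<Rightarrow> nat \<Rightarrow> nat" where
  "expo = (\<lambda>(I, J, K) s. if s \<in> V then I ! (s - 1) - 1 else if s \<in> W then J ! (s - Suc l1) - 1
     else K ! ((s - Suc (Suc (l1 + l2))) div 2) - 1)"

lemma mem_V: "a < l1 \<Longrightarrow> Suc a \<in> V" and mem_W: "b < l2 \<Longrightarrow> Suc (l1 + b) \<in> W" and mem_Q: "c < m \<Longrightarrow> q c \<in> Q"
  by (simp_all add: V_def W_def Q_def)

lemma V_E: assumes "s \<in> V" obtains a where "a < l1" "s = Suc a"
  using assms by (intro that[of "s - 1"]) (auto simp: V_def)

lemma W_E: assumes "s \<in> W" obtains b where "b < l2" "s = Suc (l1 + b)"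
  using assms by (intro that[of "s - Suc l1"]) (auto simp: W_def)

lemma expo_V: "a < l1 \<Longrightarrow> expo (I, J, K) (Suc a) = I ! a - 1"
  using mem_V by (simp add: expo_def)

lemma expo_W:
  assumes "b < l2"
  shows "expo (I, J, K) (Suc (l1 + b)) = J ! b - 1"
  using mem_W[OF assms] slot_notin(2)[OF mem_W[OF assms]] by (simp add: expo_def)

lemma expo_Q:
  assumes "c < m"
  shows "expo (I, J, K) (q c) = K ! c - 1"
proof -
  have "(q c - Suc (Suc (l1 + l2))) div 2 = c" by (simp add: q_def)
  thus ?thesis using slot_notin(4)[OF mem_Q[OF assms]] by (simp add: expo_def)
qed

lemma finite_R [simp]: "finite R"
  by (simp add: R_def)

lemma prod_R: "(\<Prod>s\<in>R. g s) = (\<Prod>s\<in>V. g s) * (\<Prod>s\<in>Q. g s) * (\<Prod>s\<in>W. g s)"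
proof -
  have "(V \<union> Q) \<inter> W = {}" by (auto dest: slot_notin(2))
  thus ?thesis unfolding R_def by (simp add: prod.union_disjoint disjoint_slots)
qed

lemma prod_V: "(\<Prod>a<l1. g (Suc a)) = (\<Prod>s\<in>V. g s)"
  by (rule prod.reindex_bij_witness[of _ "\<lambda>s. s - 1" Suc]) (auto simp: V_def)

lemma prod_W: "(\<Prod>b<l2. g (Suc (l1 + b))) = (\<Prod>s\<in>W. g s)"
  by (rule prod.reindex_bij_witness[of _ "\<lambda>s. s - Suc l1" "\<lambda>b. Suc (l1 + b)"]) (auto simp: W_def)

lemma prod_Q: "(\<Prod>c<m. g (q c)) = (\<Prod>s\<in>Q. g s)"
  unfolding Q_def by (subst prod.reindex) (simp_all add: inj_on_def inj_q)

text \<open>A block permutation merely rearranges the prefactors, so these depend neither on it nor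
  on the index lists and can be divided out. What remains is a monomial in the inverse
  sites.\<close>

lemma slot_weight_block:
  assumes t: "length I = l1" "length J = l2" "length K = m" and \<sigma>: "\<sigma> \<in> block_perms"
  shows "slot_weight n x (I, J, K) (ev \<circ> \<sigma>) (X \<circ> rep \<circ> \<sigma>)
    = (\<Prod>s\<in>V. vval n x 1 (X s)) * (\<Prod>s\<in>Q. pair_weight n x (X s)) * (\<Prod>s\<in>W. vval n x 1 (X s))
      * (\<Prod>s\<in>R. inverse (X (\<sigma> s)) ^ expo (I, J, K) s)"
proof -
  let ?t = "(I, J, K)"
  let ?z = "\<lambda>s. inverse (X (\<sigma> s)) ^ expo ?t s"
  note bij = block_perms_bij[OF \<sigma>]
  have memV: "\<sigma> s \<in> V" if "s \<in> V" for s using bij_betwE[OF bij(1)] that by blast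
  have memW: "\<sigma> s \<in> W" if "s \<in> W" for s using bij_betwE[OF bij(2)] that by blast
  have memQ: "\<sigma> s \<in> Q" if "s \<in> Q" for s using bij_betwE[OF bij(4)] that by blast
  have 1: "(\<Prod>a<length I. if (ev \<circ> \<sigma>) (Suc a) then vval n x 1 ((X \<circ> rep \<circ> \<sigma>) (Suc a)) * inverse ((X \<circ> rep \<circ> \<sigma>) (Suc a)) ^ (I ! a - 1) else 0)
      = (\<Prod>s\<in>V. vval n x 1 (X s)) * (\<Prod>s\<in>V. ?z s)"
  proof -
    have "(\<Prod>a<length I. if (ev \<circ> \<sigma>) (Suc a) then vval n x 1 ((X \<circ> rep \<circ> \<sigma>) (Suc a)) * inverse ((X \<circ> rep \<circ> \<sigma>) (Suc a)) ^ (I ! a - 1) else 0)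
      = (\<Prod>a<l1. vval n x 1 (X (\<sigma> (Suc a))) * ?z (Suc a))"
      unfolding t(1)
    proof (intro prod.cong refl)
      fix a assume "a \<in> {..<l1}"
      hence a: "a < l1" by simp
      have "\<sigma> (Suc a) \<in> V" by (rule memV[OF mem_V[OF a]])
      hence "ev (\<sigma> (Suc a))" "rep (\<sigma> (Suc a)) = \<sigma> (Suc a)"
        using slot_notin(1) by (simp_all add: ev_def rep_not_P)
      thus "(if (ev \<circ> \<sigma>) (Suc a) then vval n x 1 ((X \<circ> rep \<circ> \<sigma>) (Suc a)) * inverse ((X \<circ> rep \<circ> \<sigma>) (Suc a)) ^ (I ! a - 1) else 0)
        = vval n x 1 (X (\<sigma> (Suc a))) * ?z (Suc a)" by (simp add: expo_V[OF a])
    qed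
    also have "\<dots> = (\<Prod>s\<in>V. vval n x 1 (X (\<sigma> s))) * (\<Prod>s\<in>V. ?z s)"
      unfolding prod_V[of "\<lambda>s. vval n x 1 (X (\<sigma> s)) * ?z s"] by (rule prod.distrib)
    also have "(\<Prod>s\<in>V. vval n x 1 (X (\<sigma> s))) = (\<Prod>s\<in>V. vval n x 1 (X s))"
      by (rule prod.reindex_bij_betw[OF bij(1)])
    finally show ?thesis .
  qed
  have 2: "(\<Prod>b<length J. if \<not> (ev \<circ> \<sigma>) (Suc (length I + b)) then vval n x 1 ((X \<circ> rep \<circ> \<sigma>) (Suc (length I + b)))
          * inverse ((X \<circ> rep \<circ> \<sigma>) (Suc (length I + b))) ^ (J ! b - 1) else 0)
      = (\<Prod>s\<in>W. vval n x 1 (X s)) * (\<Prod>s\<in>W. ?z s)"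
  proof -
    have "(\<Prod>b<length J. if \<not> (ev \<circ> \<sigma>) (Suc (length I + b)) then vval n x 1 ((X \<circ> rep \<circ> \<sigma>) (Suc (length I + b)))
          * inverse ((X \<circ> rep \<circ> \<sigma>) (Suc (length I + b))) ^ (J ! b - 1) else 0)
      = (\<Prod>b<l2. vval n x 1 (X (\<sigma> (Suc (l1 + b)))) * ?z (Suc (l1 + b)))"
      unfolding t(1,2)
    proof (intro prod.cong refl)
      fix b assume "b \<in> {..<l2}"
      hence b: "b < l2" by simp
      have "\<sigma> (Suc (l1 + b)) \<in> W" by (rule memW[OF mem_W[OF b]])
      hence "\<not> ev (\<sigma> (Suc (l1 + b)))" "rep (\<sigma> (Suc (l1 + b))) = \<sigma> (Suc (l1 + b))"
        using slot_notin(2) by (simp_all add: ev_def rep_not_P)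
      thus "(if \<not> (ev \<circ> \<sigma>) (Suc (l1 + b)) then vval n x 1 ((X \<circ> rep \<circ> \<sigma>) (Suc (l1 + b)))
          * inverse ((X \<circ> rep \<circ> \<sigma>) (Suc (l1 + b))) ^ (J ! b - 1) else 0)
        = vval n x 1 (X (\<sigma> (Suc (l1 + b)))) * ?z (Suc (l1 + b))" by (simp add: expo_W[OF b])
    qed
    also have "\<dots> = (\<Prod>s\<in>W. vval n x 1 (X (\<sigma> s))) * (\<Prod>s\<in>W. ?z s)"
      unfolding prod_W[of "\<lambda>s. vval n x 1 (X (\<sigma> s)) * ?z s"] by (rule prod.distrib)
    also have "(\<Prod>s\<in>W. vval n x 1 (X (\<sigma> s))) = (\<Prod>s\<in>W. vval n x 1 (X s))"
      by (rule prod.reindex_bij_betw[OF bij(2)])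
    finally show ?thesis .
  qed
  have 3: "(\<Prod>c<length K. if \<not> (ev \<circ> \<sigma>) (Suc (length I + length J + 2 * c)) \<and> (ev \<circ> \<sigma>) (Suc (Suc (length I + length J + 2 * c)))
          \<and> (X \<circ> rep \<circ> \<sigma>) (Suc (length I + length J + 2 * c)) = (X \<circ> rep \<circ> \<sigma>) (Suc (Suc (length I + length J + 2 * c)))
        then pair_weight n x ((X \<circ> rep \<circ> \<sigma>) (Suc (Suc (length I + length J + 2 * c))))
          * inverse ((X \<circ> rep \<circ> \<sigma>) (Suc (Suc (length I + length J + 2 * c)))) ^ (K ! c - 1) else 0)
      = (\<Prod>s\<in>Q. pair_weight n x (X s)) * (\<Prod>s\<in>Q. ?z s)"
  proof -
    have "(\<Prod>c<length K. if \<not> (ev \<circ> \<sigma>) (Suc (length I + length J + 2 * c)) \<and> (ev \<circ> \<sigma>) (Suc (Suc (length I + length J + 2 * c)))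
          \<and> (X \<circ> rep \<circ> \<sigma>) (Suc (length I + length J + 2 * c)) = (X \<circ> rep \<circ> \<sigma>) (Suc (Suc (length I + length J + 2 * c)))
        then pair_weight n x ((X \<circ> rep \<circ> \<sigma>) (Suc (Suc (length I + length J + 2 * c))))
          * inverse ((X \<circ> rep \<circ> \<sigma>) (Suc (Suc (length I + length J + 2 * c)))) ^ (K ! c - 1) else 0)
      = (\<Prod>c<m. pair_weight n x (X (\<sigma> (q c))) * ?z (q c))"
      unfolding t unfolding q_def[symmetric] unfolding p_def[symmetric]
    proof (intro prod.cong refl)
      fix c assume "c \<in> {..<m}"
      hence c: "c < m" by simp
      have "\<exists>d<m. \<sigma> (p c) = p d \<and> \<sigma> (q c) = q d" using \<sigma> c unfolding block_perms_def by blast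
      then obtain d where d: "d < m" "\<sigma> (p c) = p d" "\<sigma> (q c) = q d" by blast
      have pd: "p d \<in> P" using d(1) by (simp add: P_def)
      have "\<not> ev (p d)" "ev (q d)" "rep (p d) = q d" "rep (q d) = q d"
        using slot_notin(3)[OF pd] slot_notin(4)[OF mem_Q[OF d(1)]] mem_Q[OF d(1)] rep_p[OF d(1)]
        by (simp_all add: ev_def rep_not_P)
      thus "(if \<not> (ev \<circ> \<sigma>) (p c) \<and> (ev \<circ> \<sigma>) (q c) \<and> (X \<circ> rep \<circ> \<sigma>) (p c) = (X \<circ> rep \<circ> \<sigma>) (q c)
        then pair_weight n x ((X \<circ> rep \<circ> \<sigma>) (q c)) * inverse ((X \<circ> rep \<circ> \<sigma>) (q c)) ^ (K ! c - 1) else 0)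
        = pair_weight n x (X (\<sigma> (q c))) * ?z (q c)" by (simp add: expo_Q[OF c] d)
    qed
    also have "\<dots> = (\<Prod>s\<in>Q. pair_weight n x (X (\<sigma> s))) * (\<Prod>s\<in>Q. ?z s)"
      unfolding prod_Q[of "\<lambda>s. pair_weight n x (X (\<sigma> s)) * ?z s"] by (rule prod.distrib)
    also have "(\<Prod>s\<in>Q. pair_weight n x (X (\<sigma> s))) = (\<Prod>s\<in>Q. pair_weight n x (X s))"
      by (rule prod.reindex_bij_betw[OF bij(4)])
    finally show ?thesis .
  qed
  show ?thesis
    unfolding slot_weight_def prod.case 1 2 3 prod_R[of ?z] by (simp only: mult_ac)
qed

lemma transpose_block_perms:
  assumes ab: "a \<in> V \<and> b \<in> V \<or> a \<in> W \<and> b \<in> W" and \<sigma>: "\<sigma> \<in> block_perms"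
  shows "Transposition.transpose a b \<circ> \<sigma> \<in> block_perms"
proof -
  let ?\<tau> = "Transposition.transpose a b"
  have fix_other: "?\<tau> s = s" if "s \<notin> V \<union> W" for s
    using that ab by (intro transpose_apply_other) auto
  have "a \<in> {1..l}" "b \<in> {1..l}" unfolding slots_eq using ab by blast+
  hence \<tau>: "?\<tau> permutes {1..l}" by (rule permutes_swap_id)
  have \<tau>V: "?\<tau> s \<in> V" if "s \<in> V" for s
    using that ab slot_notin(1)[of s] by (auto simp: Transposition.transpose_def)
  have \<tau>W: "?\<tau> s \<in> W" if "s \<in> W" for s
    using that ab slot_notin(2)[of s] by (auto simp: Transposition.transpose_def)
  show ?thesis
    unfolding block_perms_def
  proof (intro CollectI conjI allI impI)
    show "(?\<tau> \<circ> \<sigma>) permutes {1..l}" using \<sigma> \<tau> by (simp add: block_perms_def permutes_compose)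
    show "(?\<tau> \<circ> \<sigma>) ` V \<subseteq> V" using bij_betwE[OF block_perms_bij(1)[OF \<sigma>]] \<tau>V by auto
    show "(?\<tau> \<circ> \<sigma>) ` W \<subseteq> W" using bij_betwE[OF block_perms_bij(2)[OF \<sigma>]] \<tau>W by auto
    fix c assume "c < m"
    then obtain d where d: "d < m" "\<sigma> (p c) = p d" "\<sigma> (q c) = q d" using \<sigma> unfolding block_perms_def by blast
    have "p d \<in> P" using d(1) by (simp add: P_def)
    hence "p d \<notin> V \<union> W" "q d \<notin> V \<union> W" using slot_notin(3)[of "p d"] slot_notin(4)[OF mem_Q[OF d(1)]] by simp_all
    hence "?\<tau> (p d) = p d" "?\<tau> (q d) = q d" using fix_other by blast+
    thus "\<exists>d<m. (?\<tau> \<circ> \<sigma>) (p c) = p d \<and> (?\<tau> \<circ> \<sigma>) (q c) = q d" using d by (intro exI[of _ d]) simp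
  qed
qed

text \<open>Composition with the transposition of a and b is a sign-reversing involution of
  \<open>block_perms\<close>. Q has no counterpart, since permutations of the pairs are
  even.\<close>

lemma block_sum_coincidence:
  fixes Z :: "nat \<Rightarrow> complex"
  assumes ab: "a \<in> V \<and> b \<in> V \<or> a \<in> W \<and> b \<in> W" "a \<noteq> b" "Z a = Z b"
  shows "(\<Sum>\<sigma>\<in>block_perms. of_int (sign \<sigma>) * (\<Prod>s\<in>R. Z (\<sigma> s) ^ e s)) = 0"
proof -
  let ?\<tau> = "Transposition.transpose a b"
  let ?h = "\<lambda>\<sigma>. of_int (sign \<sigma>) * (\<Prod>s\<in>R. Z (\<sigma> s) ^ e s)"
  have "(\<Sum>\<sigma>\<in>block_perms. ?h \<sigma>) = (\<Sum>\<sigma>\<in>block_perms. ?h (?\<tau> \<circ> \<sigma>))"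
    by (rule sum.reindex_bij_witness[of _ "\<lambda>\<sigma>. ?\<tau> \<circ> \<sigma>" "\<lambda>\<sigma>. ?\<tau> \<circ> \<sigma>"])
       (simp_all add: transpose_block_perms[OF ab(1)] o_assoc)
  also have "\<dots> = (\<Sum>\<sigma>\<in>block_perms. - ?h \<sigma>)"
  proof (intro sum.cong refl)
    fix \<sigma> assume "\<sigma> \<in> block_perms"
    hence "permutation \<sigma>" by (auto simp: block_perms_def permutation_permutes)
    hence "sign (?\<tau> \<circ> \<sigma>) = - sign \<sigma>"
      using ab(2) by (simp add: sign_compose permutation_swap_id sign_swap_id)
    moreover have "Z (?\<tau> s) = Z s" for s using ab(3) by (simp add: Transposition.transpose_def)
    ultimately show "?h (?\<tau> \<circ> \<sigma>) = - ?h \<sigma>" by simp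
  qed
  finally have "(\<Sum>\<sigma>\<in>block_perms. ?h \<sigma>) = - (\<Sum>\<sigma>\<in>block_perms. ?h \<sigma>)" by (simp only: sum_negf)
  thus ?thesis by simp
qed

text \<open>A block permutation reaches d from exactly one slot, and this slot lies in the same
  block, so its exponent obeys the bound of that block.\<close>

lemma block_sum_poly_lt:
  fixes Z :: "nat \<Rightarrow> complex"
  assumes A: "A = V \<or> A = W \<or> A = Q" and d: "d \<in> A" and e: "\<And>s. s \<in> A \<Longrightarrow> e s < k"
  shows "poly_lt k (\<lambda>z. \<Sum>\<sigma>\<in>block_perms. c * (of_int (sign \<sigma>) * (\<Prod>s\<in>R. (Z(d := z)) (\<sigma> s) ^ e s)))"
proof (rule poly_lt_sum)
  fix \<sigma> assume \<sigma>: "\<sigma> \<in> block_perms"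
  have "bij_betw \<sigma> A A" using A block_perms_bij[OF \<sigma>] by blast
  then obtain s' where s': "s' \<in> A" "\<sigma> s' = d" using d by (metis bij_betw_imp_surj_on imageE)
  have "s' \<in> R" using s'(1) A unfolding R_def by blast
  have inj: "\<sigma> s = d \<longleftrightarrow> s = s'" for s
    using \<sigma> s'(2) permutes_inj[of \<sigma> "{1..l}"] by (auto simp: block_perms_def inj_def)
  have eq: "c * (of_int (sign \<sigma>) * (\<Prod>s\<in>R. (Z(d := z)) (\<sigma> s) ^ e s))
      = c * of_int (sign \<sigma>) * (\<Prod>s\<in>R - {s'}. Z (\<sigma> s) ^ e s) * z ^ e s'" for z
  proof -
    have "(\<Prod>s\<in>R. (Z(d := z)) (\<sigma> s) ^ e s) = (Z(d := z)) (\<sigma> s') ^ e s' * (\<Prod>s\<in>R - {s'}. (Z(d := z)) (\<sigma> s) ^ e s)"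
      by (rule prod.remove[OF finite_R \<open>s' \<in> R\<close>])
    also have "(\<Prod>s\<in>R - {s'}. (Z(d := z)) (\<sigma> s) ^ e s) = (\<Prod>s\<in>R - {s'}. Z (\<sigma> s) ^ e s)"
      by (intro prod.cong refl) (simp add: inj)
    finally show ?thesis by (simp add: s'(2))
  qed
  show "poly_lt k (\<lambda>z. c * (of_int (sign \<sigma>) * (\<Prod>s\<in>R. (Z(d := z)) (\<sigma> s) ^ e s)))"
    unfolding eq by (rule poly_lt_monom[OF e[OF s'(1)]])
qed

text \<open>Strictly increasing I and J fix the permutation on V and W, and K fixes it up to a
  permutation of pairs, which has sign 1. Hence contributions to one monomial cannot cancel.\<close>

lemma expo_match:
  assumes t: "(I, J, K) \<in> index_triples n l" "length I = l1" "length J = l2" "length K = m"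
    and t': "(I', J', K') \<in> index_triples n l" "length I' = l1" "length J' = l2" "length K' = m"
    and \<sigma>: "\<sigma> \<in> block_perms"
    and match: "\<And>s. s \<in> R \<Longrightarrow> expo (I, J, K) s = expo (I', J', K') (\<sigma> s)"
  shows "(I, J, K) = (I', J', K') \<and> sign \<sigma> = 1"
proof -
  note bij = block_perms_bij[OF \<sigma>]
  have pos: "1 \<le> I ! a" "1 \<le> I' ! a" if "a < l1" for a
    using that t t' nth_mem[of a I] nth_mem[of a I'] by (simp_all add: index_triples_def)
  have posJ: "1 \<le> J ! a" "1 \<le> J' ! a" if "a < l2" for a
    using that t t' nth_mem[of a J] nth_mem[of a J'] by (simp_all add: index_triples_def)
  have posK: "1 \<le> K ! a" "1 \<le> K' ! a" if "a < m" for a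
    using that t t' nth_mem[of a K] nth_mem[of a K'] by (simp_all add: index_triples_def)
  have srt: "sorted_wrt (<) I" "sorted_wrt (<) I'" "sorted_wrt (<) J" "sorted_wrt (<) J'" "sorted K" "sorted K'"
    using t(1) t'(1) by (simp_all add: index_triples_def)
  have I: "I = I' \<and> (\<forall>a<length I. \<sigma> (Suc a) - 1 = a)"
  proof (rule strictly_sorted_match[OF srt(1,2)])
    show "length I = length I'" using t t' by simp
    fix a assume "a < length I"
    hence a: "a < l1" using t by simp
    have "\<sigma> (Suc a) \<in> V" using bij_betwE[OF bij(1)] mem_V[OF a] by blast
    then obtain b where b: "b < l1" "\<sigma> (Suc a) = Suc b" by (rule V_E)
    have "Suc a \<in> R" using mem_V[OF a] by (simp add: R_def)
    from match[OF this] have "I ! a - 1 = I' ! b - 1" by (simp add: b expo_V a)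
    hence "I ! a = I' ! b" using pos[OF a] pos[OF b(1)] by linarith
    thus "\<sigma> (Suc a) - 1 < length I' \<and> I ! a = I' ! (\<sigma> (Suc a) - 1)" using b t' by simp
  qed
  have J: "J = J' \<and> (\<forall>a<length J. \<sigma> (Suc (l1 + a)) - Suc l1 = a)"
  proof (rule strictly_sorted_match[OF srt(3,4)])
    show "length J = length J'" using t t' by simp
    fix a assume "a < length J"
    hence a: "a < l2" using t by simp
    have "\<sigma> (Suc (l1 + a)) \<in> W" using bij_betwE[OF bij(2)] mem_W[OF a] by blast
    then obtain b where b: "b < l2" "\<sigma> (Suc (l1 + a)) = Suc (l1 + b)" by (rule W_E)
    have "Suc (l1 + a) \<in> R" using mem_W[OF a] by (simp add: R_def)
    from match[OF this] have "J ! a - 1 = J' ! b - 1" by (simp add: b expo_W a)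
    hence "J ! a = J' ! b" using posJ[OF a] posJ[OF b(1)] by linarith
    thus "\<sigma> (Suc (l1 + a)) - Suc l1 < length J' \<and> J ! a = J' ! (\<sigma> (Suc (l1 + a)) - Suc l1)" using b t' by simp
  qed
  have "\<forall>c<m. \<exists>d<m. \<sigma> (q c) = q d" using \<sigma> unfolding block_perms_def by blast
  then obtain D where D: "\<And>c. c < m \<Longrightarrow> D c < m \<and> \<sigma> (q c) = q (D c)" by metis
  have "K = K'"
  proof (rule sorted_match[OF srt(5,6) t(4) t'(4)])
    show "inj_on D {..<m}"
    proof (rule inj_onI)
      fix c d assume "c \<in> {..<m}" "d \<in> {..<m}" "D c = D d"
      hence "\<sigma> (q c) = \<sigma> (q d)" using D[of c] D[of d] by simp
      moreover have "inj \<sigma>" using \<sigma> permutes_inj by (auto simp: block_perms_def)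
      ultimately show "c = d" using inj_q by (simp add: inj_eq)
    qed
    fix c assume c: "c < m"
    have "q c \<in> R" using mem_Q[OF c] by (simp add: R_def)
    from match[OF this] have "K ! c - 1 = K' ! D c - 1" using D[OF c] by (simp add: expo_Q c)
    thus "D c < m \<and> K ! c = K' ! D c" using posK(1)[OF c] posK(2)[of "D c"] D[OF c] by linarith
  qed
  moreover have "sign \<sigma> = 1"
  proof (rule sign_pair_perm[OF \<sigma>])
    fix s assume "s \<in> V \<union> W"
    then consider "s \<in> V" | "s \<in> W" by blast
    thus "\<sigma> s = s"
    proof cases
      case 1
      then obtain a where a: "a < l1" "s = Suc a" by (rule V_E)
      have "\<sigma> (Suc a) \<in> V" using bij_betwE[OF bij(1)] mem_V[OF a(1)] by blast
      then obtain b where "\<sigma> (Suc a) = Suc b" by (rule V_E)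
      thus ?thesis using I a t(2) by auto
    next
      case 2
      then obtain a where a: "a < l2" "s = Suc (l1 + a)" by (rule W_E)
      have "\<sigma> (Suc (l1 + a)) \<in> W" using bij_betwE[OF bij(2)] mem_W[OF a(1)] by blast
      then obtain b where "\<sigma> (Suc (l1 + a)) = Suc (l1 + b)" by (rule W_E)
      thus ?thesis using J a t(3) by auto
    qed
  qed
  ultimately show ?thesis using I J by blast
qed

text \<open>Entries are at least 1, so subtracting 1 turns the upper bounds on the indices into the
  strict degree bounds of \<open>vanishes_everywhere\<close>.\<close>

lemma expo_less:
  assumes t: "(I, J, K) \<in> index_triples n l" "length I = l1" "length J = l2" "length K = m"
  shows "s \<in> V \<Longrightarrow> expo (I, J, K) s < n"
    and "s \<in> W \<Longrightarrow> expo (I, J, K) s < n - (l1 + m)"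
    and "s \<in> Q \<Longrightarrow> expo (I, J, K) s < n + 1 - (l1 + m)"
    and "l1 + m \<le> n"
proof -
  show "expo (I, J, K) s < n" if s: "s \<in> V"
  proof -
    obtain a where a: "a < l1" "s = Suc a" using s by (rule V_E)
    have "I ! a \<in> set I" using a t by simp
    hence "1 \<le> I ! a \<and> I ! a \<le> n" using t(1) by (simp add: index_triples_def)
    thus ?thesis by (simp add: a(2) expo_V[OF a(1)]) linarith
  qed
  show "expo (I, J, K) s < n - (l1 + m)" if s: "s \<in> W"
  proof -
    obtain a where a: "a < l2" "s = Suc (l1 + a)" using s by (rule W_E)
    have "J ! a \<in> set J" using a t by simp
    hence "1 \<le> J ! a \<and> J ! a + l1 + m \<le> n" using t by (simp add: index_triples_def)
    thus ?thesis by (simp only: a(2) expo_W[OF a(1)]) linarith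
  qed
  have K: "1 \<le> K ! c \<and> K ! c + l1 + m \<le> n + 1" if "c < m" for c
  proof -
    have "K ! c \<in> set K" using that t by simp
    thus ?thesis using t by (simp add: index_triples_def)
  qed
  show "expo (I, J, K) s < n + 1 - (l1 + m)" if s: "s \<in> Q"
  proof -
    obtain c where c: "c < m" "s = q c" using s by (rule Q_E)
    show ?thesis using K[OF c(1)] by (simp only: c(2) expo_Q[OF c(1)]) linarith
  qed
  show "l1 + m \<le> n"
  \<comment> \<open>For m > 0 the bound on an entry of K contains the claim; for m = 0 it bounds the
    length of a strictly increasing list in {1..n}.\<close>
  proof (cases "m = 0")
    case True
    have "set I \<subseteq> {1..n}" "distinct I" using t(1) by (auto simp: index_triples_def strict_sorted_iff)
    hence "length I \<le> n" using card_mono[of "{1..n}" "set I"] by (simp add: distinct_card)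
    thus ?thesis using True t(2) by simp
  next
    case False
    thus ?thesis using K[of 0] by linarith
  qed
qed

text \<open>When exactly \<open>m\<close> of the chosen sites occur in both parities, no $\xi_K$ with more than \<open>m\<close> factors
  can contribute; minimality of \<open>m\<close> excludes shorter ones.\<close>

lemma independence_core:
  assumes Y: "root_set n x Y" and T: "finite T" "T \<subseteq> index_triples n l"
    and t0: "(I0, J0, K0) \<in> T" "length I0 = l1" "length J0 = l2" "length K0 = m"
    and min: "\<And>I J K. (I, J, K) \<in> T \<Longrightarrow> c (I, J, K) \<noteq> 0 \<Longrightarrow> m \<le> length K"
    and zero: "\<And>e u. (\<And>s. s \<in> {1..l} \<Longrightarrow> u s \<in> Y) \<Longrightarrow> (\<Sum>t\<in>T. c t * (\<Sum>\<sigma> | \<sigma> permutes {1..l}.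
      of_int (sign \<sigma>) * slot_weight n x t (e \<circ> \<sigma>) (u \<circ> \<sigma>))) = 0"
  shows "c (I0, J0, K0) = 0"
proof -
  \<comment> \<open>The triples of the shape under test; \<open>f\<close> is what they contribute
    once the common prefactor has been divided out.\<close>
  define T0 where "T0 = {t \<in> T. length (fst t) = l1 \<and> length (fst (snd t)) = l2 \<and> length (snd (snd t)) = m}"
  define f where "f = (\<lambda>Z. \<Sum>t\<in>T0. \<Sum>\<sigma>\<in>block_perms. c t * (of_int (sign \<sigma>) * (\<Prod>s\<in>R. Z (\<sigma> s) ^ expo t s)))"
  have finT0: "finite T0" using T by (simp add: T0_def)
  have T0D: "(I, J, K) \<in> index_triples n l" "length I = l1" "length J = l2" "length K = m" if "(I, J, K) \<in> T0" for I J K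
    using that T(2) by (auto simp: T0_def)
  have t0T0: "(I0, J0, K0) \<in> T0" using t0 by (simp add: T0_def)
  have le: "l1 + m \<le> n" by (rule expo_less(4)[OF T0D[OF t0T0]])
  have Yfin: "finite Y" "card Y = n" and Y0: "\<And>y. y \<in> Y \<Longrightarrow> y \<noteq> 0"
    using Y by (auto simp: root_set_def)
  \<comment> \<open>By \<open>vval_at_root\<close> the values at a root y involve negative powers of
    y, so f is a polynomial in the inverse sites.\<close>
  define Y' where "Y' = inverse ` Y"
  have Y': "finite Y'" "card Y' = n"
    unfolding Y'_def using Yfin by (simp_all add: card_image inj_on_def)
  have van: "vanishes_at_sites Y' f (V \<union> Q \<union> W)"
    unfolding vanishes_at_sites_def
  proof (intro allI impI)
    fix Z assume inj: "inj_on Z (V \<union> Q \<union> W)" and img: "Z ` (V \<union> Q \<union> W) \<subseteq> Y'"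
    define X where "X = (\<lambda>s. inverse (Z s))"
    have XR: "X s \<in> Y" if "s \<in> R" for s
    proof -
      have "Z s \<in> Y'" using that img unfolding R_def by blast
      thus ?thesis by (auto simp: X_def Y'_def)
    qed
    have Xinj: "inj_on X (V \<union> Q \<union> W)" using inj by (simp add: X_def inj_on_def)
    have u: "(X \<circ> rep) s \<in> Y" if "s \<in> {1..l}" for s
    proof -
      have "rep s \<in> R"
      proof (cases "s \<in> P")
        case True
        then obtain d where "d < m" "s = p d" by (rule P_E)
        thus ?thesis using rep_p[of d] mem_Q[of d] by (simp add: R_def)
      next
        case False
        moreover have "s \<in> V \<union> W \<union> P \<union> Q" using that by (simp only: slots_eq)
        ultimately show ?thesis using rep_not_P[OF False] by (simp add: R_def) blast
      qed
      thus ?thesis using XR by simp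
    qed
    define B where "B = (\<Prod>s\<in>V. vval n x 1 (X s)) * (\<Prod>s\<in>Q. pair_weight n x (X s)) * (\<Prod>s\<in>W. vval n x 1 (X s))"
    have v0: "vval n x 1 (X s) \<noteq> 0" "pair_weight n x (X s) \<noteq> 0" if "s \<in> R" for s
      using Y XR[OF that] by (auto simp: root_set_def pair_weight_def)
    have B0: "B \<noteq> 0"
      unfolding B_def using v0 by (simp add: R_def)
    have "0 = (\<Sum>t\<in>T. c t * (\<Sum>\<sigma> | \<sigma> permutes {1..l}. of_int (sign \<sigma>) * slot_weight n x t (ev \<circ> \<sigma>) (X \<circ> rep \<circ> \<sigma>)))"
      using zero[of "X \<circ> rep" ev, OF u] by simp
    \<comment> \<open>Longer K cannot be placed, shorter K have coefficient 0 by minimality, and for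
      K of length m the other two lengths are forced.\<close>
    also have "\<dots> = (\<Sum>t\<in>T0. c t * (\<Sum>\<sigma> | \<sigma> permutes {1..l}. of_int (sign \<sigma>) * slot_weight n x t (ev \<circ> \<sigma>) (X \<circ> rep \<circ> \<sigma>)))"
    proof (rule sum.mono_neutral_right[OF T(1)])
      show "\<forall>t\<in>T - T0. c t * (\<Sum>\<sigma> | \<sigma> permutes {1..l}. of_int (sign \<sigma>) * slot_weight n x t (ev \<circ> \<sigma>) (X \<circ> rep \<circ> \<sigma>)) = 0"
      proof
        fix t assume t: "t \<in> T - T0"
        obtain I J K where IJK: "t = (I, J, K)" by (cases t)
        show "c t * (\<Sum>\<sigma> | \<sigma> permutes {1..l}. of_int (sign \<sigma>) * slot_weight n x t (ev \<circ> \<sigma>) (X \<circ> rep \<circ> \<sigma>)) = 0"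
        proof (cases "c t = 0")
          case False
          have mK: "m \<le> length K" using min[of I J K] t False IJK by simp
          have len: "length I + length J + 2 * length K = l" using t T(2) IJK by (auto simp: index_triples_def)
          have "slot_weight n x t (ev \<circ> \<sigma>) (X \<circ> rep \<circ> \<sigma>) = 0" if "\<sigma> permutes {1..l}" for \<sigma>
            using slot_weight_nonzeroD[OF that Xinj len mK] t unfolding IJK T0_def by auto
          thus ?thesis by simp
        qed simp
      qed
    qed (auto simp: T0_def)
    also have "\<dots> = (\<Sum>t\<in>T0. B * (\<Sum>\<sigma>\<in>block_perms. c t * (of_int (sign \<sigma>) * (\<Prod>s\<in>R. Z (\<sigma> s) ^ expo t s))))"
    proof (rule sum.cong[OF refl])
      fix t assume t: "t \<in> T0"
      obtain I J K where IJK: "t = (I, J, K)" by (cases t)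
      note D = T0D[OF t[unfolded IJK]]
      have len: "length I + length J + 2 * length K = l" using D(2-4) by (simp add: l_def)
      have "(\<Sum>\<sigma> | \<sigma> permutes {1..l}. of_int (sign \<sigma>) * slot_weight n x t (ev \<circ> \<sigma>) (X \<circ> rep \<circ> \<sigma>))
          = (\<Sum>\<sigma>\<in>block_perms. of_int (sign \<sigma>) * slot_weight n x t (ev \<circ> \<sigma>) (X \<circ> rep \<circ> \<sigma>))"
      proof (rule sum.mono_neutral_right)
        show "\<forall>\<sigma>\<in>{\<sigma>. \<sigma> permutes {1..l}} - block_perms. of_int (sign \<sigma>) * slot_weight n x t (ev \<circ> \<sigma>) (X \<circ> rep \<circ> \<sigma>) = 0"
        proof
          fix \<sigma> assume \<sigma>: "\<sigma> \<in> {\<sigma>. \<sigma> permutes {1..l}} - block_perms"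
          hence "slot_weight n x (I, J, K) (ev \<circ> \<sigma>) (X \<circ> rep \<circ> \<sigma>) = 0"
            using slot_weight_nonzeroD[OF _ Xinj len, of \<sigma> n x] D(4) by auto
          thus "of_int (sign \<sigma>) * slot_weight n x t (ev \<circ> \<sigma>) (X \<circ> rep \<circ> \<sigma>) = 0" by (simp add: IJK)
        qed
      qed (auto simp: block_perms_def finite_permutations)
      also have "\<dots> = (\<Sum>\<sigma>\<in>block_perms. B * (of_int (sign \<sigma>) * (\<Prod>s\<in>R. Z (\<sigma> s) ^ expo t s)))"
      proof (rule sum.cong[OF refl])
        fix \<sigma> assume "\<sigma> \<in> block_perms"
        from slot_weight_block[OF D(2-4) this, of n x X]
        show "of_int (sign \<sigma>) * slot_weight n x t (ev \<circ> \<sigma>) (X \<circ> rep \<circ> \<sigma>)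
          = B * (of_int (sign \<sigma>) * (\<Prod>s\<in>R. Z (\<sigma> s) ^ expo t s))"
          by (simp add: IJK B_def X_def)
      qed
      finally show "c t * (\<Sum>\<sigma> | \<sigma> permutes {1..l}. of_int (sign \<sigma>) * slot_weight n x t (ev \<circ> \<sigma>) (X \<circ> rep \<circ> \<sigma>))
        = B * (\<Sum>\<sigma>\<in>block_perms. c t * (of_int (sign \<sigma>) * (\<Prod>s\<in>R. Z (\<sigma> s) ^ expo t s)))"
        by (simp add: sum_distrib_left mult.left_commute)
    qed
    also have "\<dots> = B * f Z" by (simp add: f_def sum_distrib_left)
    finally show "f Z = 0" using B0 by simp
  qed
  have co: "f Z = 0" if "a \<in> V \<and> b \<in> V \<or> a \<in> W \<and> b \<in> W" "a \<noteq> b" "Z a = Z b" for Z a b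
    unfolding f_def
  proof (rule sum.neutral, rule ballI)
    fix t
    show "(\<Sum>\<sigma>\<in>block_perms. c t * (of_int (sign \<sigma>) * (\<Prod>s\<in>R. Z (\<sigma> s) ^ expo t s))) = 0"
      using block_sum_coincidence[OF that, of "expo t"] by (simp add: sum_distrib_left[symmetric])
  qed
  have deg: "poly_lt k (\<lambda>z. f (Z(d := z)))"
    if "A = V \<or> A = W \<or> A = Q" "d \<in> A" "\<And>t s. t \<in> T0 \<Longrightarrow> s \<in> A \<Longrightarrow> expo t s < k" for A d k Z
    unfolding f_def
  proof (rule poly_lt_sum)
    fix t assume t: "t \<in> T0"
    show "poly_lt k (\<lambda>z. \<Sum>\<sigma>\<in>block_perms. c t * (of_int (sign \<sigma>) * (\<Prod>s\<in>R. (Z(d := z)) (\<sigma> s) ^ expo t s)))"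
      by (rule block_sum_poly_lt[OF that(1,2) that(3)[OF t]])
  qed
  have ex: "s \<in> V \<Longrightarrow> expo t s < n" "s \<in> W \<Longrightarrow> expo t s < n - (l1 + m)"
    "s \<in> Q \<Longrightarrow> expo t s < n + 1 - (l1 + m)" if "t \<in> T0" for t s
  proof -
    obtain I J K where e: "t = (I, J, K)" by (cases t)
    note D = T0D[OF that[unfolded e]]
    show "s \<in> V \<Longrightarrow> expo t s < n" "s \<in> W \<Longrightarrow> expo t s < n - (l1 + m)"
      "s \<in> Q \<Longrightarrow> expo t s < n + 1 - (l1 + m)"
      unfolding e using expo_less(1-3)[OF D] by simp_all
  qed
  have f0: "f Z = 0" for Z
  proof (rule vanishes_everywhere[OF Y', of V W Q f])
    show "poly_lt n (\<lambda>z. f (Z(d := z)))" if "d \<in> V" for Z d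
    proof (rule deg[of V])
      fix t s assume "t \<in> T0" "s \<in> V"
      thus "expo t s < n" unfolding card_slots by (rule ex(1))
    qed (use that in simp_all)
    show "poly_lt (n - (card V + card Q)) (\<lambda>z. f (Z(d := z)))" if "d \<in> W" for Z d
    proof (rule deg[of W])
      fix t s assume "t \<in> T0" "s \<in> W"
      thus "expo t s < n - (card V + card Q)" unfolding card_slots by (rule ex(2))
    qed (use that in simp_all)
    show "poly_lt (n + 1 - (card V + card Q)) (\<lambda>z. f (Z(d := z)))" if "d \<in> Q" for Z d
    proof (rule deg[of Q])
      fix t s assume "t \<in> T0" "s \<in> Q"
      thus "expo t s < n + 1 - (card V + card Q)" unfolding card_slots by (rule ex(3))
    qed (use that in simp_all)
    show "f Z = 0" if "a \<in> V" "b \<in> V" "a \<noteq> b" "Z a = Z b" for Z a b by (rule co[of a b]) (use that in simp_all)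
    show "f Z = 0" if "a \<in> W" "b \<in> W" "a \<noteq> b" "Z a = Z b" for Z a b by (rule co[of a b]) (use that in simp_all)
  qed (use van in \<open>simp_all add: disjoint_slots card_slots le\<close>)
  define F where "F = T0 \<times> block_perms"
  define w :: "(nat list \<times> nat list \<times> nat list) \<times> (nat \<Rightarrow> nat) \<Rightarrow> complex"
    where "w = (\<lambda>(t, \<sigma>). c t * of_int (sign \<sigma>))"
  \<comment> \<open>Exponents of the monomial of (t, \<sigma>), with 0 outside R so that agreement
    on R means equality. Repeated entries of K make this map non-injective, hence the fibre sums
    \<open>d\<close>.\<close>
  define \<eta> where "\<eta> = (\<lambda>(t, \<sigma>) r. if r \<in> R then expo t (inv \<sigma> r) else 0)"
  have finF: "finite F" using finT0 by (simp add: F_def)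
  have id_block: "id \<in> block_perms" by (auto simp: block_perms_def permutes_id)
  have permR: "bij_betw \<sigma> R R" if "\<sigma> \<in> block_perms" for \<sigma>
  proof -
    note bij = block_perms_bij[OF that]
    have "\<sigma> ` R = R" using bij unfolding bij_betw_def R_def image_Un by simp
    moreover have "inj_on \<sigma> R" using that by (auto simp: block_perms_def intro: inj_on_subset[OF permutes_inj])
    ultimately show ?thesis by (simp add: bij_betw_def)
  qed
  have inv: "inv \<sigma> (\<sigma> s) = s" if "\<sigma> \<in> block_perms" for \<sigma> s
  proof -
    have "\<sigma> permutes {1..l}" using that unfolding block_perms_def by blast
    thus ?thesis by (rule permutes_inverses(2))
  qed
  have fF: "f Z = (\<Sum>y\<in>F. w y * (\<Prod>r\<in>R. Z r ^ \<eta> y r))" for Z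
  proof -
    have "f Z = (\<Sum>t\<in>T0. \<Sum>\<sigma>\<in>block_perms. w (t, \<sigma>) * (\<Prod>r\<in>R. Z r ^ \<eta> (t, \<sigma>) r))"
      unfolding f_def
    proof (intro sum.cong refl)
      fix t \<sigma> assume "\<sigma> \<in> block_perms"
      have "(\<Prod>s\<in>R. Z (\<sigma> s) ^ expo t s) = (\<Prod>s\<in>R. Z (\<sigma> s) ^ expo t (inv \<sigma> (\<sigma> s)))"
        by (simp add: inv[OF \<open>\<sigma> \<in> block_perms\<close>])
      also have "\<dots> = (\<Prod>r\<in>R. Z r ^ expo t (inv \<sigma> r))"
        by (rule prod.reindex_bij_betw[OF permR[OF \<open>\<sigma> \<in> block_perms\<close>]])
      finally show "c t * (of_int (sign \<sigma>) * (\<Prod>s\<in>R. Z (\<sigma> s) ^ expo t s)) = w (t, \<sigma>) * (\<Prod>r\<in>R. Z r ^ \<eta> (t, \<sigma>) r)"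
        by (simp add: w_def \<eta>_def)
    qed
    thus ?thesis unfolding F_def by (simp add: sum.cartesian_product)
  qed
  define \<eta>0 where "\<eta>0 = \<eta> ((I0, J0, K0), id)"
  define d where "d = (\<lambda>h. \<Sum>y\<in>{y \<in> F. \<eta> y = h}. w y)"
  have "d \<eta>0 = 0"
  proof (rule monomials_independent[where A = R and F = "\<eta> ` F" and e = "\<lambda>h. h" and c = d])
    show "s = t" if "s \<in> \<eta> ` F" "t \<in> \<eta> ` F" "\<And>i. i \<in> R \<Longrightarrow> s i = t i" for s t
    proof
      fix i
      show "s i = t i"
      proof (cases "i \<in> R")
        case False
        thus ?thesis using that(1,2) by (auto simp: \<eta>_def)
      qed (rule that(3))
    qed
    show "(\<Sum>h\<in>\<eta> ` F. d h * (\<Prod>i\<in>R. Z i ^ h i)) = 0" for Z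
    proof -
      have "0 = (\<Sum>y\<in>F. w y * (\<Prod>r\<in>R. Z r ^ \<eta> y r))" using f0[of Z] fF[of Z] by simp
      also have "\<dots> = (\<Sum>h\<in>\<eta> ` F. \<Sum>y\<in>{y \<in> F. \<eta> y = h}. w y * (\<Prod>r\<in>R. Z r ^ \<eta> y r))"
        by (rule sum.image_gen[OF finF])
      also have "\<dots> = (\<Sum>h\<in>\<eta> ` F. d h * (\<Prod>i\<in>R. Z i ^ h i))"
        by (simp add: d_def sum_distrib_right)
      finally show ?thesis ..
    qed
    show "\<eta>0 \<in> \<eta> ` F" unfolding \<eta>0_def F_def using t0T0 id_block by (intro imageI SigmaI)
  qed (use finF in simp_all)
  \<comment> \<open>By \<open>expo_match\<close> the fibre over \<open>\<eta>0\<close> has the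
    single coefficient of the tested triple with sign 1, so its sum is a positive multiple of that
    coefficient.\<close>
  moreover have "w y = c (I0, J0, K0)" if y: "y \<in> F" "\<eta> y = \<eta>0" for y
  proof -
    obtain I J K \<sigma> where ys: "y = ((I, J, K), \<sigma>)" by (metis prod.exhaust)
    have mem: "(I, J, K) \<in> T0" "\<sigma> \<in> block_perms" using y(1) by (simp_all add: ys F_def)
    have "expo (I, J, K) s = expo (I0, J0, K0) (\<sigma> s)" if s: "s \<in> R" for s
    proof -
      have "\<sigma> s \<in> R" using bij_betwE[OF permR[OF mem(2)]] s by blast
      thus ?thesis using fun_cong[OF y(2), of "\<sigma> s"] inv[OF mem(2), of s]
        by (simp add: ys \<eta>0_def \<eta>_def inv_id)
    qed
    from expo_match[OF T0D[OF mem(1)] T0D[OF t0T0] mem(2) this]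
    show ?thesis by (simp add: ys w_def)
  qed
  hence "d \<eta>0 = of_nat (card {y \<in> F. \<eta> y = \<eta>0}) * c (I0, J0, K0)"
    by (simp add: d_def)
  moreover have "((I0, J0, K0), id) \<in> {y \<in> F. \<eta> y = \<eta>0}"
    using t0T0 id_block by (simp add: F_def \<eta>0_def)
  hence "card {y \<in> F. \<eta> y = \<eta>0} \<noteq> 0" using finF card_0_eq[of "{y \<in> F. \<eta> y = \<eta>0}"] by auto
  ultimately show ?thesis by simp
qed

end

text \<open>Every coefficient is 0 or a coordinate up to a sign that is the same for all t, so a
  relation between coordinates extends to all coefficients, over which \<open>mlin\<close>
  sums.\<close>

lemma lincomb_lookup_eq_0:
  assumes b: "\<And>t. t \<in> T \<Longrightarrow> b t \<in> ext_power n l"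
    and coords: "\<And>S. S \<in> subsets (2 * n) l \<Longrightarrow> (\<Sum>t\<in>T. c t * peval x (coord l (b t) S)) = 0"
  shows "(\<Sum>t\<in>T. c t * peval x (Poly_Mapping.lookup (b t) mm)) = 0"
proof (cases "Poly_Mapping.keys mm \<subseteq> {1..l} \<and> (\<forall>i. Poly_Mapping.lookup mm i < 2 * n)")
  case False
  have "Poly_Mapping.lookup (b t) mm = 0" if "t \<in> T" for t
  proof (rule ccontr)
    assume "Poly_Mapping.lookup (b t) mm \<noteq> 0"
    hence "mm \<in> Poly_Mapping.keys (b t)" by (simp add: in_keys_iff)
    thus False using b[OF that] False by (simp add: ext_power_altdef poly_frag_def)
  qed
  thus ?thesis by simp
next
  case True
  define g where "g = Poly_Mapping.lookup mm"
  have m: "mm = tmon l g" using True by (simp add: g_def tmon_lookup)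
  show ?thesis
  proof (cases "inj_on g {1..l}")
    case inj: True
    have "g ` {1..l} \<in> subsets (2 * n) l"
      using True inj by (simp add: subsets_def card_image g_def image_subset_iff)
    note zero = coords[OF this]
    have "c t * peval x (Poly_Mapping.lookup (b t) mm)
        = of_int (tuple_sign l g) * (c t * peval x (coord l (b t) (g ` {1..l})))" if "t \<in> T" for t
      unfolding m tuple_sign(2)[OF inj b[OF that]] by (simp add: peval.hom_mult peval.hom_of_int)
    hence "(\<Sum>t\<in>T. c t * peval x (Poly_Mapping.lookup (b t) mm))
        = (\<Sum>t\<in>T. of_int (tuple_sign l g) * (c t * peval x (coord l (b t) (g ` {1..l}))))"
      by (intro sum.cong refl)
    thus ?thesis unfolding sum_distrib_left[symmetric] zero by simp
  next
    case False
    have "Poly_Mapping.lookup (b t) mm = 0" if "t \<in> T" for t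
      unfolding m by (rule lookup_tmon_not_inj[OF b[OF that] False])
    thus ?thesis by simp
  qed
qed

section \<open>Nonvanishing of the coordinate determinant\<close>

lemma basis_independent_at_ones:
  assumes n: "n \<ge> 1" and l: "l \<ge> 1"
    and coords: "\<And>S. S \<in> subsets (2 * n) l \<Longrightarrow>
      (\<Sum>t\<in>index_triples n l. c t * peval (\<lambda>_. 1) (coord l (basis_elem n t) S)) = 0"
    and t: "t \<in> index_triples n l"
  shows "c t = 0"
proof (rule ccontr)
  assume ct: "c t \<noteq> 0"
  define x :: "nat \<Rightarrow> complex" where "x = (\<lambda>_. 1)"
  define T where "T = index_triples n l"
  obtain Y where Y: "root_set n x Y" using ex_root_set_ones[OF n] unfolding x_def by blast
  \<comment> \<open>A term with K as short as possible: its sites exclude longer K but not shorter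
    ones.\<close>
  obtain t0 where t0: "t0 \<in> T" "c t0 \<noteq> 0"
    and least: "\<And>s. s \<in> T \<Longrightarrow> c s \<noteq> 0 \<Longrightarrow> length (snd (snd t0)) \<le> length (snd (snd s))"
    using ex_has_least_nat[of "\<lambda>s. s \<in> T \<and> c s \<noteq> 0" t "\<lambda>s. length (snd (snd s))"] ct t
    unfolding T_def by blast
  obtain I0 J0 K0 where e0: "t0 = (I0, J0, K0)" by (cases t0)
  have sl: "slots.l (length I0) (length J0) (length K0) = l"
    unfolding slots.l_def using t0(1) by (simp add: e0 T_def index_triples_def)
  have ext: "basis_elem n s \<in> ext_power n l" if "s \<in> T" for s
    using basis_elem_in_U_module[OF n l that[unfolded T_def]] by (simp add: U_module_def)
  define F where "F = (\<Union>s\<in>T. Poly_Mapping.keys (basis_elem n s))"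
  have finF: "finite F" by (simp add: F_def T_def)
  have mlin0: "(\<Sum>s\<in>T. c s * mlin {1..l} x \<Lambda> (basis_elem n s)) = 0" for \<Lambda>
  proof -
    have "(\<Sum>s\<in>T. c s * mlin {1..l} x \<Lambda> (basis_elem n s))
        = (\<Sum>s\<in>T. \<Sum>mm\<in>F. c s * peval x (Poly_Mapping.lookup (basis_elem n s) mm) * (\<Prod>i\<in>{1..l}. \<Lambda> i (Poly_Mapping.lookup mm i)))"
    proof (intro sum.cong refl)
      fix s assume "s \<in> T"
      hence "Poly_Mapping.keys (basis_elem n s) \<subseteq> F" by (auto simp: F_def)
      from mlin_superset[OF finF this, of "{1..l}" x \<Lambda>]
      show "c s * mlin {1..l} x \<Lambda> (basis_elem n s)
        = (\<Sum>mm\<in>F. c s * peval x (Poly_Mapping.lookup (basis_elem n s) mm) * (\<Prod>i\<in>{1..l}. \<Lambda> i (Poly_Mapping.lookup mm i)))"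
        by (simp only: sum_distrib_left mult.assoc)
    qed
    also have "\<dots> = (\<Sum>mm\<in>F. (\<Sum>s\<in>T. c s * peval x (Poly_Mapping.lookup (basis_elem n s) mm)) * (\<Prod>i\<in>{1..l}. \<Lambda> i (Poly_Mapping.lookup mm i)))"
      by (subst sum.swap) (simp only: sum_distrib_right)
    also have "\<dots> = 0"
    proof (rule sum.neutral, rule ballI)
      fix mm
      have "(\<Sum>s\<in>T. c s * peval x (Poly_Mapping.lookup (basis_elem n s) mm)) = 0"
        by (rule lincomb_lookup_eq_0[OF ext]) (use coords in \<open>simp_all add: T_def x_def\<close>)
      thus "(\<Sum>s\<in>T. c s * peval x (Poly_Mapping.lookup (basis_elem n s) mm)) * (\<Prod>i\<in>{1..l}. \<Lambda> i (Poly_Mapping.lookup mm i)) = 0"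
        by simp
    qed
    finally show ?thesis .
  qed
  have "c (I0, J0, K0) = 0"
  proof (rule slots.independence_core[OF Y, of T "length I0" "length J0" "length K0"])
    show "finite T" by (simp add: T_def)
    show "T \<subseteq> index_triples n (slots.l (length I0) (length J0) (length K0))" unfolding sl T_def ..
    show "(I0, J0, K0) \<in> T" using t0(1) e0 by simp
    show "length K0 \<le> length K" if "(I, J, K) \<in> T" "c (I, J, K) \<noteq> 0" for I J K
      using least[OF that] by (simp add: e0)
    fix e :: "nat \<Rightarrow> bool" and u :: "nat \<Rightarrow> complex"
    assume u: "\<And>s. s \<in> {1..slots.l (length I0) (length J0) (length K0)} \<Longrightarrow> u s \<in> Y"
    have "mlin {1..l} x (site_eval e u) (basis_elem n s)
        = (\<Sum>\<sigma> | \<sigma> permutes {1..l}. of_int (sign \<sigma>) * slot_weight n x s (e \<circ> \<sigma>) (u \<circ> \<sigma>))" if s: "s \<in> T" for s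
    proof -
      obtain I J K where es: "s = (I, J, K)" by (cases s)
      have len: "length I + length J + 2 * length K = l"
        and pos: "\<forall>i\<in>set I. 1 \<le> i" "\<forall>i\<in>set J. 1 \<le> i" "\<forall>i\<in>set K. 1 \<le> i"
        using s by (auto simp: es T_def index_triples_def)
      show ?thesis
        unfolding es basis_elem_eq_alt len mlin_alt
      proof (intro sum.cong refl)
        fix \<sigma> assume "\<sigma> \<in> {\<sigma>. \<sigma> permutes {1..l}}"
        hence \<sigma>: "\<sigma> permutes {1..l}" by simp
        have "(u \<circ> \<sigma>) r \<in> Y" if "r \<in> {1..length I + length J + 2 * length K}" for r
          using that permutes_in_image[OF \<sigma>, of r] u[of "\<sigma> r"] unfolding len sl by simp
        from mlin_basis_poly[where ev = "e \<circ> \<sigma>", OF Y this pos]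
        have "mlin {1..l} x (site_eval (e \<circ> \<sigma>) (u \<circ> \<sigma>)) (basis_poly n (I, J, K)) = slot_weight n x (I, J, K) (e \<circ> \<sigma>) (u \<circ> \<sigma>)"
          unfolding len .
        moreover have "site_eval e u \<circ> \<sigma> = site_eval (e \<circ> \<sigma>) (u \<circ> \<sigma>)"
          by (simp add: fun_eq_iff site_eval_def)
        ultimately show "of_int (sign \<sigma>) * mlin {1..l} x (site_eval e u \<circ> \<sigma>) (basis_poly n (I, J, K))
          = of_int (sign \<sigma>) * slot_weight n x (I, J, K) (e \<circ> \<sigma>) (u \<circ> \<sigma>)" by simp
      qed
    qed
    hence "(\<Sum>s\<in>T. c s * (\<Sum>\<sigma> | \<sigma> permutes {1..l}. of_int (sign \<sigma>) * slot_weight n x s (e \<circ> \<sigma>) (u \<circ> \<sigma>)))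
        = (\<Sum>s\<in>T. c s * mlin {1..l} x (site_eval e u) (basis_elem n s))" by simp
    thus "(\<Sum>s\<in>T. c s * (\<Sum>\<sigma> | \<sigma> permutes {1..slots.l (length I0) (length J0) (length K0)}.
        of_int (sign \<sigma>) * slot_weight n x s (e \<circ> \<sigma>) (u \<circ> \<sigma>))) = 0"
      unfolding sl mlin0 .
  qed simp_all
  thus False using t0(2) e0 by simp
qed

text \<open>If the determinant were zero, a kernel vector of the transposed matrix at the all-ones
  point would be a linear relation between the basis elements there.\<close>

lemma det_basis_nonzero:
  assumes n: "n \<ge> 1" and l: "l \<ge> 1" and Ss: "sum_sorted_subsets (2 * n) l Ss"
    and ts: "distinct ts" "set ts = index_triples n l"
  shows "det (coord_mat l (\<lambda>i. basis_elem n (ts ! i)) Ss) \<noteq> 0"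
proof
  define x :: "nat \<Rightarrow> complex" where "x = (\<lambda>_. 1)"
  define A where "A = coord_mat l (\<lambda>i. basis_elem n (ts ! i)) Ss"
  define N where "N = length Ss"
  define M where "M = map_mat (peval x) A"
  assume "det (coord_mat l (\<lambda>i. basis_elem n (ts ! i)) Ss) = 0"
  hence A0: "det A = 0" by (simp add: A_def)
  have len: "length ts = N"
    using length_sum_sorted_subsets[OF Ss] card_index_triples[of n l] distinct_card[OF ts(1)] ts(2) by (simp add: N_def)
  have Mc: "M \<in> carrier_mat N N" by (simp add: M_def A_def N_def)
  have "det M = peval x (det A)" unfolding M_def by (rule peval.hom_det)
  hence "det (transpose_mat M) = 0" by (simp add: det_transpose[OF Mc] A0)
  then obtain v where v: "v \<in> carrier_vec N" "v \<noteq> 0\<^sub>v N" "transpose_mat M *\<^sub>v v = 0\<^sub>v N"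
    using det_0_iff_vec_prod_zero_field[of "transpose_mat M" N] Mc by auto
  have vsum: "(\<Sum>i<N. M $$ (i, j) * v $ i) = 0" if "j < N" for j
  proof -
    have "(transpose_mat M *\<^sub>v v) $ j = 0" using v(3) that by simp
    thus ?thesis using that Mc v(1) by (simp add: scalar_prod_def lessThan_atLeast0)
  qed
  define c where "c = (\<lambda>t. v $ (inv_into {..<N} ((!) ts) t))"
  have inj: "inj_on ((!) ts) {..<N}" using ts(1) by (simp add: inj_on_def nth_eq_iff_index_eq len)
  have c: "c (ts ! i) = v $ i" if "i < N" for i
    unfolding c_def using inv_into_f_f[OF inj, of i] that by simp
  have "c t = 0" if "t \<in> index_triples n l" for t
  proof (rule basis_independent_at_ones[OF n l _ that])
    fix S assume "S \<in> subsets (2 * n) l"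
    then obtain j where j: "j < N" "S = Ss ! j"
      using Ss unfolding sum_sorted_subsets_def N_def by (metis in_set_conv_nth)
    have "(\<Sum>t\<in>index_triples n l. c t * peval (\<lambda>_. 1) (coord l (basis_elem n t) S))
        = (\<Sum>i<N. c (ts ! i) * peval x (coord l (basis_elem n (ts ! i)) S))"
      using sum_over_list[OF ts(1), of "\<lambda>t. c t * peval (\<lambda>_. 1) (coord l (basis_elem n t) S)"]
      by (simp add: len ts(2) x_def)
    also have "\<dots> = (\<Sum>i<N. M $$ (i, j) * v $ i)"
      using j by (intro sum.cong refl) (simp add: c M_def A_def coord_mat_def N_def)
    finally show "(\<Sum>t\<in>index_triples n l. c t * peval (\<lambda>_. 1) (coord l (basis_elem n t) S)) = 0"
      using vsum[OF j(1)] by simp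
  qed
  moreover have "ts ! i \<in> index_triples n l" if "i < N" for i
    using nth_mem[of i ts] that by (simp add: len ts(2))
  ultimately have "v $ i = 0" if "i < N" for i using c[OF that] that by simp
  hence "v = 0\<^sub>v N" using v(1) by (intro eq_vecI) auto
  thus False using v(2) by simp
qed

section \<open>Cramer's rule\<close>

text \<open>Expansion along the replaced row yields cofactors of A; summed over i, they form the
  product of the adjugate with A.\<close>

lemma cramer_rows:
  fixes A :: "'a::comm_ring_1 mat"
  assumes A: "A \<in> carrier_mat N N" and j: "j < N"
  shows "(\<Sum>i<N. det (mat N N (\<lambda>(a, b). if a = i then p b else A $$ (a, b))) * A $$ (i, j)) = det A * p j"
proof -
  have det_row: "det (mat N N (\<lambda>(a, b). if a = i then p b else A $$ (a, b))) = (\<Sum>k<N. p k * cofactor A i k)" if i: "i < N" for i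
  proof -
    define B where "B = mat N N (\<lambda>(a, b). if a = i then p b else A $$ (a, b))"
    have B: "B \<in> carrier_mat N N" by (simp add: B_def)
    have "cofactor B i k = cofactor A i k" if k: "k < N" for k
    proof -
      have "mat_delete B i k = mat_delete A i k"
        unfolding mat_delete_def using A by (intro eq_matI) (auto simp: B_def)
      thus ?thesis by (simp add: cofactor_def)
    qed
    hence "det B = (\<Sum>k<N. p k * cofactor A i k)"
      unfolding laplace_expansion_row[OF B i] using i by (intro sum.cong refl) (simp add: B_def)
    thus ?thesis by (simp add: B_def)
  qed
  have adj: "(\<Sum>i<N. cofactor A i k * A $$ (i, j)) = (if k = j then det A else 0)" if k: "k < N" for k
  proof -
    have "(adj_mat A * A) $$ (k, j) = (\<Sum>i<N. cofactor A i k * A $$ (i, j))"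
      using A j k by (simp add: adj_mat_def scalar_prod_def lessThan_atLeast0)
    thus ?thesis using j k by (cases "k = j") (simp_all add: adj_mat(3)[OF A])
  qed
  have "(\<Sum>i<N. det (mat N N (\<lambda>(a, b). if a = i then p b else A $$ (a, b))) * A $$ (i, j))
      = (\<Sum>i<N. \<Sum>k<N. p k * (cofactor A i k * A $$ (i, j)))"
    by (intro sum.cong refl) (simp add: det_row sum_distrib_right mult.assoc)
  also have "\<dots> = (\<Sum>k<N. p k * (\<Sum>i<N. cofactor A i k * A $$ (i, j)))"
    by (subst sum.swap) (simp only: sum_distrib_left)
  also have "\<dots> = (\<Sum>k<N. if k = j then p k * det A else 0)"
    by (intro sum.cong refl) (simp add: adj)
  also have "\<dots> = det A * p j" using j by (simp add: mult.commute)
  finally show ?thesis .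
qed

text \<open>Multiplication by the adjugate gives c k * det A = 0, without leaving the ring.\<close>

lemma left_kernel_zero:
  fixes A :: "'a::idom mat"
  assumes A: "A \<in> carrier_mat N N" and det: "det A \<noteq> 0"
    and zero: "\<And>j. j < N \<Longrightarrow> (\<Sum>i<N. c i * A $$ (i, j)) = 0" and k: "k < N"
  shows "c k = 0"
proof -
  have adj: "(\<Sum>j<N. A $$ (i, j) * cofactor A k j) = (if i = k then det A else 0)" if i: "i < N" for i
  proof -
    have "(A * adj_mat A) $$ (i, k) = (\<Sum>j<N. A $$ (i, j) * cofactor A k j)"
      using A i k by (simp add: adj_mat_def scalar_prod_def lessThan_atLeast0)
    thus ?thesis using i k by (cases "i = k") (simp_all add: adj_mat(2)[OF A])
  qed
  have "0 = (\<Sum>j<N. (\<Sum>i<N. c i * A $$ (i, j)) * cofactor A k j)" using zero by simp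
  also have "\<dots> = (\<Sum>j<N. \<Sum>i<N. c i * (A $$ (i, j) * cofactor A k j))"
    by (simp only: sum_distrib_right mult.assoc)
  also have "\<dots> = (\<Sum>i<N. c i * (\<Sum>j<N. A $$ (i, j) * cofactor A k j))"
    by (subst sum.swap) (simp only: sum_distrib_left)
  also have "\<dots> = (\<Sum>i<N. if i = k then c i * det A else 0)"
    by (intro sum.cong refl) (simp add: adj)
  also have "\<dots> = c k * det A" using k by simp
  finally show ?thesis using det by simp
qed

lemma poly_vars_poly_subst_Const:
  assumes "\<And>i. poly_vars (f i) \<subseteq> A"
  shows "poly_vars (poly_subst Const f p :: 'a::comm_ring_1 mpoly) \<subseteq> A"
proof (induction p rule: mpoly_induct)
  case (add m a p)
  have pw: "poly_vars (f i ^ k) \<subseteq> A" for i k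
    using poly_vars_prod_subset[of "{..<k}" "\<lambda>_. f i" A] assms by simp
  have "poly_vars (\<Prod>i\<in>Poly_Mapping.keys m. f i ^ Poly_Mapping.lookup m i) \<subseteq> A"
    by (rule poly_vars_prod_subset) (rule pw)
  hence "poly_vars (poly_subst Const f (Poly_Mapping.single m a)) \<subseteq> A"
    using poly_vars_mult[of "Const a" "\<Prod>i\<in>Poly_Mapping.keys m. f i ^ Poly_Mapping.lookup m i"]
    by (simp add: poly_subst_single)
  hence "poly_vars (poly_subst Const f (Poly_Mapping.single m a)) \<union> poly_vars (poly_subst Const f p) \<subseteq> A"
    using add by (rule Un_least)
  thus ?case unfolding subst_Const.hom_add by (rule order_trans[OF poly_vars_add])
qed simp

lemma sym_polys_quotient:
  assumes d: "d \<in> sym_polys N" "d \<noteq> 0" and dg: "d * g \<in> sym_polys N"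
  shows "g \<in> sym_polys N"
proof -
  \<comment> \<open>Setting the variables outside {1..N} to 0 fixes d and d * g, and hence g after
    cancelling d; so g involves no such variables.\<close>
  define kill where "kill = poly_subst Const (\<lambda>i. if i \<in> {1..N} then Var i else (0 :: xpoly))"
  have kill_id: "kill p = p" if "poly_vars p \<subseteq> {1..N}" for p :: xpoly
  proof -
    have "kill p = poly_subst Const Var p"
      unfolding kill_def poly_subst_def
      by (intro sum.cong refl arg_cong2[where f = "(*)"] prod.cong) (use that in \<open>auto simp: poly_vars_def\<close>)
    thus ?thesis by simp
  qed
  have "d * kill g = kill (d * g)"
    using kill_id[of d] d(1) by (simp add: kill_def subst_Const.hom_mult sym_polys_def)
  also have "\<dots> = d * g" using kill_id dg by (simp add: sym_polys_def)
  finally have "kill g = g" using d(2) by simp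
  moreover have "poly_vars (kill g) \<subseteq> {1..N}"
    unfolding kill_def by (rule poly_vars_poly_subst_Const) simp
  ultimately have "poly_vars g \<subseteq> {1..N}" by simp
  moreover have "rename \<pi> g = g" if "\<pi> permutes {1..N}" for \<pi>
  proof -
    have "d * rename \<pi> g = rename \<pi> d * rename \<pi> g" using d(1) that by (simp add: sym_polys_def)
    also have "\<dots> = d * g" using dg that by (simp add: sym_polys_def rename_mult)
    finally show ?thesis using d(2) by simp
  qed
  ultimately show ?thesis by (simp add: sym_polys_def)
qed

lemma lincomb_in_U_module:
  assumes "\<And>t. t \<in> T \<Longrightarrow> b t \<in> U_module n l" "\<And>t. t \<in> T \<Longrightarrow> c t \<in> sym_polys (2 * n)"
  shows "(\<Sum>t\<in>T. Const (c t) * b t) \<in> U_module n l"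
proof -
  have ext: "b t \<in> poly_frag n {1..l}" "\<And>\<pi>. \<pi> permutes {1..l} \<Longrightarrow> rename \<pi> (b t) = of_int (sign \<pi>) * b t"
    if "t \<in> T" for t
    using assms(1)[OF that] unfolding U_module_def ext_power_altdef by blast+
  have "(\<Sum>t\<in>T. Const (c t) * b t) \<in> poly_frag n {1..l}"
    using ext(1) assms(2) by (intro poly_frag_sum poly_frag_Const_mult)
  moreover have "rename \<pi> (\<Sum>t\<in>T. Const (c t) * b t) = of_int (sign \<pi>) * (\<Sum>t\<in>T. Const (c t) * b t)"
    if "\<pi> permutes {1..l}" for \<pi>
    unfolding rename_sum rename_mult rename_Const sum_distrib_left
    by (intro sum.cong refl) (simp only: ext(2)[OF _ that] mult.left_commute)
  moreover have "Xeval (X(l := z)) (x(2 * n - 1 := t, 2 * n := - t)) (\<Sum>s\<in>T. Const (c s) * b s) = 0"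
    if "t \<noteq> 0" "z = inverse t \<or> z = - inverse t" for X x t z
    unfolding Xeval.hom_sum Xeval.hom_mult
  proof (rule sum.neutral, rule ballI)
    fix s assume "s \<in> T"
    hence "Xeval (X(l := z)) (x(2 * n - 1 := t, 2 * n := - t)) (b s) = 0"
      using assms(1) that unfolding U_module_def by blast
    thus "Xeval (X(l := z)) (x(2 * n - 1 := t, 2 * n := - t)) (Const (c s)) * Xeval (X(l := z)) (x(2 * n - 1 := t, 2 * n := - t)) (b s) = 0"
      by simp
  qed
  ultimately show ?thesis by (simp add: U_module_def ext_power_altdef)
qed

lemma coord_sum_Const_mult: "coord l (\<Sum>t\<in>T. Const (c t) * b t) S = (\<Sum>t\<in>T. c t * coord l (b t) S)"
  by (simp add: coord_def lookup_sum)

theorem theorem5: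
  fixes n l :: nat
  assumes "n \<ge> 1" and "l \<ge> 1"
  shows "free_basis (sym_polys (2 * n)) (U_module n l) (index_triples n l) (basis_elem n)
    \<and> card (index_triples n l) = (2 * n) choose l"
proof
  note n = assms(1) and l = assms(2)
  define T where "T = index_triples n l"
  define b where "b = basis_elem n"
  define R where "R = sym_polys (2 * n)"
  define m where "m = ((2 * n) choose l) - ((2 * n - 2) choose l)"
  obtain Ss where Ss: "sum_sorted_subsets (2 * n) l Ss" using ex_sum_sorted_subsets by blast
  obtain ts where ts: "set ts = T" "distinct ts" using finite_distinct_list[of T] by (auto simp: T_def)
  define N where "N = length Ss"
  define A where "A = coord_mat l (\<lambda>i. b (ts ! i)) Ss"
  have A: "A \<in> carrier_mat N N" by (simp add: A_def N_def)
  have Aij: "A $$ (i, j) = coord l (b (ts ! i)) (Ss ! j)" if "i < N" "j < N" for i j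
    using that by (simp add: A_def coord_mat_def N_def)
  have len: "length ts = N"
    using length_sum_sorted_subsets[OF Ss] card_index_triples[of n l] distinct_card[OF ts(2)] ts(1) by (simp add: N_def T_def)
  have bU: "b t \<in> U_module n l" if "t \<in> T" for t
    using basis_elem_in_U_module[OF n l] that by (simp add: b_def T_def)
  have ti: "ts ! i \<in> T" if "i < N" for i using nth_mem[of i ts] that by (simp add: len ts(1))
  have Sj: "Ss ! j \<in> subsets (2 * n) l" if "j < N" for j
  proof -
    have "Ss ! j \<in> set Ss" using that by (simp add: N_def)
    moreover have "set Ss = subsets (2 * n) l" using Ss by (simp add: sum_sorted_subsets_def)
    ultimately show ?thesis by simp
  qed
  have Sj': "\<exists>j<N. S = Ss ! j" if "S \<in> subsets (2 * n) l" for S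
    using that Ss unfolding sum_sorted_subsets_def N_def by (metis in_set_conv_nth)
  have detR: "det (coord_mat l F Ss) \<in> R" if "\<And>i. i < N \<Longrightarrow> F i \<in> U_module n l" for F
    unfolding R_def
  proof (rule det_in_sym_polys[OF coord_mat_carrier])
    fix i j assume "i < length Ss" "j < length Ss"
    thus "coord_mat l F Ss $$ (i, j) \<in> sym_polys (2 * n)"
      using that[of i] coord_in_sym_polys[of "F i" n l "Ss ! j"] by (simp add: coord_mat_def U_module_def N_def)
  qed
  have detA0: "det A \<noteq> 0"
    unfolding A_def b_def by (rule det_basis_nonzero[OF n l Ss ts(2) ts(1)[unfolded T_def]])
  obtain \<kappa> where \<kappa>: "det A = sum_prod (2 * n) ^ m * Const \<kappa>"
    using det_basis_eq_const_mult[OF n l Ss ts(2) ts(1)[unfolded T_def]] unfolding A_def b_def m_def by blast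
  have \<kappa>0: "\<kappa> \<noteq> 0" using \<kappa> detA0 by auto
  \<comment> \<open>The symmetry of D^m is read off from the determinant of the basis, of which it
    is a constant multiple.\<close>
  have DR: "sum_prod (2 * n) ^ m \<in> R"
  proof -
    have "sum_prod (2 * n) ^ m = det A * Const (inverse \<kappa>)"
      unfolding \<kappa> mult.assoc Const.hom_mult[symmetric] using \<kappa>0 by simp
    moreover have "det A \<in> R" unfolding A_def by (rule detR) (rule bU[OF ti])
    ultimately show ?thesis by (simp add: R_def sym_polys_mult)
  qed
  show "card (index_triples n l) = (2 * n) choose l" by (rule card_index_triples)
  have span: "P \<in> {(\<Sum>t\<in>T. Const (c t) * b t) | c. \<forall>t\<in>T. c t \<in> R}" if P: "P \<in> U_module n l" for P
  proof -
    \<comment> \<open>Row i of the coordinate matrix is replaced by P. All rows still come from the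
      module, so D^m divides the new determinant as well.\<close>
    define F where "F = (\<lambda>i k. if k = i then P else b (ts ! k))"
    have FU: "F i k \<in> U_module n l" if "k < N" for i k using P bU[OF ti[OF that]] by (simp add: F_def)
    have "sum_prod (2 * n) ^ m dvd det (coord_mat l (F i) Ss)" for i
      unfolding m_def by (rule sum_prod_power_dvd_det[OF n l Ss]) (simp add: FU N_def)
    then obtain g where g: "\<And>i. det (coord_mat l (F i) Ss) = sum_prod (2 * n) ^ m * g i"
      unfolding dvd_def by metis
    have gR: "g i \<in> R" for i
      unfolding R_def
    proof (rule sym_polys_quotient)
      show "sum_prod (2 * n) ^ m \<in> sym_polys (2 * n)" using DR by (simp add: R_def)
      show "sum_prod (2 * n) ^ m \<noteq> 0" by (simp add: sum_prod_nonzero)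
      show "sum_prod (2 * n) ^ m * g i \<in> sym_polys (2 * n)"
        unfolding g[symmetric] using detR[OF FU] by (simp add: R_def)
    qed
    \<comment> \<open>The quotient in Cramer's rule: D^m * g i divided by det A = \<kappa>
      D^m.\<close>
    define c where "c = (\<lambda>t. Const (inverse \<kappa>) * g (inv_into {..<N} ((!) ts) t))"
    have inj: "inj_on ((!) ts) {..<N}" using ts(2) by (simp add: inj_on_def nth_eq_iff_index_eq len)
    have ci: "c (ts ! i) = Const (inverse \<kappa>) * g i" if "i < N" for i
      unfolding c_def using inv_into_f_f[OF inj, of i] that by simp
    have cR: "\<forall>t\<in>T. c t \<in> R" using gR by (simp add: c_def R_def sym_polys_mult)
    have coordF: "coord_mat l (F i) Ss = mat N N (\<lambda>(a, k). if a = i then coord l P (Ss ! k) else A $$ (a, k))" for i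
      by (intro eq_matI) (auto simp: coord_mat_def N_def F_def A_def)
    have "P = (\<Sum>t\<in>T. Const (c t) * b t)"
    proof (rule ext_power_eqI)
      show "P \<in> ext_power n l" using P by (simp add: U_module_def)
      show "(\<Sum>t\<in>T. Const (c t) * b t) \<in> ext_power n l"
        using lincomb_in_U_module[of T b n l c] bU cR by (simp add: U_module_def R_def)
      fix S assume "S \<in> subsets (2 * n) l"
      then obtain j where j: "j < N" "S = Ss ! j" using Sj' by blast
      have "det A * coord l (\<Sum>t\<in>T. Const (c t) * b t) S = det A * (\<Sum>i<N. c (ts ! i) * coord l (b (ts ! i)) S)"
        unfolding coord_sum_Const_mult using sum_over_list[OF ts(2), of "\<lambda>t. c t * coord l (b t) S"] by (simp add: len ts(1))
      also have "\<dots> = (\<Sum>i<N. det A * (Const (inverse \<kappa>) * g i) * A $$ (i, j))"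
        unfolding sum_distrib_left by (intro sum.cong refl) (simp add: ci Aij j mult.assoc)
      also have "\<dots> = (\<Sum>i<N. sum_prod (2 * n) ^ m * g i * A $$ (i, j))"
      proof (intro sum.cong refl)
        fix i
        have "det A * (Const (inverse \<kappa>) * g i) = sum_prod (2 * n) ^ m * g i * Const (\<kappa> * inverse \<kappa>)"
          unfolding \<kappa> Const.hom_mult by (simp only: mult_ac)
        thus "det A * (Const (inverse \<kappa>) * g i) * A $$ (i, j) = sum_prod (2 * n) ^ m * g i * A $$ (i, j)"
          using \<kappa>0 by simp
      qed
      also have "\<dots> = det A * coord l P (Ss ! j)"
        unfolding g[symmetric] coordF by (rule cramer_rows[OF A j(1), of "\<lambda>k. coord l P (Ss ! k)"])
      finally show "coord l P S = coord l (\<Sum>t\<in>T. Const (c t) * b t) S"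
        using detA0 by (simp add: j(2))
    qed
    thus ?thesis using cR by blast
  qed
  have "U_module n l = {(\<Sum>t\<in>T. Const (c t) * b t) | c. \<forall>t\<in>T. c t \<in> R}"
  proof
    show "U_module n l \<subseteq> {(\<Sum>t\<in>T. Const (c t) * b t) | c. \<forall>t\<in>T. c t \<in> R}" using span by blast
    show "{(\<Sum>t\<in>T. Const (c t) * b t) | c. \<forall>t\<in>T. c t \<in> R} \<subseteq> U_module n l"
    proof clarify
      fix c assume "\<forall>t\<in>T. c t \<in> R"
      thus "(\<Sum>t\<in>T. Const (c t) * b t) \<in> U_module n l"
        by (intro lincomb_in_U_module bU) (simp_all add: R_def)
    qed
  qed
  moreover have "c t = 0" if zero: "(\<Sum>t\<in>T. Const (c t) * b t) = 0" and t: "t \<in> T" for c t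
  proof -
    obtain k where k: "k < N" "t = ts ! k" using t ts(1) len by (metis in_set_conv_nth)
    have "c (ts ! k) = 0"
    proof (rule left_kernel_zero[OF A detA0 _ k(1), of "\<lambda>i. c (ts ! i)"])
      fix j assume j: "j < N"
      have "(\<Sum>i<N. c (ts ! i) * A $$ (i, j)) = (\<Sum>i<N. c (ts ! i) * coord l (b (ts ! i)) (Ss ! j))"
        using j by (intro sum.cong refl) (simp add: Aij)
      also have "\<dots> = coord l (\<Sum>t\<in>T. Const (c t) * b t) (Ss ! j)"
        unfolding coord_sum_Const_mult using sum_over_list[OF ts(2), of "\<lambda>t. c t * coord l (b t) (Ss ! j)"] by (simp add: len ts(1))
      also have "\<dots> = 0" unfolding zero by (simp add: coord_def)
      finally show "(\<Sum>i<N. c (ts ! i) * A $$ (i, j)) = 0" .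
    qed
    thus ?thesis by (simp add: k(2))
  qed
  ultimately show "free_basis (sym_polys (2 * n)) (U_module n l) (index_triples n l) (basis_elem n)"
    unfolding free_basis_def T_def[symmetric] b_def[symmetric] R_def[symmetric]
    by (intro conjI allI impI ballI) (simp_all add: T_def)
qed

end
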